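(* Let $k \geq 5$ and $G$ a $k$-dicritical digraph. Then \[\lvert A(G)\rvert \ge (k-\frac 1 2 - \frac 1 {k-1}) \lvert V(G)\rvert - k(\frac 1 2 - \frac 1 {k-1}).\]
   Context: A digraph $G$ is $k$-dicritical if its dichromatic number (minimum number of parts in a partition of $V(G)$ into sets inducing acyclic subdigraphs) is $k$ and every proper subdigraph has dichromatic number at most $k-1$. *)

theory Defs
  imports
    Complex_Main
    "HOL-Library.Disjoint_Sets"
    "Graph_Theory.Digraph_Component"
begin

(* pre_digraph.cycle counts a pair of opposite arcs as a (directed) cycle of length two. *)
definition acyclic_digraph :: "('a, 'b) pre_digraph \<Rightarrow> bool" where
  "acyclic_digraph G \<longleftrightarrow> \<not> (\<exists>p. pre_digraph.cycle G p)"

definition acyclic_partition :: "('a, 'b) pre_digraph \<Rightarrow> 'a set set \<Rightarrow> bool" where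
  "acyclic_partition G P \<longleftrightarrow>
     partition_on (verts G) P \<and> (\<forall>S\<in>P. acyclic_digraph (G \<restriction> S))"

(* Meaningful for finite loopless digraphs: there the partition into singletons is acyclic,
   so the minimum is attained. *)
definition dichromatic_number :: "('a, 'b) pre_digraph \<Rightarrow> nat" where
  "dichromatic_number G = (LEAST n. \<exists>P. acyclic_partition G P \<and> finite P \<and> card P = n)"

(* The relation subgraph forces equal tail and head maps, so H \<noteq> G says that H misses
   a vertex or an arc of G. *)
definition dicritical :: "nat \<Rightarrow> ('a, 'b) pre_digraph \<Rightarrow> bool" where
  "dicritical k G \<longleftrightarrow>
     dichromatic_number G = k \<and>
     (\<forall>H. subgraph H G \<and> H \<noteq> G \<longrightarrow> dichromatic_number H \<le> k - 1)"

end

(* Among the counterexamples for fixed k take one with fewest vertices, then fewest arcs, then most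
   pairs of twins. As in the Kostochka-Yancey proof of the corresponding bound for graphs, give a
   vertex set R the potential (k - 1/2 - 1/(k-1)) |R| - |A(G[R])|. Contracting the colour classes of a
   dicolouring of G[R] shows that every proper R with at least k vertices has large potential, so a few
   arcs may be added to a proper subdigraph without destroying its (k-1)-dicolourability. Applied around
   a vertex x of in- and out-degree k-1 lying in t-1 twin pairs, this gives every out-neighbour of x
   outside its twin class in-degree at least k-1+t, and dually, with one controlled exception.
   Discharging then bounds the number of arcs; the arcs between vertices of degree 2(k-1) and vertices
   of degree 2k-1 are counted by Galvin's kernel method. *)
theory Submission
  imports Defs
begin

section \<open>Acyclic relations\<close>

text \<open>With \<open>c = k - 1\<close> colours only the monochromatic arcs must be acyclic. So a
  vertex added to a dicoloured set need only avoid the colours of its out-neighbours, or only those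
  of its in-neighbours; most extension arguments mix these two one-sided rules. The threshold
  \<open>(3 * c - 2) / 2\<close> for proper vertex sets is the potential of the complete digraph on
  \<open>c\<close> vertices, the least value among complete digraphs on 2 to \<open>c\<close>
  vertices. This is what expanding a contraction saves when at least two colour classes are used. If
  only one class is used, less is saved; this obstacle is why digons between boundary vertices are
  added before colouring. In the discharging a vertex of degree \<open>2 * c\<close> lacks
  \<open>1 - 2 / c\<close>, while a vertex of degree \<open>2 * c + 1\<close> has only
  \<open>2 / c\<close> to spare. Vertices of higher degree can pay along every arc, but those of
  degree \<open>2 * c + 1\<close> cannot, so their arcs to vertices of degree \<open>2 * c\<close>
  have to be few. The outcome is potential at most 0; the positive constant \<open>potK c\<close> is
  there because complete digraphs on \<open>c + 1\<close> vertices attain it.\<close>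

lemma acyclic_empty_rel [simp]: "acyclic {}"
  by (simp add: acyclic_def)

lemma acyclic_hom:
  assumes "acyclic s" and "\<And>u v. (u, v) \<in> r \<Longrightarrow> (h u, h v) \<in> s"
  shows "acyclic r"
proof -
  have "(h u, h v) \<in> s\<^sup>+" if "(u, v) \<in> r\<^sup>+" for u v
    using that by (induction rule: trancl_induct) (auto intro: assms(2) trancl_into_trancl)
  then show ?thesis
    using assms(1) by (meson acyclic_def)
qed

text \<open>A cycle either stays in one fibre of \<open>h\<close>, using \<open>r1\<close> only, or
  is mapped to a closed walk of \<open>s\<close>. This pulls a dicolouring of a contracted digraph
  back: \<open>r1\<close> holds the contracted arcs.\<close>

lemma acyclic_quotient:
  assumes "acyclic s" and "acyclic r1"
    and "\<And>u v. (u, v) \<in> r1 \<Longrightarrow> h u = h v" and "\<And>u v. (u, v) \<in> r2 \<Longrightarrow> (h u, h v) \<in> s"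
  shows "acyclic (r1 \<union> r2)"
proof -
  have "((u, v) \<in> r1\<^sup>+ \<and> h u = h v) \<or> (h u, h v) \<in> s\<^sup>+" if "(u, v) \<in> (r1 \<union> r2)\<^sup>+" for u v
    using that
  proof (induction rule: trancl_induct)
    case (base y)
    then show ?case using assms(3,4) by blast
  next
    case (step y z)
    then show ?case
      using assms(3,4) by (metis Un_iff trancl.r_into_trancl trancl.trancl_into_trancl)
  qed
  then show ?thesis
    using assms(1,2) by (meson acyclic_def)
qed

text \<open>No arc enters \<open>X\<close> from outside, so a cycle lies wholly inside
  \<open>X\<close> or wholly outside. With monochromatic arcs as \<open>r\<close> this is the gluing
  principle for dicolourings.\<close>

lemma acyclic_split:
  assumes "\<And>u v. (u, v) \<in> r \<Longrightarrow> v \<in> X \<Longrightarrow> u \<in> X"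
    and "acyclic (r \<inter> X \<times> X)" and "acyclic (r \<inter> (- X) \<times> (- X))"
  shows "acyclic r"
proof (rule acyclicI, rule allI, rule notI)
  fix x assume c: "(x, x) \<in> r\<^sup>+"
  show False
  proof (cases "x \<in> X")
    case True
    have "v \<in> X \<longrightarrow> u \<in> X \<and> (u, v) \<in> (r \<inter> X \<times> X)\<^sup>+" if "(u, v) \<in> r\<^sup>+" for u v
      using that
    proof (induction rule: trancl_induct)
      case (base y)
      then show ?case using assms(1) by blast
    next
      case (step y z)
      then show ?case using assms(1) by (metis IntI SigmaI trancl.trancl_into_trancl)
    qed
    then show False using c True assms(2) by (meson acyclic_def)
  next
    case False
    have "u \<notin> X \<longrightarrow> v \<notin> X \<and> (u, v) \<in> (r \<inter> (- X) \<times> (- X))\<^sup>+" if "(u, v) \<in> r\<^sup>+" for u v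
      using that
    proof (induction rule: trancl_induct)
      case (base y)
      then show ?case using assms(1) by blast
    next
      case (step y z)
      then show ?case
        using assms(1) by (metis ComplI IntI SigmaI trancl.trancl_into_trancl)
    qed
    then show False using c False assms(3) by (meson acyclic_def)
  qed
qed

lemma acyclic_split_out:
  assumes "\<And>u v. (u, v) \<in> r \<Longrightarrow> u \<in> X \<Longrightarrow> v \<in> X"
    and "acyclic (r \<inter> X \<times> X)" and "acyclic (r \<inter> (- X) \<times> (- X))"
  shows "acyclic r"
  by (rule acyclic_split[where X = "- X"]) (use assms in auto)

text \<open>If nothing reachable from \<open>x\<close> through \<open>R\<close> had an arc back to
  \<open>x\<close>, the reachable set would be closed under out-arcs and avoid \<open>x\<close>, so
  no cycle could use \<open>x\<close>. This turns a failed colour for one vertex into a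
  monochromatic path.\<close>

lemma cycle_through:
  assumes "acyclic (r \<inter> R \<times> R)" and "(x, x) \<notin> r"
    and "\<not> acyclic (r \<inter> insert x R \<times> insert x R)"
  shows "\<exists>u z. u \<in> R \<and> z \<in> R \<and> (x, u) \<in> r \<and> (u, z) \<in> (r \<inter> R \<times> R)\<^sup>* \<and> (z, x) \<in> r"
proof (rule ccontr)
  assume neg: "\<not> ?thesis"
  let ?q = "r \<inter> insert x R \<times> insert x R"
  have x: "x \<notin> R"
    using assms(1,3) by (metis insert_absorb)
  let ?X = "{v. \<exists>u. (x, u) \<in> ?q \<and> u \<in> R \<and> (u, v) \<in> (r \<inter> R \<times> R)\<^sup>*}"
  have sub: "?X \<subseteq> R"
  proof
    fix v assume "v \<in> ?X"
    then obtain u where "u \<in> R" "(u, v) \<in> (r \<inter> R \<times> R)\<^sup>*" by blast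
    then show "v \<in> R" by (metis IntD2 SigmaE2 rtranclE)
  qed
  have cl: "v \<in> ?X" if "(u, v) \<in> ?q" "u \<in> ?X" for u v
  proof -
    have "u \<in> R" using sub that(2) by blast
    have "v \<noteq> x" using neg that sub by blast
    then have "(u, v) \<in> r \<inter> R \<times> R" using that(1) \<open>u \<in> R\<close> by blast
    then show ?thesis using that(2) by (blast intro: rtrancl_into_rtrancl)
  qed
  have "acyclic ?q"
  proof (rule acyclic_split_out[where X = ?X])
    show "acyclic (?q \<inter> ?X \<times> ?X)"
      by (rule acyclic_subset[OF assms(1)]) (use sub in blast)
    have nox: "u \<noteq> x" if "(u, v) \<in> ?q \<inter> (- ?X) \<times> (- ?X)" for u v
      using that assms(2) by blast
    show "acyclic (?q \<inter> (- ?X) \<times> (- ?X))"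
    proof (rule acyclic_split_out[where X = "{x}"])
      have "?q \<inter> (- ?X) \<times> (- ?X) \<inter> {x} \<times> {x} = {}"
        using assms(2) by blast
      then show "acyclic (?q \<inter> (- ?X) \<times> (- ?X) \<inter> {x} \<times> {x})"
        by (simp only:) simp
      show "acyclic (?q \<inter> (- ?X) \<times> (- ?X) \<inter> (- {x}) \<times> (- {x}))"
        by (rule acyclic_subset[OF assms(1)]) blast
    qed (use nox in blast)
  qed (use cl in blast)
  then show False using assms(3) by blast
qed

section \<open>Dicolourings\<close>

definition mono_arcs :: "('a \<Rightarrow> nat) \<Rightarrow> ('a \<times> 'a) set \<Rightarrow> ('a \<times> 'a) set" where
  "mono_arcs f E = {(u, v) \<in> E. f u = f v}"

text \<open>Only arcs and colours on \<open>R\<close> count, so the same \<open>E\<close> and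
  \<open>f\<close> can be viewed on varying vertex sets.\<close>

definition dicol :: "nat \<Rightarrow> 'a set \<Rightarrow> ('a \<times> 'a) set \<Rightarrow> ('a \<Rightarrow> nat) \<Rightarrow> bool" where
  "dicol c R E f \<longleftrightarrow> f ` R \<subseteq> {..<c} \<and> acyclic (mono_arcs f (E \<inter> R \<times> R))"

definition dicolourable :: "nat \<Rightarrow> 'a set \<Rightarrow> ('a \<times> 'a) set \<Rightarrow> bool" where
  "dicolourable c R E \<longleftrightarrow> (\<exists>f. dicol c R E f)"

text \<open>Indexed by the number \<open>c\<close> of colours that just fails: a k-dicritical
  digraph gives \<open>dicritical_rel (k - 1)\<close>.\<close>

definition dicritical_rel :: "nat \<Rightarrow> 'a set \<Rightarrow> ('a \<times> 'a) set \<Rightarrow> bool" where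
  "dicritical_rel c V E \<longleftrightarrow> finite V \<and> E \<subseteq> V \<times> V \<and> irrefl E \<and> \<not> dicolourable c V E \<and>
     (\<forall>V' E'. V' \<subseteq> V \<longrightarrow> E' \<subseteq> E \<longrightarrow> E' \<subseteq> V' \<times> V' \<longrightarrow> (V', E') \<noteq> (V, E) \<longrightarrow> dicolourable c V' E')"

definition out_nb :: "('a \<times> 'a) set \<Rightarrow> 'a \<Rightarrow> 'a set" where
  "out_nb E v = {w. (v, w) \<in> E}"

definition in_nb :: "('a \<times> 'a) set \<Rightarrow> 'a \<Rightarrow> 'a set" where
  "in_nb E v = {w. (w, v) \<in> E}"

lemma mem_out_nb [simp]: "w \<in> out_nb E v \<longleftrightarrow> (v, w) \<in> E"
  by (simp add: out_nb_def)

lemma mem_in_nb [simp]: "w \<in> in_nb E v \<longleftrightarrow> (w, v) \<in> E"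
  by (simp add: in_nb_def)

lemma out_nb_converse [simp]: "out_nb (E\<inverse>) v = in_nb E v"
  and in_nb_converse [simp]: "in_nb (E\<inverse>) v = out_nb E v"
  by auto

lemma finite_out_nb: "finite H \<Longrightarrow> finite (out_nb H a)"
  by (rule finite_subset[of _ "snd ` H"]) force+

lemma finite_in_nb: "finite H \<Longrightarrow> finite (in_nb H a)"
  by (rule finite_subset[of _ "fst ` H"]) force+

lemma mem_mono_arcs [simp]: "(u, v) \<in> mono_arcs f E \<longleftrightarrow> (u, v) \<in> E \<and> f u = f v"
  by (simp add: mono_arcs_def)

lemma mono_arcs_empty [simp]: "mono_arcs f {} = {}"
  by auto

lemma dicol_subset:
  assumes "dicol c R E f" "R' \<subseteq> R" "E' \<inter> R' \<times> R' \<subseteq> E"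
  shows "dicol c R' E' f"
  using assms unfolding dicol_def
  by (auto intro!: acyclic_subset[of "mono_arcs f (E \<inter> R \<times> R)"])

lemma dicolourable_subset:
  assumes "dicolourable c R E" "R' \<subseteq> R" "E' \<inter> R' \<times> R' \<subseteq> E"
  shows "dicolourable c R' E'"
  using assms dicol_subset unfolding dicolourable_def by blast

lemma mono_arcs_converse: "mono_arcs f (E\<inverse>) = (mono_arcs f E)\<inverse>"
  by auto

lemma dicol_converse [simp]: "dicol c R (E\<inverse>) f \<longleftrightarrow> dicol c R E f"
proof -
  have "E\<inverse> \<inter> R \<times> R = (E \<inter> R \<times> R)\<inverse>" by auto
  then show ?thesis
    unfolding dicol_def by (metis mono_arcs_converse acyclic_converse)
qed

lemma dicolourable_converse [simp]: "dicolourable c R (E\<inverse>) \<longleftrightarrow> dicolourable c R E"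
  by (simp add: dicolourable_def)

lemma dicol_cong:
  assumes "dicol c R E f" "\<And>v. v \<in> R \<Longrightarrow> f v = g v"
  shows "dicol c R E g"
proof -
  have "mono_arcs g (E \<inter> R \<times> R) = mono_arcs f (E \<inter> R \<times> R)"
    using assms(2) by auto
  then show ?thesis using assms unfolding dicol_def by auto
qed

text \<open>No monochromatic arc leaves a vertex of \<open>T\<close>, so no monochromatic cycle
  meets \<open>T\<close>; arcs into \<open>T\<close> from the rest are unconstrained.\<close>

lemma dicol_add_out:
  assumes "dicol c R E f" "f ` T \<subseteq> {..<c}"
    and "\<And>x w. x \<in> T \<Longrightarrow> w \<in> R \<union> T \<Longrightarrow> (x, w) \<in> E \<Longrightarrow> f x \<noteq> f w"
  shows "dicol c (R \<union> T) E f"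
  unfolding dicol_def
proof
  show "f ` (R \<union> T) \<subseteq> {..<c}"
    using assms(1,2) by (auto simp: dicol_def)
  have ac: "acyclic (mono_arcs f (E \<inter> R \<times> R))"
    using assms(1) by (simp add: dicol_def)
  show "acyclic (mono_arcs f (E \<inter> (R \<union> T) \<times> (R \<union> T)))"
  proof (rule acyclic_split_out[where X = T])
    have "mono_arcs f (E \<inter> (R \<union> T) \<times> (R \<union> T)) \<inter> T \<times> T = {}"
      using assms(3) by auto
    then show "acyclic (mono_arcs f (E \<inter> (R \<union> T) \<times> (R \<union> T)) \<inter> T \<times> T)"
      by (simp only:) simp
    show "acyclic (mono_arcs f (E \<inter> (R \<union> T) \<times> (R \<union> T)) \<inter> (- T) \<times> (- T))"
      by (rule acyclic_subset[OF ac]) auto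
  qed (use assms(3) in auto)
qed

lemma dicol_add_in:
  assumes "dicol c R E f" "f ` T \<subseteq> {..<c}"
    and "\<And>x w. x \<in> T \<Longrightarrow> w \<in> R \<union> T \<Longrightarrow> (w, x) \<in> E \<Longrightarrow> f x \<noteq> f w"
  shows "dicol c (R \<union> T) E f"
  using dicol_add_out[of c R "E\<inverse>" f T] assms by auto

lemma dicritical_rel_converse:
  assumes "dicritical_rel c V E"
  shows "dicritical_rel c V (E\<inverse>)"
  unfolding dicritical_rel_def
proof (intro conjI allI impI)
  show "finite V" "E\<inverse> \<subseteq> V \<times> V" "irrefl (E\<inverse>)" "\<not> dicolourable c V (E\<inverse>)"
    using assms by (auto simp: dicritical_rel_def irrefl_def)
  fix V' E' assume *: "V' \<subseteq> V" "E' \<subseteq> E\<inverse>" "E' \<subseteq> V' \<times> V'" "(V', E') \<noteq> (V, E\<inverse>)"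
  have "E'\<inverse> \<subseteq> E" "E'\<inverse> \<subseteq> V' \<times> V'"
    using *(2,3) by auto
  moreover have "(V', E'\<inverse>) \<noteq> (V, E)"
    using *(4) by (metis Pair_inject converse_converse)
  ultimately have "dicolourable c V' (E'\<inverse>)"
    using assms *(1) unfolding dicritical_rel_def by blast
  then show "dicolourable c V' E'" by simp
qed

lemma dicritical_relD:
  assumes "dicritical_rel c V E"
  shows "finite V" "E \<subseteq> V \<times> V" "\<And>v. (v, v) \<notin> E" "\<not> dicolourable c V E" "finite E"
  using assms finite_subset[of E "V \<times> V"] by (auto simp: dicritical_rel_def irrefl_def)

lemma dicritical_rel_proper:
  assumes "dicritical_rel c V E" "V' \<subseteq> V" "E' \<subseteq> E" "E' \<subseteq> V' \<times> V'" "(V', E') \<noteq> (V, E)"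
  shows "dicolourable c V' E'"
  using assms unfolding dicritical_rel_def by blast

lemma dicritical_rel_induced:
  assumes "dicritical_rel c V E" "R \<subset> V"
  shows "dicolourable c R E"
proof -
  have "dicolourable c R (E \<inter> R \<times> R)"
    by (rule dicritical_rel_proper[OF assms(1)]) (use assms(2) in auto)
  then show ?thesis
    by (rule dicolourable_subset) auto
qed

lemma exists_dicritical_sub:
  assumes "finite V" "E \<subseteq> V \<times> V" "irrefl E" "\<not> dicolourable c V E"
  shows "\<exists>W F. W \<subseteq> V \<and> F \<subseteq> E \<and> dicritical_rel c W F"
  using assms
proof (induction "card V + card E" arbitrary: V E rule: less_induct)
  case less
  show ?case
  proof (cases "dicritical_rel c V E")
    case False
    then obtain V' E' where *: "V' \<subseteq> V" "E' \<subseteq> E" "E' \<subseteq> V' \<times> V'" "(V', E') \<noteq> (V, E)"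
        "\<not> dicolourable c V' E'"
      using less.prems unfolding dicritical_rel_def by blast
    have finE: "finite E" using less.prems(1,2) finite_subset by blast
    have "card V' \<le> card V" "card E' \<le> card E"
      using * less.prems(1) finE by (auto intro: card_mono)
    moreover have "card V' \<noteq> card V \<or> card E' \<noteq> card E"
      using *(4) card_subset_eq[OF less.prems(1) *(1)] card_subset_eq[OF finE *(2)] by auto
    ultimately have "card V' + card E' < card V + card E" by linarith
    then obtain W F where "W \<subseteq> V'" "F \<subseteq> E'" "dicritical_rel c W F"
      using less.hyps[of V' E'] * less.prems finite_subset
      by (metis irrefl_def subsetD)
    then show ?thesis using * by blast
  qed blast
qed

lemma card_missing_colours:
  assumes "finite S"
  shows "card ({..<c} - f ` S) \<ge> c - card S"
proof -
  have "card ({..<c} - f ` S) \<ge> card {..<c} - card (f ` S)"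
    by (rule diff_card_le_card_Diff) (use assms in auto)
  then show ?thesis using card_image_le[OF assms, of f] by simp
qed

lemma missing_colour:
  assumes "finite S" "card S < c"
  shows "\<exists>q<c. q \<notin> f ` S"
proof -
  have "card ({..<c} - f ` S) > 0" using card_missing_colours[OF assms(1), of c f] assms(2) by linarith
  then show ?thesis by (auto simp: card_gt_0_iff)
qed

lemma dicritical_rel_out_degree:
  assumes "dicritical_rel c V E" "v \<in> V"
  shows "c \<le> card (out_nb E v)"
proof (rule ccontr)
  assume lt: "\<not> c \<le> card (out_nb E v)"
  note G = dicritical_relD[OF assms(1)]
  have fin: "finite (out_nb E v)" by (rule finite_out_nb[OF G(5)])
  obtain f where f: "dicol c (V - {v}) E f"
    using dicritical_rel_induced[OF assms(1), of "V - {v}"] assms(2) by (auto simp: dicolourable_def)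
  obtain q where q: "q < c" "q \<notin> f ` out_nb E v"
    using missing_colour[OF fin, of c f] lt by (meson not_le)
  have "dicol c ((V - {v}) \<union> {v}) E (f(v := q))"
  proof (rule dicol_add_out)
    show "dicol c (V - {v}) E (f(v := q))" by (rule dicol_cong[OF f]) auto
  qed (use q G in auto)
  moreover have "(V - {v}) \<union> {v} = V" using assms(2) by auto
  ultimately show False using G(4) by (auto simp: dicolourable_def)
qed

lemma dicritical_rel_in_degree:
  assumes "dicritical_rel c V E" "v \<in> V"
  shows "c \<le> card (in_nb E v)"
  using dicritical_rel_out_degree[OF dicritical_rel_converse[OF assms(1)] assms(2)] by simp

lemma dicritical_rel_nonempty:
  assumes "dicritical_rel c V E"
  shows "V \<noteq> {}"
  using assms by (auto simp: dicritical_rel_def dicolourable_def dicol_def)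

lemma dicritical_rel_card:
  assumes "dicritical_rel c V E"
  shows "c + 1 \<le> card V"
proof -
  obtain v where v: "v \<in> V" using dicritical_rel_nonempty[OF assms] by blast
  note G = dicritical_relD[OF assms]
  have "card (out_nb E v) \<le> card (V - {v})"
    by (rule card_mono) (use G in auto)
  then show ?thesis
    using dicritical_rel_out_degree[OF assms v] v G(1) card_gt_0_iff[of V]
    by (auto simp: card_Diff_singleton)
qed

lemma dicritical_rel_complete:
  assumes "dicritical_rel c V E" "card V = c + 1" "u \<in> V" "v \<in> V" "u \<noteq> v"
  shows "(u, v) \<in> E"
proof -
  note G = dicritical_relD[OF assms(1)]
  have "out_nb E u = V - {u}"
    by (rule card_seteq)
       (use G assms dicritical_rel_out_degree[OF assms(1,3)] in \<open>auto simp: card_Diff_singleton\<close>)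
  then have "v \<in> out_nb E u" using assms(4,5) by blast
  then show ?thesis by simp
qed

text \<open>Cyclically shifting the colours of one side makes each crossing arc monochromatic for exactly
  one of the \<open>c\<close> shifts.\<close>

lemma dicritical_rel_cut:
  assumes "dicritical_rel c V E" "R \<subset> V" "R \<noteq> {}"
  shows "c \<le> card (E \<inter> R \<times> (V - R))"
proof (rule ccontr)
  assume lt: "\<not> c \<le> card (E \<inter> R \<times> (V - R))"
  note G = dicritical_relD[OF assms(1)]
  let ?B = "E \<inter> R \<times> (V - R)"
  obtain f where f: "dicol c R E f"
    using dicritical_rel_induced[OF assms(1,2)] by (auto simp: dicolourable_def)
  obtain g where g: "dicol c (V - R) E g"
    using dicritical_rel_induced[OF assms(1), of "V - R"] assms(2,3) by (auto simp: dicolourable_def)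
  \<comment> \<open>The one shift modulo \<open>c\<close> under which the arc becomes monochromatic;
    the difference is taken in the integers because natural subtraction truncates.\<close>
  define bad where "bad = (\<lambda>(u, v). nat ((int (f u) - int (g v)) mod int c))"
  obtain s where s: "s < c" "s \<notin> bad ` ?B"
    using missing_colour[of ?B c bad] lt G(5) by auto
  have c0: "c > 0" using s by auto
  define h where "h v = (if v \<in> R then f v else (g v + s) mod c)" for v
  have inj: "g u = g v" if "u \<in> V - R" "v \<in> V - R" "(g u + s) mod c = (g v + s) mod c" for u v
  proof -
    have "g u < c" "g v < c" using g that by (auto simp: dicol_def)
    moreover have "(int (g u) + int s) mod int c = (int (g v) + int s) mod int c"
      using that(3) by (metis of_nat_add zmod_int)
    then have "int (g u) mod int c = int (g v) mod int c"
      by (simp add: mod_eq_dvd_iff)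
    ultimately show ?thesis by simp
  qed
  have hB: "h u \<noteq> h v" if "(u, v) \<in> ?B" for u v
  proof
    assume eq: "h u = h v"
    have "f u = (g v + s) mod c" using eq that by (auto simp: h_def)
    then have "int (f u) = (int (g v) + int s) mod int c" by (simp add: zmod_int)
    then have "(int (f u) - int (g v)) mod int c = int s mod int c"
      by (metis add_diff_cancel_left' mod_diff_left_eq)
    then have "bad (u, v) = s" using s(1) by (simp add: bad_def)
    then show False using s that by blast
  qed
  have "dicol c V E h"
    unfolding dicol_def
  proof
    show "h ` V \<subseteq> {..<c}"
      using f g c0 by (auto simp: h_def dicol_def)
    show "acyclic (mono_arcs h (E \<inter> V \<times> V))"
    proof (rule acyclic_split_out[where X = R])
      show "v \<in> R" if "(u, v) \<in> mono_arcs h (E \<inter> V \<times> V)" "u \<in> R" for u v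
        using that hB[of u v] by auto
      show "acyclic (mono_arcs h (E \<inter> V \<times> V) \<inter> R \<times> R)"
        by (rule acyclic_subset[of "mono_arcs f (E \<inter> R \<times> R)"])
           (use f in \<open>auto simp: h_def dicol_def\<close>)
      show "acyclic (mono_arcs h (E \<inter> V \<times> V) \<inter> (- R) \<times> (- R))"
        by (rule acyclic_subset[of "mono_arcs g (E \<inter> (V - R) \<times> (V - R))"])
           (use g inj in \<open>auto simp: h_def dicol_def\<close>)
    qed
  qed
  then show False using G(4) by (auto simp: dicolourable_def)
qed

section \<open>Contracting a dicoloured set\<close>

text \<open>The elements of \<open>B\<close> will be the arcs leaving or entering a vertex set and \<open>g\<close> their end in that
  set. If a fibre of \<open>g\<close> is large, \<open>H\<close> is a bidirected star; otherwise it is a bidirected matching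
  between elements of \<open>B\<close> at distance \<open>i\<close> in an enumeration sorted by \<open>g\<close>.\<close>

lemma boundary_digons:
  fixes g :: "'b \<Rightarrow> 'a"
  assumes "finite B" "2 * i \<le> card B"
  shows "\<exists>H. H \<subseteq> g ` B \<times> g ` B \<and> irrefl H \<and> sym H \<and> card H \<le> 2 * i \<and>
    (\<forall>M. (\<forall>u v. (u, v) \<in> H \<longrightarrow> \<not> (u \<in> M \<and> v \<in> M)) \<longrightarrow> 2 \<le> card (M \<inter> g ` B) \<longrightarrow>
       i \<le> card {e \<in> B. g e \<notin> M})"
proof (cases "\<exists>u. i \<le> card {e \<in> B. g e = u}")
  case True
  \<comment> \<open>A large fibre: the star joins its value \<open>u\<close> to at most
    \<open>i\<close> other values. A set \<open>M\<close> without \<open>u\<close> misses the whole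
    fibre. A set with \<open>u\<close> misses all leaves, and there are \<open>i\<close> of them,
    since otherwise every other value is a leaf and \<open>M\<close> meets the image of
    \<open>B\<close> in \<open>u\<close> alone.\<close>
  then obtain u where u: "i \<le> card {e \<in> B. g e = u}" by blast
  show ?thesis
  proof (cases "i = 0")
    case True
    then show ?thesis by (intro exI[of _ "{}"]) (auto simp: irrefl_def sym_def)
  next
    case False
    then have "{e \<in> B. g e = u} \<noteq> {}" using u by (metis card.empty le_zero_eq)
    then have uB: "u \<in> g ` B" by auto
    obtain L where L: "L \<subseteq> g ` B - {u}" "card L = min i (card (g ` B - {u}))" "finite L"
      using assms(1) by (metis finite_Diff finite_imageI finite_subset min.cobounded2 obtain_subset_with_card_n)
    let ?H = "{u} \<times> L \<union> L \<times> {u}"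
    have "card ?H \<le> card ({u} \<times> L) + card (L \<times> {u})" by (rule card_Un_le)
    also have "\<dots> \<le> 2 * i" using L by simp
    finally have "card ?H \<le> 2 * i" .
    moreover have "i \<le> card {e \<in> B. g e \<notin> M}"
      if M: "\<forall>u v. (u, v) \<in> ?H \<longrightarrow> \<not> (u \<in> M \<and> v \<in> M)" "2 \<le> card (M \<inter> g ` B)" for M
    proof (cases "u \<in> M")
      case False
      then have "card {e \<in> B. g e = u} \<le> card {e \<in> B. g e \<notin> M}"
        using assms(1) by (intro card_mono) auto
      then show ?thesis using u by linarith
    next
      case True
      then have LM: "L \<inter> M = {}" using M(1) by auto
      have "card L = i"
      proof (rule ccontr)
        assume "card L \<noteq> i"
        then have "L = g ` B - {u}"
          using L(2) card_subset_eq[OF _ L(1)] assms(1) by (simp add: min_def split: if_splits)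
        then have "M \<inter> g ` B \<subseteq> {u}" using LM by auto
        then have "card (M \<inter> g ` B) \<le> 1"
          by (metis card_mono finite.emptyI finite.insertI is_singletonI is_singleton_altdef)
        then show False using M(2) by linarith
      qed
      moreover have "L \<subseteq> g ` {e \<in> B. g e \<notin> M}" using L(1) LM by auto
      then have "card L \<le> card {e \<in> B. g e \<notin> M}"
        using assms(1) surj_card_le[of "{e \<in> B. g e \<notin> M}" L g] by simp
      ultimately show ?thesis by simp
    qed
    moreover have "?H \<subseteq> g ` B \<times> g ` B" "irrefl ?H" "sym ?H"
      using L(1) uB by (auto simp: irrefl_def sym_def)
    ultimately show ?thesis by blast
  qed
next
  case False
  \<comment> \<open>Every fibre fills fewer than \<open>i\<close> consecutive places of the sorted
    list, so entries \<open>i\<close> places apart have different values. The first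
    \<open>2 * i\<close> entries split into \<open>i\<close> such pairs, each joined by a digon, and
    \<open>M\<close> misses an entry of every pair.\<close>
  then have fib: "card {e \<in> B. g e = u} < i" for u by (meson not_le)
  obtain key :: "'a \<Rightarrow> nat" where key: "inj_on key (g ` B)"
    using assms(1) finite_imp_inj_to_nat_seg[of "g ` B"] by blast
  obtain xs0 where xs0: "set xs0 = B" "distinct xs0"
    using assms(1) finite_distinct_list by blast
  define xs where "xs = sort_key (\<lambda>e. key (g e)) xs0"
  have xs: "set xs = B" "distinct xs" "sorted (map (\<lambda>e. key (g e)) xs)"
    using xs0 by (auto simp: xs_def)
  have len: "length xs = card B" using xs distinct_card by metis
  have diff: "g (xs ! t) \<noteq> g (xs ! (t + i))" if "t < i" for t
  proof
    assume eq: "g (xs ! t) = g (xs ! (t + i))"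
    have "g (xs ! s) = g (xs ! t)" if s: "s \<in> {t..t + i}" for s
    proof -
      have b: "s < length xs" "t < length xs" "t + i < length xs" using s \<open>t < i\<close> assms(2) len by auto
      have "key (g (xs ! t)) \<le> key (g (xs ! s))" "key (g (xs ! s)) \<le> key (g (xs ! (t + i)))"
        using sorted_nth_mono[OF xs(3), of t s] sorted_nth_mono[OF xs(3), of s "t + i"] s b by auto
      then have "key (g (xs ! s)) = key (g (xs ! t))" using eq by simp
      then show ?thesis using key b xs(1) by (auto simp: inj_on_def dest: nth_mem)
    qed
    moreover have "xs ! s \<in> B" if s: "s \<in> {t..t + i}" for s
    proof -
      have "s < length xs" using s \<open>t < i\<close> assms(2) len by auto
      then show ?thesis using nth_mem xs(1) by blast
    qed
    ultimately have "(!) xs ` {t..t + i} \<subseteq> {e \<in> B. g e = g (xs ! t)}"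
      by blast
    then have "card ((!) xs ` {t..t + i}) \<le> card {e \<in> B. g e = g (xs ! t)}"
      using assms(1) by (intro card_mono) auto
    moreover have "card ((!) xs ` {t..t + i}) = i + 1"
      using xs(2) len assms(2) that by (subst card_image) (auto simp: inj_on_def nth_eq_iff_index_eq)
    ultimately show False using fib[of "g (xs ! t)"] by linarith
  qed
  define H1 where "H1 = (\<lambda>t. (g (xs ! t), g (xs ! (t + i)))) ` {..<i}"
  define H2 where "H2 = (\<lambda>t. (g (xs ! (t + i)), g (xs ! t))) ` {..<i}"
  have mem: "xs ! t \<in> B" "xs ! (t + i) \<in> B" if "t < i" for t
  proof -
    have "t < length xs" "t + i < length xs" using that assms(2) len by auto
    then show "xs ! t \<in> B" "xs ! (t + i) \<in> B" using nth_mem xs(1) by blast+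
  qed
  have "card (H1 \<union> H2) \<le> card H1 + card H2" by (rule card_Un_le)
  also have "\<dots> \<le> 2 * i"
    using card_image_le[of "{..<i}" "\<lambda>t. (g (xs ! t), g (xs ! (t + i)))"]
      card_image_le[of "{..<i}" "\<lambda>t. (g (xs ! (t + i)), g (xs ! t))"]
    by (simp add: H1_def H2_def)
  finally have "card (H1 \<union> H2) \<le> 2 * i" .
  moreover have "i \<le> card {e \<in> B. g e \<notin> M}"
    if M: "\<forall>u v. (u, v) \<in> H1 \<union> H2 \<longrightarrow> \<not> (u \<in> M \<and> v \<in> M)" for M
  proof -
    define pick where "pick t = (if g (xs ! t) \<notin> M then t else t + i)" for t
    have pk: "xs ! pick t \<in> {e \<in> B. g e \<notin> M}" if "t < i" for t
    proof -
      have "(g (xs ! t), g (xs ! (t + i))) \<in> H1 \<union> H2" using that by (auto simp: H1_def)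
      then have "\<not> (g (xs ! t) \<in> M \<and> g (xs ! (t + i)) \<in> M)" using M by blast
      then show ?thesis using mem[OF that] by (auto simp: pick_def)
    qed
    have "inj_on (\<lambda>t. xs ! pick t) {..<i}"
    proof (rule inj_onI)
      fix s t assume st: "s \<in> {..<i}" "t \<in> {..<i}" "xs ! pick s = xs ! pick t"
      have "pick s < length xs" "pick t < length xs"
        using st len assms(2) by (auto simp: pick_def)
      then have "pick s = pick t" using st xs(2) by (simp add: nth_eq_iff_index_eq)
      then show "s = t" using st by (auto simp: pick_def split: if_splits)
    qed
    then have "card ((\<lambda>t. xs ! pick t) ` {..<i}) = i" by (simp add: card_image)
    moreover have "card ((\<lambda>t. xs ! pick t) ` {..<i}) \<le> card {e \<in> B. g e \<notin> M}"
      using assms(1) pk by (intro card_mono) auto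
    ultimately show ?thesis by simp
  qed
  moreover have "H1 \<union> H2 \<subseteq> g ` B \<times> g ` B" using mem by (auto simp: H1_def H2_def)
  moreover have "irrefl (H1 \<union> H2)" using diff by (fastforce simp: H1_def H2_def irrefl_def)
  moreover have "sym (H1 \<union> H2)" by (auto simp: H1_def H2_def sym_def)
  ultimately show ?thesis by blast
qed

text \<open>A dicolouring of the contraction gives the representatives of the colour classes pairwise distinct
  colours, so it pulls back along \<open>\<rho>\<close>.\<close>

lemma contraction_uncolourable:
  fixes rep :: "nat \<Rightarrow> 'a"
  assumes "dicritical_rel c V E" "R \<subseteq> V" "dicol c R E \<phi>"
    and rep: "\<And>l. l \<in> \<phi> ` R \<Longrightarrow> rep l \<in> R \<and> \<phi> (rep l) = l"
  defines "\<rho> \<equiv> \<lambda>v. if v \<in> R then rep (\<phi> v) else v"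
    and "X \<equiv> rep ` \<phi> ` R"
  shows "\<exists>W F. dicritical_rel c W F \<and> W \<subseteq> (V - R) \<union> X \<and>
    F \<subseteq> {(x, y). x \<in> X \<and> y \<in> X \<and> x \<noteq> y} \<union> (\<lambda>(u, v). (\<rho> u, \<rho> v)) ` (E - R \<times> R)"
proof -
  note G = dicritical_relD[OF assms(1)]
  let ?Y = "{(x, y). x \<in> X \<and> y \<in> X \<and> x \<noteq> y} \<union> (\<lambda>(u, v). (\<rho> u, \<rho> v)) ` (E - R \<times> R)"
  have XR: "X \<subseteq> R" using rep by (auto simp: X_def)
  have \<rho>V: "\<rho> v \<in> (V - R) \<union> X" if "v \<in> V" for v
    using that by (auto simp: \<rho>_def X_def)
  have "\<not> dicolourable c ((V - R) \<union> X) ?Y"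
  proof
    assume "dicolourable c ((V - R) \<union> X) ?Y"
    then obtain \<psi> where \<psi>: "dicol c ((V - R) \<union> X) ?Y \<psi>" by (auto simp: dicolourable_def)
    let ?S = "mono_arcs \<psi> (?Y \<inter> ((V - R) \<union> X) \<times> ((V - R) \<union> X))"
    have acS: "acyclic ?S" using \<psi> by (simp add: dicol_def)
    \<comment> \<open>Distinct representatives are joined by a digon, so equal colours would close a
      cycle of length two.\<close>
    have inj: "x = y" if "x \<in> X" "y \<in> X" "\<psi> x = \<psi> y" for x y
    proof (rule ccontr)
      assume "x \<noteq> y"
      then have "(x, y) \<in> ?S" "(y, x) \<in> ?S" using that by auto
      then have "(x, x) \<in> ?S\<^sup>+" by (rule trancl_into_trancl[OF r_into_trancl])
      then show False using acS by (meson acyclic_def)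
    qed
    define \<chi> where "\<chi> v = \<psi> (\<rho> v)" for v
    have same: "\<rho> u = \<rho> v \<and> \<phi> u = \<phi> v" if "u \<in> R" "v \<in> R" "\<chi> u = \<chi> v" for u v
    proof -
      have "\<rho> u \<in> X" "\<rho> v \<in> X" using that by (auto simp: \<rho>_def X_def)
      then have "\<rho> u = \<rho> v" using that(3) inj by (simp add: \<chi>_def)
      moreover have "\<phi> (\<rho> w) = \<phi> w" if "w \<in> R" for w
        using rep[of "\<phi> w"] that by (simp add: \<rho>_def)
      ultimately show ?thesis using that by metis
    qed
    have "dicol c V E \<chi>"
      unfolding dicol_def
    proof
      show "\<chi> ` V \<subseteq> {..<c}" using \<psi> \<rho>V by (auto simp: \<chi>_def dicol_def)
      let ?r1 = "mono_arcs \<chi> (E \<inter> R \<times> R)" and ?r2 = "mono_arcs \<chi> (E - R \<times> R)"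
      have "acyclic (?r1 \<union> ?r2)"
      \<comment> \<open>Monochromatic arcs inside \<open>R\<close> join vertices of one colour class
        of \<open>\<phi>\<close> and are collapsed by \<open>\<rho>\<close>; all others become
        monochromatic arcs of the contraction.\<close>
      proof (rule acyclic_quotient[OF acS, where h = \<rho>])
        show "acyclic ?r1"
        proof (rule acyclic_subset)
          show "acyclic (mono_arcs \<phi> (E \<inter> R \<times> R))" using assms(3) by (simp add: dicol_def)
          show "?r1 \<subseteq> mono_arcs \<phi> (E \<inter> R \<times> R)"
          proof (rule subrelI)
            fix u v assume "(u, v) \<in> ?r1"
            then show "(u, v) \<in> mono_arcs \<phi> (E \<inter> R \<times> R)" using same[of u v] by simp
          qed
        qed
        show "\<rho> u = \<rho> v" if "(u, v) \<in> ?r1" for u v using that same[of u v] by simp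
        show "(\<rho> u, \<rho> v) \<in> ?S" if "(u, v) \<in> ?r2" for u v
          using that \<rho>V G(2) by (auto simp: \<chi>_def intro: rev_image_eqI)
      qed
      then show "acyclic (mono_arcs \<chi> (E \<inter> V \<times> V))"
        by (rule acyclic_subset) auto
    qed
    then show False using G(4) by (auto simp: dicolourable_def)
  qed
  moreover have "finite ((V - R) \<union> X)"
    using XR assms(2) G(1) by (meson finite_Diff finite_Un finite_subset)
  moreover have "?Y \<subseteq> ((V - R) \<union> X) \<times> ((V - R) \<union> X)" using \<rho>V G(2) by auto
  moreover have "irrefl ?Y"
  proof -
    have "\<rho> u \<noteq> \<rho> v" if "(u, v) \<in> E - R \<times> R" for u v
      using that G(3) rep by (auto simp: \<rho>_def)
    then show ?thesis by (force simp: irrefl_def)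
  qed
  ultimately obtain W F where "W \<subseteq> (V - R) \<union> X" "F \<subseteq> ?Y" "dicritical_rel c W F"
    using exists_dicritical_sub[of "(V - R) \<union> X" ?Y c] by blast
  then show ?thesis by blast
qed

section \<open>The potential of a vertex set in a minimal counterexample\<close>

text \<open>With \<open>k = c + 1\<close>, the theorem says that the potential of the vertex set of a \<open>k\<close>-dicritical
  digraph is at most \<open>potK c\<close>, the potential of the bidirected complete digraph on \<open>k\<close> vertices.\<close>

definition pot :: "nat \<Rightarrow> ('a \<times> 'a) set \<Rightarrow> 'a set \<Rightarrow> real" where
  "pot c E R = (real c + 1 / 2 - 1 / real c) * real (card R) - real (card (E \<inter> R \<times> R))"

definition potK :: "nat \<Rightarrow> real" where
  "potK c = (real c - 1) / 2 - 1 / real c"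

definition twin :: "('a \<times> 'a) set \<Rightarrow> 'a \<Rightarrow> 'a \<Rightarrow> bool" where
  "twin E u v \<longleftrightarrow> u \<noteq> v \<and> (u, v) \<in> E \<and> (v, u) \<in> E \<and>
     (\<forall>w. w \<noteq> u \<longrightarrow> w \<noteq> v \<longrightarrow> ((u, w) \<in> E \<longleftrightarrow> (v, w) \<in> E) \<and> ((w, u) \<in> E \<longleftrightarrow> (w, v) \<in> E))"

definition twin_pairs :: "'a set \<Rightarrow> ('a \<times> 'a) set \<Rightarrow> ('a \<times> 'a) set" where
  "twin_pairs V E = {(u, v) \<in> V \<times> V. twin E u v}"

definition smaller :: "'a set \<Rightarrow> ('a \<times> 'a) set \<Rightarrow> 'a set \<Rightarrow> ('a \<times> 'a) set \<Rightarrow> bool" where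
  "smaller W F V E \<longleftrightarrow> card W < card V \<or> card W = card V \<and>
     (card F < card E \<or> card F = card E \<and> card (twin_pairs V E) < card (twin_pairs W F))"

lemma twin_converse [simp]: "twin (E\<inverse>) u v \<longleftrightarrow> twin E u v"
  by (auto simp: twin_def)

lemma pot_converse [simp]: "pot c (E\<inverse>) R = pot c E R"
proof -
  have "E\<inverse> \<inter> R \<times> R = (E \<inter> R \<times> R)\<inverse>" by auto
  then show ?thesis by (simp add: pot_def card_inverse)
qed

lemma smaller_converse: "smaller W F V (E\<inverse>) \<longleftrightarrow> smaller W (F\<inverse>) V E"
  by (simp add: smaller_def twin_pairs_def card_inverse)

text \<open>The left side is the potential of the complete digraph on \<open>j\<close> vertices and
  the right side its value at \<open>j = c\<close>; the difference has the factor
  \<open>c - j\<close> and a positive cofactor.\<close>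

lemma clique_pot_ge:
  fixes c j :: nat
  assumes "4 \<le> c" "2 \<le> j" "j \<le> c"
  shows "(real c + 1 / 2 - 1 / real c) * real j - real j * (real j - 1) \<ge> (3 * real c - 2) / 2"
proof -
  have "0 \<le> (real c - real j) * (real j - 3 / 2 + 1 / real c)"
    using assms by (intro mult_nonneg_nonneg) auto
  also have "\<dots> = (real c + 1 / 2 - 1 / real c) * real j - real j * (real j - 1) - (3 * real c - 2) / 2"
    using assms by (simp add: field_simps)
  finally show ?thesis by simp
qed

text \<open>Competitors live in the same vertex type. This suffices because a contraction takes its
  representatives from \<open>V\<close> and the replacement of a vertex by a twin reuses the vertex
  removed.\<close>

locale min_counterexample =
  fixes c :: nat and V :: "'a set" and E :: "('a \<times> 'a) set"
  assumes c4: "4 \<le> c"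
    and crit: "dicritical_rel c V E"
    and big: "pot c E V > potK c"
    and small: "\<And>W F. dicritical_rel c W F \<Longrightarrow> smaller W F V E \<Longrightarrow> pot c F W \<le> potK c"
begin

lemma converse: "min_counterexample c V (E\<inverse>)"
proof
  show "pot c F W \<le> potK c" if "dicritical_rel c W F" "smaller W F V (E\<inverse>)" for W :: "'a set" and F
    using small[of W "F\<inverse>"] that dicritical_rel_converse[OF that(1)] by (simp add: smaller_converse)
qed (use c4 crit big dicritical_rel_converse in auto)

lemmas fin = dicritical_relD(1)[OF crit] and EV = dicritical_relD(2)[OF crit]
  and noloop = dicritical_relD(3)[OF crit] and uncol = dicritical_relD(4)[OF crit]
  and finE = dicritical_relD(5)[OF crit]

lemma small_card: "dicritical_rel c W F \<Longrightarrow> card W < card V \<Longrightarrow> pot c F W \<le> potK c"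
  for W :: "'a set"
  by (rule small) (auto simp: smaller_def)

lemma inv_c: "0 < 1 / real c" "1 / real c \<le> 1 / 4" "real c * (1 / real c) = 1"
  using c4 by (auto simp: field_simps)

text \<open>A dicritical subdigraph found after adding \<open>H\<close> has fewer vertices than
  \<open>V\<close>, so minimality bounds its potential, and each arc of \<open>H\<close> taken out
  again raises it by one. It contains a new arc, since otherwise it is a proper subdigraph of a
  dicritical digraph. Set against a lower bound for potentials, this tells how many arcs can be
  added safely.\<close>

lemma uncolourable_add:
  assumes "R \<subset> V" "H \<subseteq> R \<times> R" "irrefl H" "\<not> dicolourable c R (E \<union> H)"
  shows "\<exists>W. W \<subseteq> R \<and> c + 1 \<le> card W \<and> pot c E W \<le> potK c + real (card ((H - E) \<inter> W \<times> W)) \<and>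
    (H - E) \<inter> W \<times> W \<noteq> {}"
proof -
  let ?Y = "(E \<union> H) \<inter> R \<times> R"
  have "\<not> dicolourable c R ?Y"
    using assms(4) dicolourable_subset[of c R ?Y R "E \<union> H"] by blast
  moreover have "irrefl ?Y" using assms(3) noloop by (auto simp: irrefl_def)
  moreover have finR: "finite R" using assms(1) fin finite_subset by blast
  ultimately obtain W F where WF: "W \<subseteq> R" "F \<subseteq> ?Y" "dicritical_rel c W F"
    using exists_dicritical_sub[of R ?Y c] by blast
  note W = dicritical_relD[OF WF(3)]
  have "card W < card V"
    using WF(1) assms(1) fin by (meson psubset_card_mono subset_psubset_trans)
  then have p: "pot c F W \<le> potK c" using small_card WF(3) by blast
  have F: "F \<subseteq> (E \<inter> W \<times> W) \<union> ((H - E) \<inter> W \<times> W)" using WF(2) W(2) by blast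
  have "card F \<le> card ((E \<inter> W \<times> W) \<union> ((H - E) \<inter> W \<times> W))"
    by (rule card_mono[OF _ F]) (use W(1) in auto)
  also have "\<dots> \<le> card (E \<inter> W \<times> W) + card ((H - E) \<inter> W \<times> W)"
    by (rule card_Un_le)
  finally have "pot c E W \<le> potK c + real (card ((H - E) \<inter> W \<times> W))"
    using p W(2) by (simp add: pot_def Int_absorb2)
  moreover have "(H - E) \<inter> W \<times> W \<noteq> {}"
  proof
    assume "(H - E) \<inter> W \<times> W = {}"
    then have "F \<subseteq> E" using F by blast
    then have "dicolourable c W F"
      using dicritical_rel_proper[OF crit, of W F] WF(1) assms(1) W(2) by blast
    then show False using W(4) by blast
  qed
  ultimately show ?thesis using WF(1) dicritical_rel_card[OF WF(3)] by blast
qed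

text \<open>A set \<open>R\<close> of minimum potential is contracted; the bound follows by expanding the dicritical
  subdigraph found afterwards. If only one vertex of the clique is used, the arcs between \<open>R\<close> and its
  complement that are lost must compensate; the added arcs \<open>H\<close> guarantee that there are enough.\<close>

lemma potential_gt:
  assumes "S \<subset> V" "c + 1 \<le> card S"
  shows "pot c E S > (3 * real c - 2) / 2"
proof (rule ccontr)
  assume neg: "\<not> ?thesis"
  let ?a = "real c + 1 / 2 - 1 / real c"
  let ?fam = "{R. R \<subset> V \<and> c + 1 \<le> card R}"
  have "finite ?fam" by (rule finite_subset[of _ "Pow V"]) (use fin in auto)
  moreover have "?fam \<noteq> {}" using assms by blast
  ultimately have "\<exists>R. is_arg_min (pot c E) (\<lambda>R. R \<in> ?fam) R"
    by (rule ex_is_arg_min_if_finite)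
  then obtain R where "is_arg_min (pot c E) (\<lambda>R. R \<in> ?fam) R" by blast
  then have R: "R \<in> ?fam" and min: "\<And>R'. R' \<in> ?fam \<Longrightarrow> pot c E R \<le> pot c E R'"
    by (simp_all add: is_arg_min_linorder)
  have RV: "R \<subset> V" and cR: "c + 1 \<le> card R" using R by auto
  have finR: "finite R" using RV fin finite_subset by blast
  define \<mu> where "\<mu> = pot c E R"
  have \<mu>: "\<mu> \<le> (3 * real c - 2) / 2"
    using min[of S] assms neg by (simp add: \<mu>_def)
  \<comment> \<open>If the contraction uses a single representative, the expanded set has potential
    at most \<open>potK c - ?a + \<mu>\<close>. Losing \<open>i\<close> further arcs brings this
    down to \<open>potK c\<close>, against \<open>big\<close>. Truncation by \<open>nat\<close>
    covers the case where no arc has to be lost.\<close>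
  define i where "i = nat \<lceil>\<mu> - ?a\<rceil>"
  have i_ge: "\<mu> - ?a \<le> real i" by (simp add: i_def) (meson le_of_int_ceiling of_nat_nat order.trans real_nat_ceiling_ge)
  have i_lt: "real i < \<mu> - ?a + 1" if "i > 0" using that by (simp add: i_def) linarith
  have i2: "2 * i \<le> c - 1"
  proof (cases "i = 0")
    case False
    then have "real i < (3 * real c - 2) / 2 - ?a + 1" using i_lt \<mu> by linarith
    then have "2 * real i < real c - 1 + 2 * (1 / real c)" by (simp add: field_simps)
    then have "2 * real i < real c" using inv_c by linarith
    then show ?thesis by linarith
  qed simp
  define B where "B = {(u, v) \<in> E. (u \<in> R) \<noteq> (v \<in> R)}"
  define g where "g = (\<lambda>(u, v). if u \<in> R then u else v :: 'a)"
  have finB: "finite B" using finE by (rule rev_finite_subset) (auto simp: B_def)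
  have gR: "g ` B \<subseteq> R" by (auto simp: g_def B_def)
  have "R \<noteq> {}" using cR by auto
  then have "c \<le> card (E \<inter> R \<times> (V - R))" using dicritical_rel_cut[OF crit RV] by blast
  also have "\<dots> \<le> card B" by (rule card_mono[OF finB]) (auto simp: B_def)
  finally have "2 * i \<le> card B" using i2 by linarith
  from boundary_digons[OF finB this, of g]
  obtain H where H: "H \<subseteq> g ` B \<times> g ` B" "irrefl H" "sym H" "card H \<le> 2 * i"
    and Hind: "\<forall>M. (\<forall>u v. (u, v) \<in> H \<longrightarrow> \<not> (u \<in> M \<and> v \<in> M)) \<longrightarrow> 2 \<le> card (M \<inter> g ` B) \<longrightarrow>
        i \<le> card {e \<in> B. g e \<notin> M}"
    by (elim exE conjE)
  have finH: "finite H" using H(1) finB finite_subset by blast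
  \<comment> \<open>Otherwise some \<open>W\<close> inside \<open>R\<close> has potential at most
    \<open>potK c + 2 * i\<close>, but by the choice of \<open>R\<close> at least
    \<open>\<mu>\<close>; with the definition of \<open>i\<close> this gives
    \<open>c < 2 * i\<close>.\<close>
  have "dicolourable c R (E \<union> H)"
  proof (rule ccontr)
    assume "\<not> dicolourable c R (E \<union> H)"
    moreover have "H \<subseteq> R \<times> R" using H(1) gR by blast
    ultimately obtain W where W: "W \<subseteq> R" "c + 1 \<le> card W"
        "pot c E W \<le> potK c + real (card ((H - E) \<inter> W \<times> W))" "(H - E) \<inter> W \<times> W \<noteq> {}"
      using uncolourable_add[OF RV _ H(2)] by blast
    have "card ((H - E) \<inter> W \<times> W) \<le> card H" by (rule card_mono[OF finH]) auto
    moreover have "card ((H - E) \<inter> W \<times> W) > 0" using W(4) finH by (simp add: card_gt_0_iff)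
    moreover have "\<mu> \<le> pot c E W" using min[of W] W RV by (auto simp: \<mu>_def)
    ultimately have "\<mu> \<le> potK c + 2 * real i" "i > 0" using W(3) H(4) by linarith+
    then have "real c < 2 * real i" using i_lt by (simp add: potK_def field_simps)
    then show False using i2 by linarith
  qed
  then obtain \<phi> where \<phi>H: "dicol c R (E \<union> H) \<phi>" by (auto simp: dicolourable_def)
  then have \<phi>: "dicol c R E \<phi>" by (rule dicol_subset) auto
  have Hmono: "\<phi> u \<noteq> \<phi> v" if "(u, v) \<in> H" for u v
  proof
    assume eq: "\<phi> u = \<phi> v"
    let ?m = "mono_arcs \<phi> ((E \<union> H) \<inter> R \<times> R)"
    have "(v, u) \<in> H" using that H(3) by (auto simp: sym_def)
    then have "(u, v) \<in> ?m" "(v, u) \<in> ?m" using that eq H(1) gR by auto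
    then have "(u, u) \<in> ?m\<^sup>+" by (rule trancl_into_trancl[OF r_into_trancl])
    then show False using \<phi>H by (auto simp: dicol_def acyclic_def)
  qed
  \<comment> \<open>Boundary vertices are preferred: a colour class with just one boundary vertex is
    then represented by it, so that the contraction moves none of its boundary arcs.\<close>
  define rep where "rep l = (if \<exists>u \<in> g ` B. \<phi> u = l then SOME u. u \<in> g ` B \<and> \<phi> u = l
      else SOME u. u \<in> R \<and> \<phi> u = l)" for l
  have repB: "rep l \<in> g ` B \<and> \<phi> (rep l) = l" if "u \<in> g ` B" "\<phi> u = l" for u l
    using someI_ex[of "\<lambda>u. u \<in> g ` B \<and> \<phi> u = l"] that by (auto simp: rep_def)
  have rep: "rep l \<in> R \<and> \<phi> (rep l) = l" if "l \<in> \<phi> ` R" for l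
  proof (cases "\<exists>u \<in> g ` B. \<phi> u = l")
    case True
    then show ?thesis using repB gR by blast
  next
    case False
    then show ?thesis using someI_ex[of "\<lambda>u. u \<in> R \<and> \<phi> u = l"] that by (auto simp: rep_def)
  qed
  define \<rho> where "\<rho> v = (if v \<in> R then rep (\<phi> v) else v)" for v
  define X where "X = rep ` \<phi> ` R"
  obtain W F where WF: "dicritical_rel c W F" "W \<subseteq> (V - R) \<union> X"
      "F \<subseteq> {(x, y). x \<in> X \<and> y \<in> X \<and> x \<noteq> y} \<union> (\<lambda>(u, v). (\<rho> u, \<rho> v)) ` (E - R \<times> R)"
    using contraction_uncolourable[OF crit _ \<phi> rep] RV unfolding \<rho>_def X_def by blast
  note W = dicritical_relD[OF WF(1)]
  have XR: "X \<subseteq> R" using rep by (auto simp: X_def)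
  have finX: "finite X" using XR finR finite_subset by blast
  have "card X \<le> card (\<phi> ` R)" unfolding X_def by (rule card_image_le) (use finR in auto)
  also have "\<dots> \<le> card {..<c}" by (rule card_mono) (use \<phi> in \<open>auto simp: dicol_def\<close>)
  finally have cX: "card X \<le> c" by simp
  have "card W \<le> card ((V - R) \<union> X)" by (rule card_mono[OF _ WF(2)]) (use fin finX in auto)
  also have "\<dots> \<le> card (V - R) + card X" by (rule card_Un_le)
  also have "\<dots> < card (V - R) + card R" using cX cR by linarith
  also have "\<dots> = card V" using RV fin by (metis card_Diff_subset card_mono finR le_add_diff_inverse2 psubset_imp_subset)
  finally have cW: "card W < card V" .
  then have pW: "pot c F W \<le> potK c" using small_card WF(1) by blast
  \<comment> \<open>The dicritical digraph found uses \<open>j\<close> representatives.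
    \<open>P\<close> collects the arcs of \<open>E\<close> whose images it uses, and
    \<open>R'\<close> is its expansion.\<close>
  define j where "j = card (W \<inter> X)"
  define P where "P = {(u, v) \<in> E - R \<times> R. (\<rho> u, \<rho> v) \<in> F}"
  have finP: "finite P" using finE by (rule rev_finite_subset) (auto simp: P_def)
  define R' where "R' = (W - R) \<union> R"
  have R'V: "R' \<subseteq> V" using WF(2) XR RV by (auto simp: R'_def)
  have FP: "F - X \<times> X \<subseteq> (\<lambda>(u, v). (\<rho> u, \<rho> v)) ` P"
    using WF(3) by (force simp: P_def)
  then have cFP: "card (F - X \<times> X) \<le> card P" using surj_card_le[OF finP] by blast
  have notE: "\<not> F \<subseteq> E"
    using dicritical_rel_proper[OF crit, of W F] WF(2) XR RV cW W(2,4) by blast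
  have j1: "1 \<le> j"
  proof (rule ccontr)
    assume "\<not> 1 \<le> j"
    then have WX: "W \<inter> X = {}" using finX by (simp add: j_def not_le)
    have "F \<subseteq> E"
    proof (rule subrelI)
      fix p q assume pq: "(p, q) \<in> F"
      then have "p \<in> W" "q \<in> W" using W(2) by auto
      then have "(p, q) \<in> F - X \<times> X" using pq WX by blast
      then have "(p, q) \<in> (\<lambda>(u, v). (\<rho> u, \<rho> v)) ` P" using FP by blast
      then obtain u v where uv: "(u, v) \<in> P" "p = \<rho> u" "q = \<rho> v" by auto
      have "u \<notin> R" "v \<notin> R"
        using WX \<open>p \<in> W\<close> \<open>q \<in> W\<close> uv by (auto simp: \<rho>_def X_def split: if_splits)
      then show "(p, q) \<in> E" using uv by (auto simp: P_def \<rho>_def)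
    qed
    then show False using notE by blast
  qed
  have "j \<le> card X" unfolding j_def by (rule card_mono[OF finX]) auto
  then have jc: "j \<le> c" using cX by linarith
  have "card F \<le> card (F \<inter> X \<times> X) + card (F - X \<times> X)"
    using card_Un_le[of "F \<inter> X \<times> X" "F - X \<times> X"] by (simp add: Int_Diff_Un)
  moreover have "card (F \<inter> X \<times> X) \<le> j * (j - 1)"
  proof -
    have "F \<inter> X \<times> X \<subseteq> (W \<inter> X) \<times> (W \<inter> X) - (\<lambda>x. (x, x)) ` (W \<inter> X)"
      using W(2,3) by auto
    then have "card (F \<inter> X \<times> X) \<le> card ((W \<inter> X) \<times> (W \<inter> X) - (\<lambda>x. (x, x)) ` (W \<inter> X))"
      using finX by (intro card_mono) auto
    also have "\<dots> = j * j - j"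
      using finX by (subst card_Diff_subset) (auto simp: j_def card_image inj_on_def card_cartesian_product)
    finally show ?thesis by (simp add: diff_mult_distrib2)
  qed
  ultimately have "card F \<le> j * (j - 1) + card P" using cFP by linarith
  then have "real (card F) \<le> real (j * (j - 1) + card P)" by (simp only: of_nat_le_iff)
  then have cF: "real (card F) \<le> real j * (real j - 1) + real (card P)"
    using j1 by (simp add: of_nat_diff)
  have cWj: "card W = card (W - R) + j"
  proof -
    have "W \<inter> R = W \<inter> X" using WF(2) XR by blast
    then show ?thesis using W(1) unfolding j_def by (metis Diff_Int Int_commute add.commute card_Diff_subset_Int card_Int_Diff finite_Int)
  qed
  have cR': "card R' = card (W - R) + card R"
    unfolding R'_def by (rule card_Un_disjoint) (use W(1) finR in auto)
  have PR': "P \<subseteq> E \<inter> R' \<times> R'"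
  proof (rule subrelI)
    fix u v assume uv: "(u, v) \<in> P"
    then have "\<rho> u \<in> W" "\<rho> v \<in> W" using W(2) by (auto simp: P_def)
    then show "(u, v) \<in> E \<inter> R' \<times> R'"
      using uv by (auto simp: P_def R'_def \<rho>_def split: if_splits)
  qed
  \<comment> \<open>Exchanging the \<open>j\<close> clique vertices for \<open>R\<close> adds
    \<open>\<mu>\<close> and takes away their clique potential; \<open>om\<close> counts arcs inside
    \<open>R'\<close> beyond those of \<open>R\<close> and \<open>P\<close>.\<close>
  have step: "pot c E R' \<le> potK c - (?a * real j - real j * (real j - 1)) + \<mu> - real om"
    if om: "card (E \<inter> R' \<times> R') \<ge> card (E \<inter> R \<times> R) + card P + om" for om
  proof -
    have e1: "pot c F W = ?a * (real (card (W - R)) + real j) - real (card F)"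
      using W(2) cWj by (simp add: pot_def Int_absorb2)
    have e2: "pot c E R' = ?a * (real (card (W - R)) + real (card R)) - real (card (E \<inter> R' \<times> R'))"
      by (simp add: pot_def cR')
    have e3: "\<mu> = ?a * real (card R) - real (card (E \<inter> R \<times> R))"
      by (simp add: \<mu>_def pot_def)
    have "real (card (E \<inter> R' \<times> R')) \<ge> real (card (E \<inter> R \<times> R)) + real (card P) + real om"
      using om by linarith
    then show ?thesis using e1 e2 e3 cF pW by (simp add: distrib_left)
  qed
  have sum0: "card (E \<inter> R' \<times> R') \<ge> card (E \<inter> R \<times> R) + card P"
  proof -
    have "card ((E \<inter> R \<times> R) \<union> P) \<le> card (E \<inter> R' \<times> R')"
      by (rule card_mono) (use finE PR' in \<open>auto simp: R'_def\<close>)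
    moreover have "card ((E \<inter> R \<times> R) \<union> P) = card (E \<inter> R \<times> R) + card P"
      by (rule card_Un_disjoint) (use finE finP in \<open>auto simp: P_def\<close>)
    ultimately show ?thesis by simp
  qed
  have kp: "?a \<le> ?a * real j - real j * (real j - 1)"
  proof (cases "j = 1")
    case False
    then have "2 \<le> j" using j1 by linarith
    have "4 \<le> real c" using c4 by simp
    then have "real c + 1 / 2 \<le> (3 * real c - 2) / 2" by (simp add: field_simps)
    then have "?a \<le> (3 * real c - 2) / 2" using inv_c(1) by linarith
    then show ?thesis using clique_pot_ge[OF c4 \<open>2 \<le> j\<close> jc] by linarith
  qed simp
  \<comment> \<open>A proper \<open>R'\<close> would have potential below the minimum
    \<open>\<mu>\<close>.\<close>
  have R'eq: "R' = V"
  proof (rule ccontr)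
    assume "R' \<noteq> V"
    then have "R' \<in> ?fam" using R'V cR cR' by auto
    then have "\<mu> \<le> pot c E R'" using min by (auto simp: \<mu>_def)
    moreover have "potK c < ?a" using c4 by (simp add: potK_def)
    ultimately show False using step[of 0] sum0 kp by simp
  qed
  show False
  proof (cases "j = 1")
    case False
    then have "2 \<le> j" using j1 by linarith
    have "pot c E V \<le> potK c - (?a * real j - real j * (real j - 1)) + \<mu>"
      using step[of 0] sum0 R'eq by simp
    then show False using big \<mu> clique_pot_ge[OF c4 \<open>2 \<le> j\<close> jc] by linarith
  next
    case True
    then obtain x where x: "W \<inter> X = {x}" by (metis card_1_singletonE j_def)
    then have "x \<in> X" by blast
    then obtain l where l: "l \<in> \<phi> ` R" "x = rep l" unfolding X_def by blast
    \<comment> \<open>\<open>M\<close> is the one colour class used. Boundary arcs with their end in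
      \<open>R\<close> outside \<open>M\<close> are lost, so there are fewer than \<open>i\<close>
      of them. As \<open>H\<close> has no arc inside \<open>M\<close>, the choice of
      \<open>H\<close> leaves \<open>M\<close> at most one boundary vertex. Then the contraction
      changes no arc that is used, and \<open>F\<close> lies in \<open>E\<close>, contrary to
      criticality.\<close>
    define M where "M = {v \<in> R. \<phi> v = l}"
    have PM: "u \<in> M" if "\<rho> u \<in> W" "u \<in> R" for u
    proof -
      have "\<rho> u \<in> W \<inter> X" using that by (auto simp: \<rho>_def X_def)
      then have "rep (\<phi> u) = rep l" using that x l by (auto simp: \<rho>_def)
      moreover have "\<phi> (rep (\<phi> u)) = \<phi> u" "\<phi> (rep l) = l" using rep that(2) l(1) by blast+
      ultimately have "\<phi> u = l" by metis
      then show ?thesis using that by (simp add: M_def)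
    qed
    have PgM: "g e \<in> M" if "e \<in> P" "e \<in> B" for e
    proof -
      obtain u v where e: "e = (u, v)" by force
      have "\<rho> u \<in> W" "\<rho> v \<in> W" using that W(2) by (auto simp: P_def e)
      then show ?thesis using that PM by (auto simp: B_def g_def e)
    qed
    define om where "om = card {e \<in> B. g e \<notin> M}"
    have "card ((E \<inter> R \<times> R) \<union> P \<union> {e \<in> B. g e \<notin> M}) \<le> card (E \<inter> R' \<times> R')"
      by (rule card_mono) (use finE EV R'eq RV in \<open>auto simp: B_def P_def\<close>)
    moreover have "card ((E \<inter> R \<times> R) \<union> P \<union> {e \<in> B. g e \<notin> M}) = card ((E \<inter> R \<times> R) \<union> P) + om"
      unfolding om_def
      by (rule card_Un_disjoint) (use finE finP finB PgM in \<open>auto simp: B_def\<close>)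
    moreover have "card ((E \<inter> R \<times> R) \<union> P) = card (E \<inter> R \<times> R) + card P"
      by (rule card_Un_disjoint) (use finE finP in \<open>auto simp: P_def\<close>)
    ultimately have bound: "pot c E V \<le> potK c - ?a + \<mu> - real om"
      using step[of om] True R'eq by simp
    have "om < i" using bound i_ge big by linarith
    moreover have "\<not> (u \<in> M \<and> v \<in> M)" if "(u, v) \<in> H" for u v
      using Hmono[OF that] by (simp add: M_def)
    then have "i \<le> om" if "2 \<le> card (M \<inter> g ` B)"
      using Hind that unfolding om_def by blast
    ultimately have "\<not> 2 \<le> card (M \<inter> g ` B)" by linarith
    then have M1: "u = v" if "u \<in> M \<inter> g ` B" "v \<in> M \<inter> g ` B" for u v
      using that finB card_le_Suc0_iff_eq[of "M \<inter> g ` B"] by auto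
    have \<rho>id: "\<rho> u = u" if "(u, v) \<in> P \<or> (v, u) \<in> P" for u v
    proof (cases "u \<in> R")
      case uR: True
      have "v \<notin> R" using that uR by (auto simp: P_def)
      then have uB: "u \<in> g ` B" using that uR by (force simp: P_def B_def g_def image_iff)
      have "u \<in> M" using that uR PM W(2) by (auto simp: P_def)
      then have "rep l \<in> g ` B \<and> \<phi> (rep l) = l" using repB[OF uB] by (simp add: M_def)
      then have "rep l = u" using M1[of "rep l" u] uB \<open>u \<in> M\<close> gR by (auto simp: M_def)
      then show ?thesis using \<open>u \<in> M\<close> by (simp add: \<rho>_def M_def)
    qed (simp add: \<rho>_def)
    have "F \<subseteq> E"
    proof (rule subrelI)
      fix p q assume pq: "(p, q) \<in> F"
      then have "p \<in> W" "q \<in> W" "p \<noteq> q" using W(2,3) by auto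
      then have "\<not> (p \<in> X \<and> q \<in> X)" using x by (metis IntI singletonD)
      then have "(p, q) \<in> F - X \<times> X" using pq by blast
      then have "(p, q) \<in> (\<lambda>(u, v). (\<rho> u, \<rho> v)) ` P" using FP by blast
      then obtain u v where uv: "(u, v) \<in> P" "p = \<rho> u" "q = \<rho> v" by auto
      then have "p = u" "q = v" using \<rho>id by blast+
      then show "(p, q) \<in> E" using uv by (auto simp: P_def)
    qed
    then show False using notE by blast
  qed
qed

end

section \<open>Vertices of minimum degree\<close>

definition clique :: "('a \<times> 'a) set \<Rightarrow> 'a set \<Rightarrow> bool" where
  "clique E R \<longleftrightarrow> (\<forall>u\<in>R. \<forall>v\<in>R. u \<noteq> v \<longrightarrow> (u, v) \<in> E)"

definition cluster :: "('a \<times> 'a) set \<Rightarrow> 'a \<Rightarrow> 'a set" where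
  "cluster E x = insert x {z. twin E x z}"

lemma cluster_converse [simp]: "cluster (E\<inverse>) x = cluster E x"
  by (simp add: cluster_def)

lemma clique_converse [simp]: "clique (E\<inverse>) R = clique E R"
  by (auto simp: clique_def)

lemma cluster_self [simp]: "x \<in> cluster E x"
  by (simp add: cluster_def)

lemma twin_sym: "twin E u v \<Longrightarrow> twin E v u"
  by (auto simp: twin_def)

lemma cluster_nb:
  assumes "z \<in> cluster E x" "w \<notin> cluster E x"
  shows "(z, w) \<in> E \<longleftrightarrow> (x, w) \<in> E" "(w, z) \<in> E \<longleftrightarrow> (w, x) \<in> E"
  using assms by (auto simp: cluster_def twin_def)

lemma clique_cluster: "clique E (cluster E x)"
  unfolding clique_def cluster_def by (auto simp: twin_def)

context min_counterexample
begin

definition low :: "'a \<Rightarrow> bool" where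
  "low v \<longleftrightarrow> v \<in> V \<and> card (out_nb E v) = c \<and> card (in_nb E v) = c"

lemma nb_V: "out_nb E v \<subseteq> V" "in_nb E v \<subseteq> V"
  using EV by auto

lemma fin_nb [simp]: "finite (out_nb E v)" "finite (in_nb E v)"
  using finite_subset[OF nb_V(1) fin] finite_subset[OF nb_V(2) fin] by auto

lemma degree_ge: "v \<in> V \<Longrightarrow> c \<le> card (out_nb E v)" "v \<in> V \<Longrightarrow> c \<le> card (in_nb E v)"
  using dicritical_rel_out_degree[OF crit] dicritical_rel_in_degree[OF crit] by auto

lemma pot_V: "pot c E V = (real c + 1 / 2 - 1 / real c) * real (card V) - real (card E)"
  using EV by (simp add: pot_def Int_absorb2)

lemma clique_pot_eq: "(real c + 1 / 2 - 1 / real c) * (real c + 1) = potK c + real c * (real c + 1)"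
  using c4 by (simp add: potK_def field_simps)

text \<open>The complete digraph on \<open>c + 1\<close> vertices has potential exactly
  \<open>potK c\<close>, so it is no counterexample.\<close>

lemma card_V_gt: "c + 1 < card V"
proof -
  have "card V \<noteq> c + 1"
  proof
    assume n: "card V = c + 1"
    have "E = V \<times> V - (\<lambda>x. (x, x)) ` V"
      using EV noloop dicritical_rel_complete[OF crit n] by (auto simp: image_iff)
    then have "card E = card V * card V - card V"
      using fin by (simp add: card_Diff_subset card_image inj_on_def card_cartesian_product image_subset_iff)
    then have "real (card E) = real c * (real c + 1)" using n by (simp add: algebra_simps)
    then show False using big clique_pot_eq n by (simp add: pot_V add.commute)
  qed
  then show ?thesis using dicritical_rel_card[OF crit] by simp
qed

text \<open>At most two arcs of a complete digraph are missing, so the potential is at most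
  \<open>potK c + 2\<close>, too small for \<open>potential_gt\<close>.\<close>

lemma no_almost_clique:
  assumes "R \<subseteq> V" "card R = c + 1"
    and adj: "\<And>u v. u \<in> R \<Longrightarrow> v \<in> R \<Longrightarrow> u \<noteq> v \<Longrightarrow> {u, v} \<noteq> {p, q} \<Longrightarrow> (u, v) \<in> E"
  shows False
proof -
  have finR: "finite R" using assms(1) fin finite_subset by blast
  have "R \<subset> V" using assms card_V_gt by auto
  then have p: "pot c E R > (3 * real c - 2) / 2" using potential_gt assms(2) by simp
  have "R \<times> R - (\<lambda>x. (x, x)) ` R \<subseteq> (E \<inter> R \<times> R) \<union> {(p, q), (q, p)}"
  proof
    fix e assume e: "e \<in> R \<times> R - (\<lambda>x. (x, x)) ` R"
    then obtain u v where uv: "e = (u, v)" "u \<in> R" "v \<in> R" "u \<noteq> v" by auto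
    then show "e \<in> (E \<inter> R \<times> R) \<union> {(p, q), (q, p)}"
      using adj[of u v] by (auto simp: doubleton_eq_iff)
  qed
  then have "card (R \<times> R - (\<lambda>x. (x, x)) ` R) \<le> card ((E \<inter> R \<times> R) \<union> {(p, q), (q, p)})"
    by (rule card_mono[rotated]) (use finE in auto)
  also have "\<dots> \<le> card (E \<inter> R \<times> R) + card {(p, q), (q, p)}" by (rule card_Un_le)
  also have "\<dots> \<le> card (E \<inter> R \<times> R) + 2" by (cases "p = q") auto
  also have "card (R \<times> R - (\<lambda>x. (x, x)) ` R) = card R * card R - card R"
    using finR by (simp add: card_Diff_subset card_image inj_on_def card_cartesian_product image_subset_iff)
  also have "\<dots> = c * (c + 1)" using assms(2) by simp
  finally have "real (c * (c + 1)) \<le> real (card (E \<inter> R \<times> R) + 2)" by (simp only: of_nat_le_iff)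
  then have "real c * (real c + 1) \<le> real (card (E \<inter> R \<times> R)) + 2" by (simp add: algebra_simps)
  moreover have "pot c E R = potK c + real c * (real c + 1) - real (card (E \<inter> R \<times> R))"
    using clique_pot_eq assms(2) by (simp add: pot_def add.commute)
  ultimately have "(3 * real c - 2) / 2 < potK c + 2" using p by linarith
  then have "real c < 7 / 2 - 1 / real c" by (simp add: potK_def field_simps)
  then show False using c4 inv_c(1) by linarith
qed

lemma no_clique:
  assumes "R \<subseteq> V" "card R = c + 1" "clique E R"
  shows False
  by (rule no_almost_clique[OF assms(1,2)]) (use assms(3) in \<open>auto simp: clique_def\<close>)

section \<open>Twin classes and the extension of dicolourings over them\<close>

lemma cluster_V: "x \<in> V \<Longrightarrow> cluster E x \<subseteq> V"
  using EV by (auto simp: cluster_def twin_def)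

lemma finite_cluster [simp]: "x \<in> V \<Longrightarrow> finite (cluster E x)"
  using cluster_V fin finite_subset by blast

lemma cluster_out:
  assumes "x \<in> V"
  shows "card (out_nb E x) + 1 = card (cluster E x) + card (out_nb E x - cluster E x)"
proof -
  have "insert x (out_nb E x) = cluster E x \<union> (out_nb E x - cluster E x)"
    by (auto simp: cluster_def twin_def)
  moreover have "card (insert x (out_nb E x)) = card (out_nb E x) + 1" using noloop by simp
  moreover have "card (cluster E x \<union> (out_nb E x - cluster E x))
      = card (cluster E x) + card (out_nb E x - cluster E x)"
    by (rule card_Un_disjoint) (use assms in auto)
  ultimately show ?thesis by simp
qed

lemma cluster_in:
  assumes "x \<in> V"
  shows "card (in_nb E x) + 1 = card (cluster E x) + card (in_nb E x - cluster E x)"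
  using min_counterexample.cluster_out[OF converse assms] by simp

lemma cluster_card_pos: "x \<in> V \<Longrightarrow> 1 \<le> card (cluster E x)"
  using card_gt_0_iff[of "cluster E x"] by (metis One_nat_def Suc_leI cluster_self empty_iff finite_cluster)

text \<open>If \<open>y\<close> has few in-neighbours outside the cluster \<open>T\<close>, then colouring \<open>y\<close> by a colour missing
  among them and \<open>T\<close> by colours missing among its out-neighbours shows that every dicolouring of the
  rest is very special.\<close>

lemma cluster_colouring:
  assumes "low x" and y: "y \<in> V" "y \<notin> cluster E x" "(x, y) \<in> E"
    and deg: "card (in_nb E y - cluster E x) < c"
    and f: "dicol c (V - cluster E x - {y}) E f"
    and u: "u \<in> out_nb E x - cluster E x - {y}"
  shows "\<exists>z. z \<in> in_nb E x - cluster E x - {y} \<and> f z = f u \<and>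
    (u, z) \<in> (mono_arcs f (E \<inter> (V - cluster E x - {y}) \<times> (V - cluster E x - {y})))\<^sup>*"
proof -
  define T where "T = cluster E x"
  let ?U = "V - T - {y}"
  let ?A = "out_nb E x - T - {y}"
  \<comment> \<open>The palette for \<open>T\<close>: colours absent from the out-neighbours
    \<open>?A\<close>. As \<open>?A\<close> and \<open>T\<close> together have \<open>c\<close>
    elements, it contains at least \<open>card T\<close> colours.\<close>
  let ?P = "{..<c} - f ` ?A"
  have xV: "x \<in> V" using assms(1) by (simp add: low_def)
  have TV: "T \<subseteq> V" "finite T" "x \<in> T" using xV cluster_V by (auto simp: T_def)
  have yT: "y \<notin> T" using y by (simp add: T_def)
  have f: "dicol c ?U E f" using f by (simp add: T_def)
  have AU: "?A \<subseteq> ?U" using nb_V by blast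
  have cA: "card ?A + card T = c"
  proof -
    have "card (out_nb E x - T) = card ?A + 1"
      using y yT by (metis Diff_iff card_Suc_Diff1 Suc_eq_plus1 fin_nb(1) finite_Diff mem_out_nb)
    then show ?thesis using cluster_out[OF xV] assms(1) by (simp add: T_def low_def)
  qed
  obtain q where q: "q < c" "q \<notin> f ` (in_nb E y - T)"
    using missing_colour[OF _ deg] by (auto simp: T_def)
  \<comment> \<open>With \<open>card T\<close> colours left besides \<open>q\<close>, the set
    \<open>T\<close> avoids its out-neighbours, \<open>y\<close> avoids its in-neighbours, and
    \<open>f\<close> extends to \<open>V\<close>. So all counts are tight: \<open>q\<close> belongs
    to the palette and \<open>f\<close> is injective on \<open>?A\<close>.\<close>
  have Pq: "card (?P - {q}) < card T"
  proof (rule ccontr)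
    assume "\<not> card (?P - {q}) < card T"
    then obtain \<sigma> where \<sigma>: "inj_on \<sigma> T" "\<sigma> ` T \<subseteq> ?P - {q}"
      using card_le_inj[of T "?P - {q}"] TV by auto
    define h where "h v = (if v \<in> T then \<sigma> v else if v = y then q else f v)" for v
    have "dicol c ?U E h" by (rule dicol_cong[OF f]) (auto simp: h_def)
    then have "dicol c (?U \<union> T) E h"
    proof (rule dicol_add_out)
      show "h ` T \<subseteq> {..<c}" using \<sigma>(2) by (auto simp: h_def)
      fix z w assume zw: "z \<in> T" "w \<in> ?U \<union> T" "(z, w) \<in> E"
      show "h z \<noteq> h w"
      proof (cases "w \<in> T")
        case True
        then show ?thesis using zw noloop \<sigma>(1) by (auto simp: h_def inj_on_def)
      next
        case False
        then have "w \<in> ?A" using zw cluster_nb(1)[of z E x w] by (auto simp: T_def)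
        then have "f w \<in> f ` ?A" by blast
        then show ?thesis using False zw \<sigma>(2) by (auto simp: h_def)
      qed
    qed
    then have "dicol c (?U \<union> T \<union> {y}) E h"
    proof (rule dicol_add_in)
      fix z w assume zw: "z \<in> {y}" "w \<in> ?U \<union> T \<union> {y}" "(w, z) \<in> E"
      show "h z \<noteq> h w"
      proof (cases "w \<in> T")
        case True
        then show ?thesis using zw yT \<sigma>(2) by (auto simp: h_def)
      next
        case False
        then have "w \<noteq> y" "f w \<in> f ` (in_nb E y - T)" using zw noloop by auto
        then show ?thesis using False zw yT q by (auto simp: h_def)
      qed
    qed (use q yT in \<open>auto simp: h_def\<close>)
    moreover have "?U \<union> T \<union> {y} = V" using TV y by auto
    ultimately show False using uncol by (auto simp: dicolourable_def)
  qed
  have fA: "card (f ` ?A) \<le> card ?A" by (rule card_image_le) simp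
  have fAc: "f ` ?A \<subseteq> {..<c}" using f AU by (auto simp: dicol_def)
  have cP: "card ?P + card (f ` ?A) = c"
    using card_Diff_subset[of "f ` ?A" "{..<c}"] fAc card_mono[of "{..<c}" "f ` ?A"] by simp
  have qP: "q \<in> ?P"
  proof (rule ccontr)
    assume "q \<notin> ?P"
    then have "?P - {q} = ?P" by blast
    then show False using Pq cP fA cA by simp
  qed
  have cPq: "card (?P - {q}) + 1 = card ?P" using qP by (metis card_Suc_Diff1 Suc_eq_plus1 finite_Diff finite_lessThan)
  then have "card (f ` ?A) = card ?A" "card (?P - {q}) + 1 = card T" using Pq cP fA cA by linarith+
  then have injA: "inj_on f ?A" by (simp add: eq_card_imp_inj_on)
  have "card (T - {x}) = card (?P - {q})"
    using \<open>card (?P - {q}) + 1 = card T\<close> TV by (simp add: card_Diff_singleton)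
  then obtain \<sigma> where \<sigma>: "inj_on \<sigma> (T - {x})" "\<sigma> ` (T - {x}) \<subseteq> ?P - {q}"
    using card_le_inj[of "T - {x}" "?P - {q}"] TV by auto
  \<comment> \<open>One colour is lacking for \<open>T\<close>, so \<open>x\<close> borrows that of
    \<open>u\<close>. The extension fails, and it can only fail by a monochromatic cycle at
    \<open>x\<close>; injectivity on \<open>?A\<close> forces this cycle to leave \<open>x\<close>
    through \<open>u\<close>.\<close>
  define h where "h v = (if v = x then f u else if v \<in> T then \<sigma> v else if v = y then q else f v)" for v
  have uA: "u \<in> ?A" using u by (simp add: T_def)
  have hU: "h v = f v" if "v \<in> ?U" for v using that TV by (auto simp: h_def)
  have hU': "dicol c ?U E h" by (rule dicol_cong[OF f]) (simp add: hU)
  have "\<not> dicol c (insert x ?U) E h"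
  proof
    assume "dicol c (insert x ?U) E h"
    then have "dicol c (insert x ?U \<union> (T - {x})) E h"
    proof (rule dicol_add_out)
      show "h ` (T - {x}) \<subseteq> {..<c}" using \<sigma>(2) by (auto simp: h_def)
      fix z w assume zw: "z \<in> T - {x}" "w \<in> insert x ?U \<union> (T - {x})" "(z, w) \<in> E"
      have hz: "h z = \<sigma> z" "\<sigma> z \<in> ?P" using zw \<sigma>(2) by (auto simp: h_def)
      show "h z \<noteq> h w"
      proof (cases "w \<in> T - {x}")
        case True
        then show ?thesis using zw noloop \<sigma>(1) by (auto simp: h_def inj_on_def)
      next
        case wT: False
        show ?thesis
        proof (cases "w = x")
          case True
          then show ?thesis using hz uA by (auto simp: h_def)
        next
          case False
          then have "w \<in> ?A" using zw wT cluster_nb(1)[of z E x w] by (auto simp: T_def)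
          then have "f w \<in> f ` ?A" by blast
          moreover have "h w = f w" using \<open>w \<in> ?A\<close> AU hU by blast
          ultimately show ?thesis using hz by auto
        qed
      qed
    qed
    then have "dicol c (insert x ?U \<union> (T - {x}) \<union> {y}) E h"
    proof (rule dicol_add_in)
      fix z w assume zw: "z \<in> {y}" "w \<in> insert x ?U \<union> (T - {x}) \<union> {y}" "(w, z) \<in> E"
      have hy: "h y = q" using yT TV by (auto simp: h_def)
      consider "w = x" | "w \<in> T - {x}" | "w \<in> ?U" using zw noloop by auto
      then show "h z \<noteq> h w"
      proof cases
        case 1
        then show ?thesis using zw hy qP uA by (auto simp: h_def)
      next
        case 2
        then show ?thesis using zw hy \<sigma>(2) by (auto simp: h_def)
      next
        case 3
        then have "f w \<in> f ` (in_nb E y - T)" using zw by auto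
        then show ?thesis using 3 hU zw hy q by auto
      qed
    qed (use q yT TV in \<open>auto simp: h_def\<close>)
    moreover have "insert x ?U \<union> (T - {x}) \<union> {y} = V" using TV y by auto
    ultimately show False using uncol by (auto simp: dicolourable_def)
  qed
  moreover have hx: "h x = f u" by (simp add: h_def)
  have "f u < c" using fAc uA by blast
  then have "h ` insert x ?U \<subseteq> {..<c}"
    using hU' by (simp add: dicol_def hx)
  ultimately have nac: "\<not> acyclic (mono_arcs h (E \<inter> insert x ?U \<times> insert x ?U))"
    by (simp add: dicol_def)
  let ?r = "mono_arcs h E"
  have r: "?r \<inter> S \<times> S = mono_arcs h (E \<inter> S \<times> S)" for S by auto
  have "\<exists>u' z. u' \<in> ?U \<and> z \<in> ?U \<and> (x, u') \<in> ?r \<and> (u', z) \<in> (?r \<inter> ?U \<times> ?U)\<^sup>* \<and> (z, x) \<in> ?r"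
  proof (rule cycle_through)
    show "acyclic (?r \<inter> ?U \<times> ?U)" using hU' unfolding r by (simp add: dicol_def)
    show "\<not> acyclic (?r \<inter> insert x ?U \<times> insert x ?U)" using nac unfolding r .
  qed (use noloop in simp)
  then obtain u' z where *: "u' \<in> ?U" "z \<in> ?U" "(x, u') \<in> E" "h x = h u'" "(z, x) \<in> E" "h z = h x"
      "(u', z) \<in> (?r \<inter> ?U \<times> ?U)\<^sup>*"
    by auto
  have "u' \<in> ?A" "f u' = f u" using * hU hx by auto
  then have "u' = u" using injA uA by (meson inj_onD)
  moreover have "?r \<inter> ?U \<times> ?U \<subseteq> mono_arcs f (E \<inter> ?U \<times> ?U)"
  proof (rule subrelI)
    fix a b assume "(a, b) \<in> ?r \<inter> ?U \<times> ?U"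
    then show "(a, b) \<in> mono_arcs f (E \<inter> ?U \<times> ?U)" using hU[of a] hU[of b] by simp
  qed
  then have "(u', z) \<in> (mono_arcs f (E \<inter> ?U \<times> ?U))\<^sup>*" using *(7) rtrancl_mono by blast
  ultimately show ?thesis using * hU hx unfolding T_def by auto
qed

text \<open>Otherwise, adding arcs from all in-neighbours of \<open>x\<close> to a vertex \<open>u\<close> violating the inclusion would
  close the monochromatic paths of the previous lemma to cycles.\<close>

lemma out_subset_in:
  assumes "low x" and y: "y \<in> V" "y \<notin> cluster E x" "(x, y) \<in> E"
    and deg: "card (in_nb E y - cluster E x) < c"
  shows "out_nb E x - cluster E x - {y} \<subseteq> in_nb E x"
proof (rule ccontr)
  let ?T = "cluster E x"
  let ?U = "V - ?T - {y}"
  assume "\<not> ?thesis"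
  then obtain u where u: "u \<in> out_nb E x - ?T - {y}" "u \<notin> in_nb E x" by blast
  define A where "A = in_nb E x - ?T - {y}"
  define H where "H = A \<times> {u}"
  have xV: "x \<in> V" using assms(1) by (simp add: low_def)
  have AU: "A \<subseteq> ?U" "u \<in> ?U" "finite A" using nb_V[of x] u by (auto simp: A_def)
  have nd: "\<not> dicolourable c ?U (E \<union> H)"
  proof
    assume "dicolourable c ?U (E \<union> H)"
    then obtain f where f: "dicol c ?U (E \<union> H) f" by (auto simp: dicolourable_def)
    then have "dicol c ?U E f" by (rule dicol_subset) auto
    from cluster_colouring[OF assms this u(1)]
    obtain z where z: "z \<in> A" "f z = f u" "(u, z) \<in> (mono_arcs f (E \<inter> ?U \<times> ?U))\<^sup>*"
      by (auto simp: A_def)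
    let ?m = "mono_arcs f ((E \<union> H) \<inter> ?U \<times> ?U)"
    have "(u, z) \<in> ?m\<^sup>*" by (rule subsetD[OF rtrancl_mono z(3)]) auto
    moreover have "(z, u) \<in> ?m" using z AU by (auto simp: H_def)
    ultimately have "(u, u) \<in> ?m\<^sup>+" by (rule rtrancl_into_trancl1)
    then show False using f by (auto simp: dicol_def acyclic_def)
  qed
  have "?U \<subset> V" "H \<subseteq> ?U \<times> ?U" "irrefl H"
    using AU y(1) u(2) by (auto simp: H_def A_def irrefl_def)
  from uncolourable_add[OF this nd]
  obtain W where W: "W \<subseteq> ?U" "c + 1 \<le> card W"
      "pot c E W \<le> potK c + real (card ((H - E) \<inter> W \<times> W))" "(H - E) \<inter> W \<times> W \<noteq> {}"
    by (elim exE conjE)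
  have uW: "u \<in> W" using W(4) by (auto simp: H_def)
  have finW: "finite W" using W(1) fin by (meson finite_Diff finite_subset)
  have xW: "x \<notin> W" using W(1) by auto
  have "(H - E) \<inter> W \<times> W \<subseteq> (A \<inter> W) \<times> {u}" by (auto simp: H_def)
  then have "card ((H - E) \<inter> W \<times> W) \<le> card ((A \<inter> W) \<times> {u})"
    by (rule card_mono[rotated]) (use AU in auto)
  then have h: "card ((H - E) \<inter> W \<times> W) \<le> card (A \<inter> W)"
    by (simp add: card_cartesian_product)
  \<comment> \<open>The added arcs into \<open>u\<close> are paid for by genuine arcs from the same
    tails into \<open>x\<close>, and \<open>(x, u)\<close> is one arc more. So passing from
    \<open>W\<close> to \<open>?R\<close> leaves the potential at most
    \<open>potK c + ?a - 1\<close> with \<open>?a\<close> the coefficient of the vertex number,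
    still below the threshold.\<close>
  let ?R = "insert x W"
  have "(E \<inter> W \<times> W) \<union> ((A \<inter> W) \<times> {x} \<union> {(x, u)}) \<subseteq> E \<inter> ?R \<times> ?R"
    using u uW by (auto simp: A_def)
  then have "card ((E \<inter> W \<times> W) \<union> ((A \<inter> W) \<times> {x} \<union> {(x, u)})) \<le> card (E \<inter> ?R \<times> ?R)"
    by (rule card_mono[rotated]) (use finE in auto)
  moreover have "card ((E \<inter> W \<times> W) \<union> ((A \<inter> W) \<times> {x} \<union> {(x, u)}))
      = card (E \<inter> W \<times> W) + card ((A \<inter> W) \<times> {x} \<union> {(x, u)})"
    by (rule card_Un_disjoint) (use finE AU xW in auto)
  moreover have "card ((A \<inter> W) \<times> {x} \<union> {(x, u)}) = card ((A \<inter> W) \<times> {x}) + card {(x, u)}"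
    by (rule card_Un_disjoint) (use AU xW in auto)
  ultimately have "card (E \<inter> W \<times> W) + card (A \<inter> W) + 1 \<le> card (E \<inter> ?R \<times> ?R)"
    by (simp add: card_cartesian_product)
  then have "real (card (E \<inter> W \<times> W)) + real (card (A \<inter> W)) + 1 \<le> real (card (E \<inter> ?R \<times> ?R))"
    by linarith
  moreover have "real (card ((H - E) \<inter> W \<times> W)) \<le> real (card (A \<inter> W))" using h by simp
  moreover have "card ?R = card W + 1" using finW xW by simp
  ultimately have "pot c E ?R \<le> potK c + (real c + 1 / 2 - 1 / real c) - 1"
    using W(3) by (simp add: pot_def distrib_left)
  moreover have "potK c + (real c + 1 / 2 - 1 / real c) - 1 \<le> (3 * real c - 2) / 2"
    using inv_c(1) by (simp add: potK_def field_simps)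
  moreover have "?R \<subset> V" using W(1) xV y by auto
  ultimately show False using potential_gt[of ?R] W(2) \<open>card ?R = card W + 1\<close> by simp
qed

text \<open>Outside the cluster, the in-neighbours of \<open>x\<close> are the vertices of \<open>A\<close> and one further vertex \<open>z0\<close>.
  A dicolouring of the digraph without the cluster but with the arc \<open>(z0, y)\<close> extends.\<close>

lemma simple_arc_contra:
  assumes "low x" and y: "y \<in> V" "y \<notin> cluster E x" "(x, y) \<in> E" "(y, x) \<notin> E"
    and sub: "out_nb E x - cluster E x - {y} \<subseteq> in_nb E x"
  shows False
proof -
  define T where "T = cluster E x"
  let ?U = "V - T"
  define A where "A = out_nb E x - T - {y}"
  have xV: "x \<in> V" using assms(1) by (simp add: low_def)
  have TV: "T \<subseteq> V" "finite T" "x \<in> T" using xV cluster_V by (auto simp: T_def)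
  have yT: "y \<notin> T" using y by (simp add: T_def)
  have finA: "finite A" by (simp add: A_def)
  have AV: "A \<subseteq> ?U" using nb_V[of x] by (auto simp: A_def)
  have cA: "card A + card T = c"
  proof -
    have "card (out_nb E x - T) = card A + 1"
      using y yT by (metis A_def Diff_iff card_Suc_Diff1 Suc_eq_plus1 fin_nb(1) finite_Diff mem_out_nb)
    then show ?thesis using cluster_out[OF xV] assms(1) by (simp add: T_def low_def)
  qed
  have "card (in_nb E x - T) = card A + 1"
    using cluster_in[OF xV] assms(1) cA by (simp add: T_def low_def)
  moreover have Asub: "A \<subseteq> in_nb E x - T" using sub by (auto simp: A_def T_def)
  ultimately have "card (in_nb E x - T - A) = 1"
    by (simp add: card_Diff_subset[OF finA])
  then obtain z0 where z0: "in_nb E x - T - A = {z0}" by (rule card_1_singletonE)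
  then have z0x: "(z0, x) \<in> E" "z0 \<notin> T" "z0 \<notin> A" by auto
  have z0y: "z0 \<noteq> y" using z0x y by auto
  have z0V: "z0 \<in> V" using z0x EV by auto
  have "dicolourable c ?U (E \<union> {(z0, y)})"
  proof (rule ccontr)
    assume "\<not> ?thesis"
    then obtain W where W: "W \<subseteq> ?U" "c + 1 \<le> card W"
        "pot c E W \<le> potK c + real (card (({(z0, y)} - E) \<inter> W \<times> W))"
      using uncolourable_add[of ?U "{(z0, y)}"] z0y z0V z0x y yT xV TV by (auto simp: irrefl_def)
    have "card (({(z0, y)} - E) \<inter> W \<times> W) \<le> card {(z0, y)}" by (rule card_mono) auto
    then have "pot c E W \<le> potK c + 1" using W(3) by simp
    moreover have "W \<subset> V" using W(1) TV xV by blast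
    then have "pot c E W > (3 * real c - 2) / 2" using potential_gt W(2) by blast
    ultimately have "(3 * real c - 2) / 2 < potK c + 1" by linarith
    then have "real c < 3 / 2 - 1 / real c" by (simp add: potK_def field_simps)
    then show False using c4 inv_c(1) by linarith
  qed
  then obtain g where g: "dicol c ?U (E \<union> {(z0, y)}) g" by (auto simp: dicolourable_def)
  then have gE: "dicol c ?U E g" by (rule dicol_subset) auto
  let ?P = "{..<c} - g ` A"
  have "card T \<le> card ?P" using card_missing_colours[OF finA, of c g] cA by linarith
  then obtain \<sigma> where \<sigma>: "inj_on \<sigma> T" "\<sigma> ` T \<subseteq> ?P"
    using card_le_inj[of T ?P] TV by auto
  define h where "h v = (if v \<in> T then \<sigma> v else g v)" for v
  have hU: "dicol c ?U E h" by (rule dicol_cong[OF gE]) (auto simp: h_def)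
  \<comment> \<open>\<open>T\<close> is coloured from the palette missing on \<open>A\<close>, so
    monochromatic arcs out of \<open>T\<close> go to \<open>y\<close> only and monochromatic arcs
    into \<open>T\<close> come from \<open>z0\<close> only.\<close>
  have out: "h z \<noteq> h w" if "z \<in> T" "(z, w) \<in> E" "w \<noteq> y" for z w
  proof (cases "w \<in> T")
    case True
    then show ?thesis using that noloop \<sigma>(1) by (auto simp: h_def inj_on_def)
  next
    case False
    then have "w \<in> A" using that cluster_nb(1)[of z E x w] by (auto simp: T_def A_def)
    then have "g w \<in> g ` A" by blast
    then show ?thesis using False that \<sigma>(2) by (auto simp: h_def)
  qed
  have inT: "w = z0" if "z \<in> T" "(w, z) \<in> E" "w \<notin> T" "h w = h z" for w z
  proof -
    have "w \<in> in_nb E x - T" using that cluster_nb(2)[of z E x w] by (auto simp: T_def)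
    moreover have "w \<notin> A"
    proof
      assume "w \<in> A"
      then have "g w \<in> g ` A" by blast
      then show False using that \<sigma>(2) by (auto simp: h_def)
    qed
    ultimately show ?thesis using z0 by blast
  qed
  \<comment> \<open>A monochromatic cycle through \<open>z\<close> comes in from \<open>z0\<close>
    and goes out to \<open>y\<close>, and its path from \<open>y\<close> to \<open>z0\<close> is
    already closed to a cycle by the added arc.\<close>
  have fin_step: "dicol c (insert z ?U) E h" if z: "z \<in> T" for z
  proof (rule ccontr)
    assume n: "\<not> dicol c (insert z ?U) E h"
    have "h ` insert z ?U \<subseteq> {..<c}" using hU z \<sigma>(2) by (auto simp: dicol_def h_def)
    then have nac: "\<not> acyclic (mono_arcs h (E \<inter> insert z ?U \<times> insert z ?U))"
      using n by (simp add: dicol_def)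
    let ?r = "mono_arcs h E"
    have r: "?r \<inter> S \<times> S = mono_arcs h (E \<inter> S \<times> S)" for S by auto
    have "\<exists>u' z'. u' \<in> ?U \<and> z' \<in> ?U \<and> (z, u') \<in> ?r \<and> (u', z') \<in> (?r \<inter> ?U \<times> ?U)\<^sup>* \<and> (z', z) \<in> ?r"
    proof (rule cycle_through)
      show "acyclic (?r \<inter> ?U \<times> ?U)" using hU unfolding r by (simp add: dicol_def)
      show "\<not> acyclic (?r \<inter> insert z ?U \<times> insert z ?U)" using nac unfolding r .
    qed (use noloop in simp)
    then obtain u' z' where *: "u' \<in> ?U" "z' \<in> ?U" "(z, u') \<in> E" "h z = h u'" "(z', z) \<in> E" "h z' = h z"
      "(u', z') \<in> (?r \<inter> ?U \<times> ?U)\<^sup>*"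
      by auto
    have "u' = y" using out[OF z *(3)] *(4) by blast
    moreover have "z' = z0" using inT[OF z *(5)] * by blast
    ultimately have p: "(y, z0) \<in> (?r \<inter> ?U \<times> ?U)\<^sup>*" and eq: "h z0 = h y" using * by auto
    let ?m = "mono_arcs g ((E \<union> {(z0, y)}) \<inter> ?U \<times> ?U)"
    have "?r \<inter> ?U \<times> ?U \<subseteq> ?m" by (auto simp: h_def)
    then have "(y, z0) \<in> ?m\<^sup>*" using p rtrancl_mono by blast
    moreover have "(z0, y) \<in> ?m" using eq z0x z0V y yT by (auto simp: h_def)
    ultimately have "(y, y) \<in> ?m\<^sup>+" by (rule rtrancl_into_trancl1)
    then show False using g by (auto simp: dicol_def acyclic_def)
  qed
  \<comment> \<open>At most one vertex of \<open>T\<close> shares the colour of \<open>y\<close>.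
    The others have no monochromatic out-arcs and can be added last.\<close>
  obtain z where z: "z \<in> T" "\<And>z'. z' \<in> T - {z} \<Longrightarrow> h z' \<noteq> h y"
  proof (cases "\<exists>z \<in> T. h z = h y")
    case True
    then obtain z where "z \<in> T" "h z = h y" by blast
    then have "h z' \<noteq> h y" if "z' \<in> T - {z}" for z'
      using that \<sigma>(1) by (auto simp: h_def inj_on_def)
    then show ?thesis using that \<open>z \<in> T\<close> by blast
  next
    case False
    then show ?thesis using that[of x] TV by auto
  qed
  have "dicol c (insert z ?U \<union> (T - {z})) E h"
  proof (rule dicol_add_out[OF fin_step[OF z(1)]])
    show "h ` (T - {z}) \<subseteq> {..<c}" using \<sigma>(2) by (auto simp: h_def)
    show "h z' \<noteq> h w" if "z' \<in> T - {z}" "w \<in> insert z ?U \<union> (T - {z})" "(z', w) \<in> E" for z' w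
      using that out[of z' w] z(2)[of z'] by blast
  qed
  moreover have "insert z ?U \<union> (T - {z}) = V" using TV z by auto
  ultimately show False using uncol by (auto simp: dicolourable_def)
qed

end

lemma cliqueD: "clique E R \<Longrightarrow> u \<in> R \<Longrightarrow> v \<in> R \<Longrightarrow> u \<noteq> v \<Longrightarrow> (u, v) \<in> E"
  by (simp add: clique_def)

section \<open>Replacement by twins, exceptional neighbours and degree bounds\<close>

context min_counterexample
begin

text \<open>The closed out-neighbourhood of \<open>x\<close> is a complete digraph on
  \<open>c + 1\<close> vertices but for arcs at \<open>y\<close>. Replacing \<open>y\<close> by a
  twin of \<open>x\<close> completes this digraph, so no contradiction can be drawn.\<close>

definition exceptional :: "'a \<Rightarrow> 'a \<Rightarrow> bool" where
  "exceptional x y \<longleftrightarrow> low x \<and> y \<notin> cluster E x \<and> (x, y) \<in> E \<and> (y, x) \<in> E \<and>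
     clique E (insert x (out_nb E x) - {y})"

text \<open>Replacing \<open>y\<close> by a further twin of \<open>x\<close> keeps the digraph uncolourable. Either the dicritical
  subdigraph obtained misses a vertex and yields a set of small potential, which must be a clique, or
  it is a smaller counterexample; for \<open>y\<close> of minimum degree only because it has more twins.\<close>

lemma twin_replacement:
  assumes "low x" and y: "y \<in> V" "y \<notin> cluster E x" "(x, y) \<in> E" "(y, x) \<in> E"
    and deg: "card (in_nb E y - cluster E x) < c"
    and ord: "\<not> low y \<or> card (cluster E y) \<le> card (cluster E x)"
  shows "exceptional x y"
proof -
  define T where "T = cluster E x"
  have xV: "x \<in> V" using assms(1) by (simp add: low_def)
  have TV: "T \<subseteq> V" "finite T" "x \<in> T" using xV cluster_V by (auto simp: T_def)
  have yT: "y \<notin> T" and xy: "x \<noteq> y" using y by (auto simp: T_def)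
  have cT: "(u, v) \<in> E" if "u \<in> T" "v \<in> T" "u \<noteq> v" for u v
    using clique_cluster[of E x] that by (simp add: clique_def T_def)
  \<comment> \<open>In \<open>E'\<close> the vertex \<open>y\<close> keeps its name but has the arcs
    of \<open>x\<close> and a digon to \<open>x\<close>.\<close>
  define \<tau> where "\<tau> v = (if v = y then x else v)" for v
  define E' where "E' = {(u, v) \<in> V \<times> V. (\<tau> u, \<tau> v) \<in> E} \<union> {(x, y), (y, x)}"
  have E'_id: "(u, v) \<in> E' \<longleftrightarrow> (u, v) \<in> E" if "u \<noteq> y" "v \<noteq> y" for u v
    using that EV by (auto simp: E'_def \<tau>_def)
  have E'_out: "(y, v) \<in> E' \<longleftrightarrow> v \<noteq> y \<and> (v = x \<or> (x, v) \<in> E)" for v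
    using EV noloop y xy by (auto simp: E'_def \<tau>_def)
  have E'_in: "(v, y) \<in> E' \<longleftrightarrow> v \<noteq> y \<and> (v = x \<or> (v, x) \<in> E)" for v
    using EV noloop y xy by (auto simp: E'_def \<tau>_def)
  have E'V: "E' \<subseteq> V \<times> V" using xV y by (auto simp: E'_def)
  have irr: "irrefl E'" using noloop xy by (auto simp: E'_def irrefl_def)
  have finE': "finite E'" using E'V fin finite_subset by blast
  have clq: "(u, v) \<in> E'" if uv: "u \<in> insert y T" "v \<in> insert y T" "u \<noteq> v" for u v
  proof -
    consider "u = y" "v \<in> T" | "v = y" "u \<in> T" | "u \<noteq> y" "v \<noteq> y" "u \<in> T" "v \<in> T"
      using uv yT by auto
    then show ?thesis
    proof cases
      case 1
      then show ?thesis using cT[of x v] TV yT by (auto simp: E'_out)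
    next
      case 2
      then show ?thesis using cT[of u x] TV yT by (auto simp: E'_in)
    next
      case 3
      then show ?thesis using cT uv by (simp add: E'_id)
    qed
  qed
  have "\<not> dicolourable c V E'"
  proof
    assume "dicolourable c V E'"
    then obtain f where f: "dicol c V E' f" by (auto simp: dicolourable_def)
    let ?m = "mono_arcs f (E' \<inter> V \<times> V)"
    have m: "acyclic ?m" using f by (simp add: dicol_def)
    have YV: "insert y T \<subseteq> V" using TV y by auto
    have injf: "inj_on f (insert y T)"
    proof (rule inj_onI, rule ccontr)
      fix u v assume uv: "u \<in> insert y T" "v \<in> insert y T" "f u = f v" "u \<noteq> v"
      then have "(u, v) \<in> ?m" "(v, u) \<in> ?m" using clq[of u v] clq[of v u] YV by auto
      then have "(u, u) \<in> ?m\<^sup>+" by (rule trancl_into_trancl[OF r_into_trancl])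
      then show False using m by (simp add: acyclic_def)
    qed
    obtain q where q: "q < c" "q \<notin> f ` (in_nb E y - T)"
      using missing_colour[OF _ deg, of f] by (auto simp: T_def)
    \<comment> \<open>In \<open>E'\<close> the vertices of \<open>insert y T\<close> are twins of
      pairwise distinct colours, so their colours may be redistributed. At most one of them has
      colour \<open>q\<close>; \<open>T\<close> takes over colours other than \<open>q\<close>, and
      \<open>y\<close> gets \<open>q\<close>, which then no in-neighbour of \<open>y\<close> in
      \<open>E\<close> has.\<close>
    define S where "S = {v \<in> insert y T. f v \<noteq> q}"
    have "card (insert y T) \<le> card S + 1"
    proof -
      have "card (f ` insert y T - {q}) = card (f ` S)"
        by (rule arg_cong[of _ _ card]) (auto simp: S_def)
      also have "\<dots> \<le> card S" by (rule card_image_le) (use TV in \<open>auto simp: S_def\<close>)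
      finally have "card (f ` insert y T - {q}) \<le> card S" .
      moreover have "card (f ` insert y T) \<le> card (f ` insert y T - {q}) + 1"
        using diff_card_le_card_Diff[of "{q}" "f ` insert y T"] by (simp del: image_insert)
      ultimately show ?thesis using card_image[OF injf] by linarith
    qed
    then have "card T \<le> card S" using TV yT by simp
    moreover have "finite S" using TV by (simp add: S_def)
    ultimately obtain \<pi> where \<pi>: "\<pi> ` T \<subseteq> S" "inj_on \<pi> T"
      using card_le_inj[of T S] TV by blast
    define h where "h v = (if v = y then q else if v \<in> T then f (\<pi> v) else f v)" for v
    define p where "p v = (if v \<in> T then \<pi> v else v)" for v
    have pS: "\<pi> v \<in> insert y T" "f (\<pi> v) \<noteq> q" if "v \<in> T" for v
      using \<pi>(1) that by (auto simp: S_def)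
    have "dicol c (V - {y}) E h"
      unfolding dicol_def
    proof
      show "h ` (V - {y}) \<subseteq> {..<c}"
      proof (rule image_subsetI)
        fix v assume v: "v \<in> V - {y}"
        have fV: "f w < c" if "w \<in> V" for w using f that by (auto simp: dicol_def)
        show "h v \<in> {..<c}"
          using v fV[of v] fV[of "\<pi> v"] pS(1)[of v] YV by (auto simp: h_def)
      qed
      show "acyclic (mono_arcs h (E \<inter> (V - {y}) \<times> (V - {y})))"
      proof (rule acyclic_hom[OF m, where h = p])
        fix u v assume uv: "(u, v) \<in> mono_arcs h (E \<inter> (V - {y}) \<times> (V - {y}))"
        then have e: "(u, v) \<in> E" "u \<in> V" "v \<in> V" "u \<noteq> y" "v \<noteq> y" "h u = h v" by auto
        have hp: "h w = f (p w)" if "w \<noteq> y" for w using that by (simp add: h_def p_def)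
        have pV: "p w \<in> V" if "w \<in> V" for w using that pS YV by (auto simp: p_def)
        have "(p u, p v) \<in> E'"
        proof -
          consider "u \<in> T" "v \<in> T" | "u \<in> T" "v \<notin> T" | "u \<notin> T" "v \<in> T" | "u \<notin> T" "v \<notin> T" by blast
          then show ?thesis
          proof cases
            case 1
            have "f (\<pi> u) = f (\<pi> v)" using e 1 by (simp add: h_def)
            then have "\<pi> u = \<pi> v" using injf pS 1 by (meson inj_onD)
            then have "u = v" using \<pi>(2) 1 by (meson inj_onD)
            then show ?thesis using e noloop by blast
          next
            case 2
            have xv: "(z, v) \<in> E" if "z \<in> T" for z
              using cluster_nb(1)[of _ E x v] 2 that e(1) unfolding T_def by blast
            then have "(x, v) \<in> E" using TV by blast
            then show ?thesis
              using pS[OF 2(1)] 2 xv e by (cases "\<pi> u = y") (auto simp: p_def E'_out E'_id)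
          next
            case 3
            have xv: "(u, z) \<in> E" if "z \<in> T" for z
              using cluster_nb(2)[of _ E x u] 3 that e(1) unfolding T_def by blast
            then have "(u, x) \<in> E" using TV by blast
            then show ?thesis
              using pS[OF 3(2)] 3 xv e by (cases "\<pi> v = y") (auto simp: p_def E'_in E'_id)
          next
            case 4
            then show ?thesis using e by (simp add: p_def E'_id)
          qed
        qed
        then show "(p u, p v) \<in> ?m" using e hp pV by simp
      qed
    qed
    then have "dicol c (V - {y} \<union> {y}) E h"
    proof (rule dicol_add_in)
      fix z w assume zw: "z \<in> {y}" "w \<in> V - {y} \<union> {y}" "(w, z) \<in> E"
      have wy: "w \<noteq> y" using zw noloop by auto
      show "h z \<noteq> h w"
      proof (cases "w \<in> T")
        case True
        then show ?thesis using zw wy pS(2)[of w] by (auto simp: h_def)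
      next
        case False
        then have "f w \<in> f ` (in_nb E y - T)" using zw by auto
        then show ?thesis using zw wy False q by (auto simp: h_def)
      qed
    qed (use q in \<open>auto simp: h_def\<close>)
    moreover have "V - {y} \<union> {y} = V" using y by auto
    ultimately show False using uncol by (auto simp: dicolourable_def)
  qed
  from exists_dicritical_sub[OF fin E'V irr this]
  obtain W F where WF: "W \<subseteq> V" "F \<subseteq> E'" "dicritical_rel c W F"
    by (elim exE conjE)
  note W = dicritical_relD[OF WF(3)]
  have yW: "y \<in> W"
  proof (rule ccontr)
    assume yW: "y \<notin> W"
    have "F \<subseteq> E"
    proof (rule subrelI)
      fix u v assume uv: "(u, v) \<in> F"
      then have "u \<noteq> y" "v \<noteq> y" using W(2) yW by auto
      then show "(u, v) \<in> E" using uv WF(2) E'_id by blast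
    qed
    moreover have "(W, F) \<noteq> (V, E)" using yW y by auto
    ultimately have "dicolourable c W F"
      using dicritical_rel_proper[OF crit WF(1)] W(2) by blast
    then show False using W(4) by blast
  qed
  have out': "out_nb E' y = insert x (out_nb E x - {y})" using xy by (auto simp: E'_out)
  have in': "in_nb E' y = insert x (in_nb E x - {y})" using xy by (auto simp: E'_in)
  have c': "card (out_nb E' y) = c" "card (in_nb E' y) = c"
    using assms(1) y noloop c4 by (simp_all add: out' in' low_def card_Diff_singleton)
  define R where "R = W - {y}"
  have RV: "R \<subset> V" using WF(1) y by (auto simp: R_def)
  have cR: "card W = card R + 1" using card_Suc_Diff1[OF W(1) yW] by (simp add: R_def)
  have star: "card F \<le> card (F \<inter> S \<times> S) + (card (out_nb F y) + card (in_nb F y))"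
    if "F \<subseteq> insert y S \<times> insert y S" "finite F" for F :: "('a \<times> 'a) set" and S
  proof -
    note finn = finite_out_nb[OF that(2), of y] finite_in_nb[OF that(2), of y]
    have "F \<subseteq> (F \<inter> S \<times> S) \<union> ({y} \<times> out_nb F y \<union> in_nb F y \<times> {y})" using that(1) by auto
    then have "card F \<le> card ((F \<inter> S \<times> S) \<union> ({y} \<times> out_nb F y \<union> in_nb F y \<times> {y}))"
      by (rule card_mono[rotated]) (use that(2) finn in auto)
    also have "\<dots> \<le> card (F \<inter> S \<times> S) + card ({y} \<times> out_nb F y \<union> in_nb F y \<times> {y})"
      by (rule card_Un_le)
    also have "card ({y} \<times> out_nb F y \<union> in_nb F y \<times> {y}) \<le> card ({y} \<times> out_nb F y) + card (in_nb F y \<times> {y})"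
      by (rule card_Un_le)
    finally show ?thesis by (simp add: card_cartesian_product)
  qed
  have fin_nb': "finite (out_nb E' y)" "finite (in_nb E' y)" by (auto simp: out' in')
  show ?thesis
  proof (cases "W = V")
    case False
    then have "card W < card V" using WF(1) fin by (meson psubsetI psubset_card_mono)
    then have pW: "pot c F W \<le> potK c" using small_card WF(3) by blast
    have "card (out_nb F y) \<le> card (out_nb E' y)" "card (in_nb F y) \<le> card (in_nb E' y)"
      using WF(2) fin_nb' by (auto intro!: card_mono)
    moreover have "F \<inter> R \<times> R \<subseteq> E \<inter> R \<times> R" using WF(2) E'_id by (auto simp: R_def)
    then have "card (F \<inter> R \<times> R) \<le> card (E \<inter> R \<times> R)"
      by (rule card_mono[rotated]) (use finE in auto)
    moreover have "F \<subseteq> insert y R \<times> insert y R" using W(2) by (auto simp: R_def)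
    ultimately have "card F \<le> card (E \<inter> R \<times> R) + 2 * c"
      using star[of F R] W(5) c' by linarith
    then have "real (card F) \<le> real (card (E \<inter> R \<times> R)) + 2 * real c" by linarith
    moreover have "pot c F W = (real c + 1 / 2 - 1 / real c) * (real (card R) + 1) - real (card F)"
      using W(2) cR by (simp add: pot_def Int_absorb2 add.commute)
    ultimately have "pot c E R \<le> potK c - (real c + 1 / 2 - 1 / real c) + 2 * real c"
      using pW by (simp add: pot_def distrib_left)
    \<comment> \<open>Exactly the threshold of \<open>potential_gt\<close>: \<open>R\<close> has
      only \<open>c\<close> vertices and \<open>W\<close> spans a complete digraph, which is the
      exceptional case.\<close>
    also have "\<dots> = (3 * real c - 2) / 2" by (simp add: potK_def field_simps)
    finally have "\<not> c + 1 \<le> card R" using potential_gt[OF RV] by linarith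
    then have cW: "card W = c + 1" using cR dicritical_rel_card[OF WF(3)] by linarith
    have compl: "(u, v) \<in> F" if "u \<in> W" "v \<in> W" "u \<noteq> v" for u v
      using dicritical_rel_complete[OF WF(3) cW that] .
    have "R = out_nb E' y"
    proof (rule card_seteq[OF fin_nb'(1)])
      show "R \<subseteq> out_nb E' y"
      proof
        fix v assume "v \<in> R"
        then have "(y, v) \<in> F" using compl[OF yW, of v] by (auto simp: R_def)
        then show "v \<in> out_nb E' y" using WF(2) by auto
      qed
      show "card (out_nb E' y) \<le> card R" using c' cW cR by simp
    qed
    then have Req: "R = insert x (out_nb E x) - {y}" using xy by (auto simp: out')
    have "clique E R"
      unfolding clique_def
    proof (intro ballI impI)
      fix u v assume "u \<in> R" "v \<in> R" "u \<noteq> v"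
      then show "(u, v) \<in> E" using compl[of u v] WF(2) E'_id[of u v] by (auto simp: R_def)
    qed
    then show ?thesis using assms y unfolding exceptional_def Req by blast
  next
    case True
    have EyE: "card E' \<le> card (E \<inter> (V - {y}) \<times> (V - {y})) + 2 * c"
    proof -
      have "E' \<inter> (V - {y}) \<times> (V - {y}) = E \<inter> (V - {y}) \<times> (V - {y})" using E'_id by auto
      moreover have "insert y (V - {y}) = V" using y by auto
      ultimately show ?thesis using star[of E' "V - {y}"] E'V finE' c' by simp
    qed
    have Ey: "card (E \<inter> (V - {y}) \<times> (V - {y})) + (card (out_nb E y) + card (in_nb E y)) \<le> card E"
    proof -
      have "card ((E \<inter> (V - {y}) \<times> (V - {y})) \<union> ({y} \<times> out_nb E y \<union> in_nb E y \<times> {y})) \<le> card E"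
        by (rule card_mono) (use finE in auto)
      moreover have "card ((E \<inter> (V - {y}) \<times> (V - {y})) \<union> ({y} \<times> out_nb E y \<union> in_nb E y \<times> {y}))
          = card (E \<inter> (V - {y}) \<times> (V - {y})) + card ({y} \<times> out_nb E y \<union> in_nb E y \<times> {y})"
        by (rule card_Un_disjoint) (use finE in auto)
      moreover have "card ({y} \<times> out_nb E y \<union> in_nb E y \<times> {y}) = card ({y} \<times> out_nb E y) + card (in_nb E y \<times> {y})"
        by (rule card_Un_disjoint) (use noloop in auto)
      ultimately show ?thesis by (simp add: card_cartesian_product)
    qed
    have FE': "card F \<le> card E'" by (rule card_mono[OF finE' WF(2)])
    have dy: "c \<le> card (out_nb E y)" "c \<le> card (in_nb E y)" using degree_ge y by auto
    \<comment> \<open>At least \<open>2 * c\<close> arcs at \<open>y\<close> were replaced by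
      exactly \<open>2 * c\<close>. In a tie \<open>y\<close> is low; it loses the pairs with its
      own twins, at most \<open>2 * (card T - 1)\<close>, and wins \<open>2 * card T\<close> pairs
      with \<open>T\<close>.\<close>
    have "smaller W F V E"
    proof (cases "card F < card E")
      case True
      then show ?thesis using \<open>W = V\<close> by (simp add: smaller_def)
    next
      case False
      then have eq: "card F = card E" "card F = card E'" "card (out_nb E y) = c" "card (in_nb E y) = c"
        using FE' EyE Ey dy by linarith+
      then have FeqE': "F = E'" using card_subset_eq[OF finE' WF(2)] by simp
      have "low y" using eq y by (simp add: low_def)
      then have ty: "card (cluster E y) \<le> card T" using ord by (simp add: T_def)
      define N where "N = {(u, v) \<in> twin_pairs V E. u \<noteq> y \<and> v \<noteq> y}"
      have finN: "finite N" by (rule finite_subset[of _ "V \<times> V"]) (use fin in \<open>auto simp: N_def twin_pairs_def\<close>)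
      define Cy where "Cy = cluster E y - {y}"
      have finCy: "finite Cy" using y by (simp add: Cy_def)
      have cCy: "card Cy + 1 = card (cluster E y)"
        using card_Suc_Diff1[of "cluster E y" y] y by (simp add: Cy_def)
      have "twin_pairs V E \<subseteq> N \<union> ({y} \<times> Cy \<union> Cy \<times> {y})"
        by (auto simp: N_def twin_pairs_def Cy_def cluster_def dest: twin_sym) (auto simp: twin_def)
      then have "card (twin_pairs V E) \<le> card (N \<union> ({y} \<times> Cy \<union> Cy \<times> {y}))"
        by (rule card_mono[rotated]) (use finN finCy in auto)
      also have "\<dots> \<le> card N + card ({y} \<times> Cy \<union> Cy \<times> {y})" by (rule card_Un_le)
      also have "card ({y} \<times> Cy \<union> Cy \<times> {y}) \<le> card ({y} \<times> Cy) + card (Cy \<times> {y})"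
        by (rule card_Un_le)
      finally have up: "card (twin_pairs V E) \<le> card N + 2 * card Cy"
        by (simp add: card_cartesian_product)
      have tN: "twin E' u v" if "twin E u v" "u \<noteq> y" "v \<noteq> y" for u v
        unfolding twin_def
      proof (intro conjI allI impI)
        show "u \<noteq> v" "(u, v) \<in> E'" "(v, u) \<in> E'" using that E'_id by (auto simp: twin_def)
        fix w assume w: "w \<noteq> u" "w \<noteq> v"
        show "((u, w) \<in> E') = ((v, w) \<in> E')"
        proof (cases "w = y")
          case True
          then show ?thesis using that w by (cases "u = x"; cases "v = x") (auto simp: E'_in twin_def)
        next
          case False
          then show ?thesis using that w by (auto simp: E'_id twin_def)
        qed
        show "((w, u) \<in> E') = ((w, v) \<in> E')"
        proof (cases "w = y")
          case True
          then show ?thesis using that w by (cases "u = x"; cases "v = x") (auto simp: E'_out twin_def)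
        next
          case False
          then show ?thesis using that w by (auto simp: E'_id twin_def)
        qed
      qed
      have ty': "twin E' y z" if z: "z \<in> T" for z
      proof -
        have zy: "z \<noteq> y" using z yT by blast
        show ?thesis
        proof (cases "z = x")
          case True
          then show ?thesis using xy unfolding twin_def by (auto simp: E'_out E'_in E'_id)
        next
          case False
          then have tw: "twin E x z" using z by (simp add: T_def cluster_def)
          have xz: "(x, z) \<in> E" "(z, x) \<in> E" using tw by (auto simp: twin_def)
          show ?thesis
            unfolding twin_def
          proof (intro conjI allI impI)
            show "y \<noteq> z" "(y, z) \<in> E'" "(z, y) \<in> E'" using zy xz by (auto simp: E'_out E'_in)
            fix w assume w: "w \<noteq> y" "w \<noteq> z"
            show "((y, w) \<in> E') = ((z, w) \<in> E')"
              using tw w zy xz by (cases "w = x") (auto simp: E'_out E'_id twin_def)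
            show "((w, y) \<in> E') = ((w, z) \<in> E')"
              using tw w zy xz by (cases "w = x") (auto simp: E'_in E'_id twin_def)
          qed
        qed
      qed
      have "N \<union> ({y} \<times> T \<union> T \<times> {y}) \<subseteq> twin_pairs V E'"
        using tN ty' TV y by (auto simp: N_def twin_pairs_def intro: twin_sym)
      then have "card (N \<union> ({y} \<times> T \<union> T \<times> {y})) \<le> card (twin_pairs V E')"
        by (rule card_mono[rotated]) (rule finite_subset[of _ "V \<times> V"], use fin in \<open>auto simp: twin_pairs_def\<close>)
      moreover have "card (N \<union> ({y} \<times> T \<union> T \<times> {y})) = card N + card ({y} \<times> T \<union> T \<times> {y})"
        by (rule card_Un_disjoint) (use finN TV in \<open>auto simp: N_def\<close>)
      moreover have "card ({y} \<times> T \<union> T \<times> {y}) = card ({y} \<times> T) + card (T \<times> {y})"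
        by (rule card_Un_disjoint) (use TV yT in auto)
      ultimately have "card N + 2 * card T \<le> card (twin_pairs V E')"
        by (simp add: card_cartesian_product)
      then have "card (twin_pairs V E) < card (twin_pairs V E')"
        using up cCy ty by linarith
      then show ?thesis using \<open>W = V\<close> eq FeqE' by (simp add: smaller_def)
    qed
    then have "pot c F W \<le> potK c" using small WF(3) by blast
    moreover have "card F \<le> card E" using FE' EyE Ey dy by linarith
    then have "pot c F W \<ge> pot c E V"
      using True W(2) pot_V by (simp add: pot_def Int_absorb2)
    ultimately show ?thesis using big by linarith
  qed
qed

lemma low_converse: "min_counterexample.low c V (E\<inverse>) v \<longleftrightarrow> low v"
  by (auto simp: low_def min_counterexample.low_def[OF converse])

lemma exceptional_in:
  assumes "exceptional x y"
  shows "in_nb E x = out_nb E x"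
proof -
  note e = assms[unfolded exceptional_def]
  have xy: "x \<noteq> y" using e by auto
  have "out_nb E x \<subseteq> in_nb E x"
  proof
    fix v assume v: "v \<in> out_nb E x"
    then have "v \<noteq> x" using noloop by auto
    show "v \<in> in_nb E x"
    proof (cases "v = y")
      case True
      then show ?thesis using e by simp
    next
      case False
      then have "v \<in> insert x (out_nb E x) - {y}" "x \<in> insert x (out_nb E x) - {y}"
        using v xy by auto
      then have "(v, x) \<in> E" using e \<open>v \<noteq> x\<close> unfolding clique_def by blast
      then show ?thesis by simp
    qed
  qed
  moreover have "card (out_nb E x) = card (in_nb E x)" using e by (simp add: low_def)
  ultimately show ?thesis using card_subset_eq[of "in_nb E x" "out_nb E x"] by simp
qed

lemma exceptional_card:
  assumes "exceptional x y"
  shows "card (insert x (out_nb E x)) = c + 1" "insert x (out_nb E x) \<subseteq> V"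
  using assms noloop nb_V(1)[of x] by (auto simp: exceptional_def low_def)

lemma exceptional_converse:
  assumes "min_counterexample.exceptional c V (E\<inverse>) x y"
  shows "exceptional x y"
proof -
  interpret C: min_counterexample c V "E\<inverse>" by (rule converse)
  have "in_nb E x = out_nb E x" using C.exceptional_in[OF assms] by simp
  then show ?thesis
    using assms unfolding C.exceptional_def exceptional_def low_converse by (simp add: insert_commute)
qed

text \<open>The whole twin class points to \<open>y\<close>, and fewer than \<open>c\<close> further
  in-neighbours would let \<open>out_subset_in\<close> supply the inclusion that
  \<open>simple_arc_contra\<close> refutes.\<close>

lemma simple_out:
  assumes "low x" "(x, y) \<in> E" "(y, x) \<notin> E"
  shows "c + card (cluster E x) \<le> card (in_nb E y)"
proof -
  let ?T = "cluster E x"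
  have xV: "x \<in> V" using assms(1) by (simp add: low_def)
  have y: "y \<in> V" using assms EV by auto
  have yT: "y \<notin> ?T" using assms noloop by (auto simp: cluster_def twin_def)
  have "?T \<subseteq> in_nb E y" using cluster_nb(1)[OF _ yT] assms(2) by auto
  then have "card (in_nb E y - ?T) = card (in_nb E y) - card ?T" "card ?T \<le> card (in_nb E y)"
    using xV by (auto simp: card_Diff_subset intro: card_mono)
  moreover have "\<not> card (in_nb E y - ?T) < c"
    using simple_arc_contra[OF assms(1) y yT assms(2,3)] out_subset_in[OF assms(1) y yT assms(2)] by blast
  ultimately show ?thesis by linarith
qed

lemma simple_in:
  assumes "low x" "(y, x) \<in> E" "(x, y) \<notin> E"
  shows "c + card (cluster E x) \<le> card (out_nb E y)"
  using min_counterexample.simple_out[OF converse, unfolded low_converse, of x y] assms by simp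

lemma digon_in:
  assumes "low x" "(x, y) \<in> E" "(y, x) \<in> E" "y \<notin> cluster E x"
    and "\<not> low y \<or> card (cluster E y) \<le> card (cluster E x)" and "\<not> exceptional x y"
  shows "c + card (cluster E x) \<le> card (in_nb E y)"
proof -
  let ?T = "cluster E x"
  have xV: "x \<in> V" using assms(1) by (simp add: low_def)
  have y: "y \<in> V" using assms EV by auto
  have "?T \<subseteq> in_nb E y" using cluster_nb(1)[OF _ assms(4)] assms(2) by auto
  then have "card (in_nb E y - ?T) = card (in_nb E y) - card ?T" "card ?T \<le> card (in_nb E y)"
    using xV by (auto simp: card_Diff_subset intro: card_mono)
  moreover have "\<not> card (in_nb E y - ?T) < c"
    using twin_replacement[OF assms(1) y assms(4,2,3)] assms(5,6) by blast
  ultimately show ?thesis by linarith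
qed

lemma digon_out:
  assumes "low x" "(x, y) \<in> E" "(y, x) \<in> E" "y \<notin> cluster E x"
    and "\<not> low y \<or> card (cluster E y) \<le> card (cluster E x)" and "\<not> exceptional x y"
  shows "c + card (cluster E x) \<le> card (out_nb E y)"
  using min_counterexample.digon_in[OF converse, unfolded low_converse, of x y] assms exceptional_converse
  by auto

text \<open>Seen from the end with the larger twin class, \<open>digon_in\<close> would push the
  in-degree of the other end above \<open>c\<close>.\<close>

lemma low_digon:
  assumes "low x" "low y" "(x, y) \<in> E" "(y, x) \<in> E" "y \<notin> cluster E x"
  shows "exceptional x y \<or> exceptional y x"
proof (rule ccontr)
  assume neg: "\<not> ?thesis"
  have x: "x \<notin> cluster E y" using assms(5) by (auto simp: cluster_def dest: twin_sym)
  have "1 \<le> card (cluster E x)" "1 \<le> card (cluster E y)"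
    using assms(1,2) cluster_card_pos by (auto simp: low_def)
  then show False
    using digon_in[OF assms(1,3,4,5)] digon_in[OF assms(2,4,3) x] neg assms(1,2)
    by (fastforce simp: low_def)
qed

text \<open>Two exceptions would leave only the digon between them in doubt, hence an almost
  complete digraph on \<open>c + 1\<close> vertices.\<close>

lemma exceptional_unique:
  assumes "exceptional x y" "exceptional x z"
  shows "y = z"
proof (rule ccontr)
  assume "y \<noteq> z"
  show False
  proof (rule no_almost_clique[OF exceptional_card(2)[OF assms(1)] exceptional_card(1)[OF assms(1)]])
    fix u v assume uv: "u \<in> insert x (out_nb E x)" "v \<in> insert x (out_nb E x)" "u \<noteq> v" "{u, v} \<noteq> {y, z}"
    have K: "clique E (insert x (out_nb E x) - {y})" "clique E (insert x (out_nb E x) - {z})"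
      using assms by (simp_all add: exceptional_def)
    have "u \<noteq> y \<and> v \<noteq> y \<or> u \<noteq> z \<and> v \<noteq> z" using uv \<open>y \<noteq> z\<close> by auto
    then show "(u, v) \<in> E"
    proof
      assume "u \<noteq> y \<and> v \<noteq> y"
      then show ?thesis using cliqueD[OF K(1), of u v] uv by blast
    next
      assume "u \<noteq> z \<and> v \<noteq> z"
      then show ?thesis using cliqueD[OF K(2), of u v] uv by blast
    qed
  qed
qed

text \<open>By \<open>low_digon\<close> such an \<open>a\<close> is exceptional itself, with
  exception \<open>x\<close>. The cliques of \<open>x\<close> and \<open>a\<close> then cover every
  pair in the closed neighbourhood of \<open>a\<close> except \<open>{x, v}\<close>, where
  \<open>v\<close> is its only vertex outside the first clique.\<close>

lemma exceptional_low_nb: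
  assumes "exceptional x y" "low a" "(x, a) \<in> E" "a \<notin> cluster E x" "a \<noteq> y"
  shows False
proof -
  have x: "low x" and K: "clique E (insert x (out_nb E x) - {y})"
    using assms(1) by (auto simp: exceptional_def)
  have xy: "x \<noteq> y" using assms(1) by (auto simp: exceptional_def)
  have xa: "x \<noteq> a" using assms(3) noloop by auto
  have ax: "(a, x) \<in> E" using exceptional_in[OF assms(1)] assms(3) by auto
  have "exceptional a x"
    using low_digon[OF x assms(2,3) ax assms(4)] exceptional_unique[OF assms(1)] assms(5) by blast
  note a = exceptional_card[OF this] and Ka = this[unfolded exceptional_def]
  let ?R = "insert x (out_nb E x) - {y}" and ?N = "insert a (out_nb E a)"
  have RN: "?R \<subseteq> ?N"
  proof
    fix r assume r: "r \<in> ?R"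
    moreover have "a \<in> ?R" using assms(3,5) by simp
    ultimately show "r \<in> ?N" using cliqueD[OF K, of a r] by (cases "r = a") auto
  qed
  have "card ?R = c" using exceptional_card[OF assms(1)] assms(1)
    by (simp add: exceptional_def card_Diff_singleton)
  then have "card (?N - ?R) = 1" using RN a by (simp add: card_Diff_subset)
  then obtain v where v: "?N - ?R = {v}" by (rule card_1_singletonE)
  show False
  proof (rule no_almost_clique[OF a(2,1)])
    fix p q assume pq: "p \<in> ?N" "q \<in> ?N" "p \<noteq> q" "{p, q} \<noteq> {x, v}"
    show "(p, q) \<in> E"
    proof (cases "p \<in> ?R \<and> q \<in> ?R")
      case True
      then show ?thesis using cliqueD[OF K] pq(3) by blast
    next
      case False
      then have "p = v \<or> q = v" using v pq by blast
      moreover have "v \<noteq> x" using v xy by auto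
      ultimately have "p \<noteq> x" "q \<noteq> x" using pq(4) by auto
      moreover have "clique E (?N - {x})" using Ka by blast
      ultimately show ?thesis using cliqueD[of E "?N - {x}" p q] pq by blast
    qed
  qed
qed

text \<open>A twin of \<open>y\<close> lies in the clique at \<open>x\<close> and passes its
  adjacencies on to \<open>y\<close>, which completes a clique on \<open>c + 1\<close>
  vertices.\<close>

lemma exceptional_no_twin:
  assumes "exceptional x y"
  shows "cluster E y = {y}"
proof (rule ccontr)
  assume "cluster E y \<noteq> {y}"
  then obtain z where z: "twin E y z" by (auto simp: cluster_def)
  note e = assms[unfolded exceptional_def]
  have zx: "z \<noteq> x"
  proof
    assume "z = x"
    then show False using z e twin_sym[of E y x] by (auto simp: cluster_def)
  qed
  have xy: "x \<noteq> y" using e by auto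
  have zx': "(x, z) \<in> E" using z e zx xy by (auto simp: twin_def)
  have zy: "z \<noteq> y" using z by (auto simp: twin_def)
  let ?N = "insert x (out_nb E x)"
  have zN: "z \<in> ?N - {y}" using zx' zy by simp
  show False
  proof (rule no_clique[OF exceptional_card(2)[OF assms] exceptional_card(1)[OF assms]])
    have adj: "(z, w) \<in> E \<and> (w, z) \<in> E" if "w \<in> ?N - {y}" "w \<noteq> z" for w
      using cliqueD[of E "?N - {y}"] e zN that by metis
    then have "(y, w) \<in> E \<and> (w, y) \<in> E" if "w \<in> ?N - {y}" for w
      using that z by (cases "w = z") (auto simp: twin_def)
    moreover have "clique E (?N - {y})" using e by blast
    ultimately show "clique E ?N"
      unfolding clique_def by blast
  qed
qed

text \<open>A low \<open>y\<close> has fewer than \<open>c\<close> in-neighbours outside the twin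
  class of \<open>x\<close>, so \<open>out_subset_in\<close> applies; equal degrees turn its
  inclusion into an equation.\<close>

lemma low_digon_out_eq_in:
  assumes "low x" "low y" "(x, y) \<in> E" "(y, x) \<in> E" "y \<notin> cluster E x"
  shows "in_nb E x = out_nb E x"
proof -
  let ?T = "cluster E x"
  have xV: "x \<in> V" "y \<in> V" using assms by (auto simp: low_def)
  have "?T \<subseteq> in_nb E y" using cluster_nb(1)[OF _ assms(5)] assms(3) by auto
  then have "card (in_nb E y - ?T) = c - card ?T"
    using xV assms(2) by (simp add: card_Diff_subset low_def)
  then have "card (in_nb E y - ?T) < c" using cluster_card_pos[OF xV(1)] c4 by linarith
  then have "out_nb E x - ?T - {y} \<subseteq> in_nb E x"
    by (rule out_subset_in[OF assms(1) xV(2) assms(5,3)])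
  then have "out_nb E x \<subseteq> in_nb E x"
    using assms(4) noloop by (auto simp: cluster_def twin_def)
  moreover have "card (out_nb E x) = card (in_nb E x)" using assms(1) by (simp add: low_def)
  ultimately show ?thesis using card_subset_eq[of "in_nb E x" "out_nb E x"] by simp
qed

text \<open>A class of \<open>c\<close> twins has a single out-neighbour outside. A digon to it
  completes a clique, and for a simple arc the inclusion required by
  \<open>simple_arc_contra\<close> is vacuous.\<close>

lemma cluster_card_le:
  assumes "low x"
  shows "card (cluster E x) + 1 \<le> c"
proof (rule ccontr)
  assume "\<not> ?thesis"
  then have ge: "c \<le> card (cluster E x)" by simp
  let ?T = "cluster E x"
  have xV: "x \<in> V" using assms by (simp add: low_def)
  have eqs: "c + 1 = card ?T + card (out_nb E x - ?T)" "c + 1 = card ?T + card (in_nb E x - ?T)"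
    using cluster_out[OF xV] cluster_in[OF xV] assms by (simp_all add: low_def)
  have "card ?T \<noteq> c + 1" using no_clique[OF cluster_V[OF xV]] clique_cluster[of E x] by blast
  then have cT: "card ?T = c" using eqs ge by linarith
  then have "card (out_nb E x - ?T) = 1" "card (in_nb E x - ?T) = 1" using eqs by linarith+
  then obtain y z where yz: "out_nb E x - ?T = {y}" "in_nb E x - ?T = {z}"
    by (metis card_1_singletonE)
  then have y: "(x, y) \<in> E" "y \<notin> ?T" by auto
  then have yV: "y \<in> V" using EV by auto
  show False
  proof (cases "(y, x) \<in> E")
    case True
    have ad: "(u, y) \<in> E" "(y, u) \<in> E" if "u \<in> ?T" for u
      using cluster_nb[OF that y(2)] y True by auto
    have "clique E (insert y ?T)"
      using clique_cluster[of E x] ad by (auto simp: clique_def)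
    moreover have "insert y ?T \<subseteq> V" using cluster_V[OF xV] yV by auto
    moreover have "card (insert y ?T) = c + 1" using y cT xV by simp
    ultimately show False using no_clique by blast
  next
    case False
    have "out_nb E x - ?T - {y} \<subseteq> in_nb E x" using yz by blast
    then show False using simple_arc_contra[OF assms yV y(2,1) False] by blast
  qed
qed

end

section \<open>Kernels and list colourings\<close>

text \<open>Hall's theorem by the usual induction: a proper tight subfamily is split off if there is
  one; otherwise any choice for one index preserves the condition.\<close>

lemma hall:
  fixes F :: "'i \<Rightarrow> 'e set"
  assumes "finite J" "\<And>j. j \<in> J \<Longrightarrow> finite (F j)"
    and "\<And>J'. J' \<subseteq> J \<Longrightarrow> card J' \<le> card (\<Union> (F ` J'))"
  shows "\<exists>r. inj_on r J \<and> (\<forall>j\<in>J. r j \<in> F j)"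
  using assms
proof (induction "card J" arbitrary: J F rule: less_induct)
  case less
  have finU: "finite (\<Union> (F ` J'))" if "J' \<subseteq> J" for J'
    using less.prems(1,2) that finite_subset by blast
  show ?case
  proof (cases "\<exists>J0. J0 \<subset> J \<and> J0 \<noteq> {} \<and> card (\<Union> (F ` J0)) \<le> card J0")
    case True
    then obtain J0 where J0: "J0 \<subset> J" "J0 \<noteq> {}" "card (\<Union> (F ` J0)) \<le> card J0" by blast
    have fin0: "finite J0" using J0(1) less.prems(1) finite_subset by blast
    have "\<exists>r. inj_on r J0 \<and> (\<forall>j\<in>J0. r j \<in> F j)"
    proof (rule less.hyps)
      show "card J0 < card J" using J0(1) less.prems(1) by (simp add: psubset_card_mono)
      show "finite (F j)" if "j \<in> J0" for j using less.prems(2) that J0(1) by blast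
      show "card J' \<le> card (\<Union> (F ` J'))" if "J' \<subseteq> J0" for J' using less.prems(3) that J0(1) by blast
    qed (rule fin0)
    then obtain r0 where r0: "inj_on r0 J0" "\<And>j. j \<in> J0 \<Longrightarrow> r0 j \<in> F j" by blast
    let ?U0 = "\<Union> (F ` J0)"
    have "\<exists>r. inj_on r (J - J0) \<and> (\<forall>j\<in>J - J0. r j \<in> F j - ?U0)"
    proof (rule less.hyps)
      have "card (J - J0) = card J - card J0" using J0(1) fin0 by (simp add: card_Diff_subset)
      moreover have "card J0 > 0" "card J0 \<le> card J"
        using J0 fin0 less.prems(1) by (auto simp: card_gt_0_iff intro: card_mono)
      ultimately show "card (J - J0) < card J" by linarith
      show "finite (J - J0)" using less.prems(1) by simp
      show "finite (F j - ?U0)" if "j \<in> J - J0" for j using less.prems(2) that by blast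
      fix J' assume J': "J' \<subseteq> J - J0"
      have finJ': "finite J'" using J' less.prems(1) by (meson finite_Diff finite_subset)
      have sub: "J' \<union> J0 \<subseteq> J" using J' J0(1) by blast
      have "card J' + card J0 = card (J' \<union> J0)"
        using J' fin0 finJ' by (subst card_Un_disjoint) auto
      also have "\<dots> \<le> card (\<Union> (F ` (J' \<union> J0)))" by (rule less.prems(3)[OF sub])
      also have "\<Union> (F ` (J' \<union> J0)) = (\<Union>j\<in>J'. F j - ?U0) \<union> ?U0" by auto
      also have "card \<dots> \<le> card (\<Union>j\<in>J'. F j - ?U0) + card ?U0" by (rule card_Un_le)
      finally show "card J' \<le> card (\<Union>j\<in>J'. F j - ?U0)" using J0(3) by linarith
    qed
    then obtain r1 where r1: "inj_on r1 (J - J0)" "\<And>j. j \<in> J - J0 \<Longrightarrow> r1 j \<in> F j - ?U0" by blast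
    let ?r = "\<lambda>j. if j \<in> J0 then r0 j else r1 j"
    have "inj_on ?r J"
    proof (rule inj_onI)
      fix i j assume ij: "i \<in> J" "j \<in> J" "?r i = ?r j"
      consider "i \<in> J0" "j \<in> J0" | "i \<in> J0" "j \<notin> J0" | "i \<notin> J0" "j \<in> J0" | "i \<notin> J0" "j \<notin> J0" by blast
      then show "i = j"
      proof cases
        case 1
        then show ?thesis using r0(1) ij by (simp add: inj_on_def)
      next
        case 2
        then show ?thesis using r0(2)[of i] r1(2)[of j] ij by auto
      next
        case 3
        then show ?thesis using r0(2)[of j] r1(2)[of i] ij by auto
      next
        case 4
        then show ?thesis using r1(1) ij by (simp add: inj_on_def)
      qed
    qed
    moreover have "\<forall>j\<in>J. ?r j \<in> F j" using r0(2) r1(2) by auto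
    ultimately show ?thesis by blast
  next
    case False
    show ?thesis
    proof (cases "J = {}")
      case ne: False
      then obtain j where j: "j \<in> J" by blast
      have "card {j} \<le> card (\<Union> (F ` {j}))" using less.prems(3)[of "{j}"] j by blast
      then have "F j \<noteq> {}" by auto
      then obtain e where e: "e \<in> F j" by blast
      have "\<exists>r. inj_on r (J - {j}) \<and> (\<forall>i\<in>J - {j}. r i \<in> F i - {e})"
      proof (rule less.hyps)
        show "card (J - {j}) < card J" using j less.prems(1) by (rule card_Diff1_less[rotated])
        show "finite (J - {j})" using less.prems(1) by simp
        show "finite (F i - {e})" if "i \<in> J - {j}" for i using less.prems(2) that by blast
        fix J' assume J': "J' \<subseteq> J - {j}"
        show "card J' \<le> card (\<Union>i\<in>J'. F i - {e})"
        proof (cases "J' = {}")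
          case J'ne: False
          have "J' \<subset> J" using J' j by blast
          then have "card J' < card (\<Union> (F ` J'))" using False J'ne by (meson not_le)
          moreover have "(\<Union>i\<in>J'. F i - {e}) = \<Union> (F ` J') - {e}" by blast
          moreover have "card (\<Union> (F ` J')) - card {e} \<le> card (\<Union> (F ` J') - {e})"
            by (rule diff_card_le_card_Diff) simp
          ultimately show ?thesis by simp
        qed simp
      qed
      then obtain r where r: "inj_on r (J - {j})" "\<And>i. i \<in> J - {j} \<Longrightarrow> r i \<in> F i - {e}" by blast
      have "inj_on (r(j := e)) J"
      proof (rule inj_onI)
        fix i i' assume ii: "i \<in> J" "i' \<in> J" "(r(j := e)) i = (r(j := e)) i'"
        consider "i = j" "i' = j" | "i = j" "i' \<noteq> j" | "i \<noteq> j" "i' = j" | "i \<noteq> j" "i' \<noteq> j" by blast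
        then show "i = i'"
        proof cases
          case 2
          then show ?thesis using r(2)[of i'] ii by auto
        next
          case 3
          then show ?thesis using r(2)[of i] ii by auto
        next
          case 4
          then show ?thesis using r(1) ii by (simp add: inj_on_def)
        qed simp
      qed
      moreover have "\<forall>i\<in>J. (r(j := e)) i \<in> F i" using r(2) e by auto
      ultimately show ?thesis by blast
    qed simp
  qed
qed

text \<open>Hall's theorem with arcs as representatives: each \<open>a\<close> asks for one of its
  arcs, each \<open>b\<close> for two. Subsets \<open>A'\<close> and \<open>B'\<close> see at least
  \<open>2 * card A'\<close> and at least \<open>4 * card B'\<close> arcs, hence at least
  \<open>card A' + 2 * card B'\<close>. Arcs given to \<open>A\<close> form \<open>O'\<close>; those
  given to \<open>B\<close> stay outside it.\<close>

lemma orientation: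
  fixes A B :: "'a set"
  assumes "finite A" "finite B" "A \<inter> B = {}" "H \<subseteq> A \<times> B"
    and degA: "\<And>a. a \<in> A \<Longrightarrow> 2 \<le> card (out_nb H a)"
    and degB: "\<And>b. b \<in> B \<Longrightarrow> 4 \<le> card (in_nb H b)"
  shows "\<exists>O'. O' \<subseteq> H \<and> (\<forall>a\<in>A. out_nb O' a \<noteq> {}) \<and> (\<forall>b\<in>B. 2 \<le> card (in_nb (H - O') b))"
proof -
  have finH: "finite H" using assms(1,2,4) finite_subset by blast
  define J where "J = A \<times> {0::nat} \<union> B \<times> {1, 2}"
  define F where "F j = {e \<in> H. fst e = fst j \<or> snd e = fst j}" for j :: "'a \<times> nat"
  have "\<exists>r. inj_on r J \<and> (\<forall>j\<in>J. r j \<in> F j)"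
  proof (rule hall)
    show "finite J" using assms(1,2) by (simp add: J_def)
    show "finite (F j)" for j using finH by (simp add: F_def)
    fix J' assume J': "J' \<subseteq> J"
    define A' where "A' = A \<inter> fst ` J'"
    define B' where "B' = B \<inter> fst ` J'"
    have finAB: "finite A'" "finite B'" using assms(1,2) by (auto simp: A'_def B'_def)
    have "J' \<subseteq> A' \<times> {0} \<union> B' \<times> {1, 2}" using J' by (force simp: J_def A'_def B'_def)
    then have "card J' \<le> card (A' \<times> {0::nat} \<union> B' \<times> {1, 2})"
      by (rule card_mono[rotated]) (use finAB in auto)
    also have "\<dots> \<le> card (A' \<times> {0::nat}) + card (B' \<times> {1::nat, 2})" by (rule card_Un_le)
    finally have 1: "card J' \<le> card A' + 2 * card B'" by (simp add: card_cartesian_product)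
    have finU: "finite (\<Union> (F ` J'))" by (rule finite_subset[OF _ finH]) (auto simp: F_def)
    have "card A' * 2 \<le> (\<Sum>a\<in>A'. card (out_nb H a))"
      using sum_bounded_below[of A' 2 "\<lambda>a. card (out_nb H a)"] degA by (simp add: A'_def)
    also have "\<dots> = card (SIGMA a:A'. out_nb H a)"
      by (rule card_SigmaI[symmetric]) (use finAB finH finite_out_nb in auto)
    also have "\<dots> \<le> card (\<Union> (F ` J'))"
      by (rule card_mono[OF finU]) (auto simp: A'_def F_def)
    finally have 2: "2 * card A' \<le> card (\<Union> (F ` J'))" by simp
    have "card B' * 4 \<le> (\<Sum>b\<in>B'. card (in_nb H b))"
      using sum_bounded_below[of B' 4 "\<lambda>b. card (in_nb H b)"] degB by (simp add: B'_def)
    also have "\<dots> = card (SIGMA b:B'. in_nb H b)"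
      by (rule card_SigmaI[symmetric]) (use finAB finH finite_in_nb in auto)
    also have "\<dots> = card ((SIGMA b:B'. in_nb H b)\<inverse>)" by (simp add: card_inverse)
    also have "\<dots> \<le> card (\<Union> (F ` J'))"
      by (rule card_mono[OF finU]) (auto simp: B'_def F_def)
    finally show "card J' \<le> card (\<Union> (F ` J'))" using 1 2 by linarith
  qed
  then obtain r where r: "inj_on r J" "\<And>j. j \<in> J \<Longrightarrow> r j \<in> F j" by blast
  define O' where "O' = r ` (A \<times> {0})"
  have rA: "r (a, 0) \<in> H \<and> fst (r (a, 0)) = a" if "a \<in> A" for a
    using r(2)[of "(a, 0)"] that assms(3,4) by (force simp: J_def F_def)
  have rB: "r (b, i) \<in> H \<and> snd (r (b, i)) = b" if "b \<in> B" "i \<in> {1, 2}" for b i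
    using r(2)[of "(b, i)"] that assms(3,4) by (force simp: J_def F_def)
  have "out_nb O' a \<noteq> {}" if "a \<in> A" for a
  proof -
    have "(a, snd (r (a, 0))) \<in> O'" using rA[OF that] that by (metis O'_def SigmaI imageI prod.collapse singletonI)
    then show ?thesis by auto
  qed
  moreover have "2 \<le> card (in_nb (H - O') b)" if b: "b \<in> B" for b
  proof -
    have mem: "(fst (r (b, i)), b) \<in> H - O'" if i: "i \<in> {1, 2}" for i
    proof -
      have "r (b, i) \<notin> O'"
      proof
        assume "r (b, i) \<in> O'"
        then obtain a where "a \<in> A" "r (b, i) = r (a, 0)" by (auto simp: O'_def)
        then have "(b, i) = (a, 0)"
          using inj_onD[OF r(1), of "(b, i)" "(a, 0)"] b i by (auto simp: J_def)
        then show False using i by auto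
      qed
      then show ?thesis using rB[OF b i] by (metis DiffI prod.collapse)
    qed
    have "fst (r (b, 1)) \<noteq> fst (r (b, 2))"
    proof
      assume "fst (r (b, 1)) = fst (r (b, 2))"
      then have "r (b, 1) = r (b, 2)" using rB[OF b, of 1] rB[OF b, of 2] by (simp add: prod_eq_iff)
      then have "(b, 1::nat) = (b, 2)"
        by (rule inj_onD[OF r(1)]) (use b in \<open>auto simp: J_def\<close>)
      then show False by simp
    qed
    then have "card {fst (r (b, 1)), fst (r (b, 2))} = 2" by simp
    moreover have "{fst (r (b, 1)), fst (r (b, 2))} \<subseteq> in_nb (H - O') b" using mem by auto
    moreover have "finite (in_nb (H - O') b)" using finH by (simp add: finite_in_nb)
    ultimately show ?thesis by (metis card_mono)
  qed
  moreover have "O' \<subseteq> H" using rA by (auto simp: O'_def)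
  ultimately show ?thesis by blast
qed

text \<open>If every vertex of \<open>U\<close> outside \<open>A\<close> has an arc into
  \<open>A\<close>, then the part of \<open>U\<close> in \<open>A\<close> is a kernel. Otherwise
  some \<open>b\<close> has none; it is added to a kernel of what remains without \<open>b\<close>
  and its in-neighbours. Its out-neighbours lie in \<open>B\<close>, so by symmetry they were
  removed too.\<close>

lemma kernel:
  assumes "finite U" "U \<subseteq> A \<union> B"
    and indep: "\<And>u v. (u, v) \<in> K \<Longrightarrow> u \<in> A \<Longrightarrow> v \<notin> A"
    and symB: "\<And>u v. (u, v) \<in> K \<Longrightarrow> u \<in> B \<Longrightarrow> v \<in> B \<Longrightarrow> (v, u) \<in> K"
    and irr: "\<And>u. (u, u) \<notin> K"
  shows "\<exists>N \<subseteq> U. (\<forall>u\<in>N. \<forall>v\<in>N. (u, v) \<notin> K) \<and> (\<forall>u\<in>U - N. \<exists>v\<in>N. (u, v) \<in> K)"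
  using assms(1,2)
proof (induction "card U" arbitrary: U rule: less_induct)
  case less
  show ?case
  proof (cases "\<forall>b \<in> U - A. \<exists>a \<in> U \<inter> A. (b, a) \<in> K")
    case True
    then show ?thesis using indep by (intro exI[of _ "U \<inter> A"]) blast
  next
    case False
    then obtain b where b: "b \<in> U" "b \<notin> A" "\<And>a. a \<in> U \<Longrightarrow> a \<in> A \<Longrightarrow> (b, a) \<notin> K" by blast
    let ?U = "U - {b} - {u. (u, b) \<in> K}"
    have "?U \<subset> U" using b(1) by blast
    then have "card ?U < card U" using less.prems(1) by (rule psubset_card_mono[rotated])
    then have "\<exists>N \<subseteq> ?U. (\<forall>u\<in>N. \<forall>v\<in>N. (u, v) \<notin> K) \<and> (\<forall>u\<in>?U - N. \<exists>v\<in>N. (u, v) \<in> K)"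
      by (rule less.hyps) (use less.prems in auto)
    then obtain N where N: "N \<subseteq> ?U" "\<forall>u\<in>N. \<forall>v\<in>N. (u, v) \<notin> K"
        "\<forall>u\<in>?U - N. \<exists>v\<in>N. (u, v) \<in> K"
      by (elim exE conjE)
    have "(b, v) \<notin> K" if "v \<in> N" for v
    proof
      assume "(b, v) \<in> K"
      moreover have "v \<in> U" "(v, b) \<notin> K" using that N(1) by auto
      ultimately show False using b less.prems(2) symB[of b v] by blast
    qed
    then have "\<forall>u\<in>insert b N. \<forall>v\<in>insert b N. (u, v) \<notin> K" using N(1,2) irr by blast
    moreover have "\<forall>u\<in>U - insert b N. \<exists>v\<in>insert b N. (u, v) \<in> K" using N(3) by blast
    moreover have "insert b N \<subseteq> U" using N(1) b(1) by blast
    ultimately show ?thesis by blast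
  qed
qed

text \<open>Galvin's argument: colouring a kernel of the vertices whose list contains a given colour
  decreases the out-degree of all the others by at least one.\<close>

lemma kernel_list_colouring:
  fixes L :: "'a \<Rightarrow> nat set"
  assumes "finite U" "U \<subseteq> A \<union> B"
    and indep: "\<And>u v. (u, v) \<in> K \<Longrightarrow> u \<in> A \<Longrightarrow> v \<notin> A"
    and symB: "\<And>u v. (u, v) \<in> K \<Longrightarrow> u \<in> B \<Longrightarrow> v \<in> B \<Longrightarrow> (v, u) \<in> K"
    and irr: "\<And>u. (u, u) \<notin> K"
    and "\<And>u. u \<in> U \<Longrightarrow> finite (L u) \<and> card (out_nb K u \<inter> U) < card (L u)"
  shows "\<exists>h. (\<forall>u\<in>U. h u \<in> L u) \<and> (\<forall>u\<in>U. \<forall>v\<in>U. (u, v) \<in> K \<longrightarrow> h u \<noteq> h v)"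
  using assms(1,2,6)
proof (induction "card U" arbitrary: U L rule: less_induct)
  case less
  show ?case
  proof (cases "U = {}")
    case False
    then obtain u0 where u0: "u0 \<in> U" by blast
    then have "L u0 \<noteq> {}" using less.prems(3)[of u0] by auto
    then obtain q where q: "q \<in> L u0" by blast
    let ?Q = "{u \<in> U. q \<in> L u}"
    have "\<exists>N \<subseteq> ?Q. (\<forall>u\<in>N. \<forall>v\<in>N. (u, v) \<notin> K) \<and> (\<forall>u\<in>?Q - N. \<exists>v\<in>N. (u, v) \<in> K)"
      by (rule kernel[OF _ _ indep symB irr]) (use less.prems in auto)
    then obtain N where N: "N \<subseteq> ?Q" "\<forall>u\<in>N. \<forall>v\<in>N. (u, v) \<notin> K"
        "\<forall>u\<in>?Q - N. \<exists>v\<in>N. (u, v) \<in> K"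
      by (elim exE conjE)
    have Nne: "N \<noteq> {}" using N(3) u0 q by blast
    have "\<exists>h. (\<forall>u\<in>U - N. h u \<in> L u - {q}) \<and> (\<forall>u\<in>U - N. \<forall>v\<in>U - N. (u, v) \<in> K \<longrightarrow> h u \<noteq> h v)"
    proof (rule less.hyps)
      have "U - N \<subset> U" using Nne N(1) by blast
      then show "card (U - N) < card U" using less.prems(1) by (rule psubset_card_mono[rotated])
      show "finite (U - N)" "U - N \<subseteq> A \<union> B" using less.prems by auto
      fix u assume u: "u \<in> U - N"
      have finO: "finite (out_nb K u \<inter> U)" using less.prems(1) by simp
      have sub: "out_nb K u \<inter> (U - N) \<subseteq> out_nb K u \<inter> U" by blast
      have lt: "finite (L u)" "card (out_nb K u \<inter> U) < card (L u)" using less.prems(3)[of u] u by auto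
      show "finite (L u - {q}) \<and> card (out_nb K u \<inter> (U - N)) < card (L u - {q})"
      proof (cases "q \<in> L u")
        case True
        then obtain v where v: "v \<in> N" "(u, v) \<in> K" using N(3) u by blast
        then have "v \<in> U" using N(1) by blast
        then have "v \<in> out_nb K u \<inter> U" "v \<notin> out_nb K u \<inter> (U - N)" using v by simp_all
        then have "out_nb K u \<inter> (U - N) \<subset> out_nb K u \<inter> U" using sub by blast
        then have "card (out_nb K u \<inter> (U - N)) < card (out_nb K u \<inter> U)"
          by (rule psubset_card_mono[OF finO])
        moreover have "card (L u - {q}) + 1 = card (L u)"
          using True lt(1) card_Suc_Diff1[of "L u" q] by simp
        ultimately show ?thesis using lt by simp
      next
        case False
        then have "L u - {q} = L u" by blast
        moreover have "card (out_nb K u \<inter> (U - N)) \<le> card (out_nb K u \<inter> U)"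
          by (rule card_mono[OF finO sub])
        ultimately show ?thesis using lt by simp
      qed
    qed
    then obtain h where h: "\<And>u. u \<in> U - N \<Longrightarrow> h u \<in> L u - {q}"
        "\<And>u v. u \<in> U - N \<Longrightarrow> v \<in> U - N \<Longrightarrow> (u, v) \<in> K \<Longrightarrow> h u \<noteq> h v"
      by blast
    let ?h = "\<lambda>u. if u \<in> N then q else h u"
    have "?h u \<in> L u" if "u \<in> U" for u using that N(1) h(1)[of u] by auto
    moreover have "?h u \<noteq> ?h v" if "u \<in> U" "v \<in> U" "(u, v) \<in> K" for u v
    proof -
      have "\<not> (u \<in> N \<and> v \<in> N)" using that N(2) by blast
      then show ?thesis using that h(1)[of u] h(1)[of v] h(2)[of u v] by auto
    qed
    ultimately show ?thesis by (intro exI[of _ ?h]) blast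
  qed simp
qed

text \<open>In a smallest feedback arc set the arcs at \<open>b\<close> can be exchanged for all
  arcs into \<open>b\<close>, because no cycle passes through a vertex without in-arcs. Minimality
  then gives the bound at every vertex.\<close>

lemma feedback_arc_set:
  assumes "finite E"
  shows "\<exists>S \<subseteq> E. acyclic (E - S) \<and> (\<forall>b. card {e \<in> S. fst e = b \<or> snd e = b} \<le> card (in_nb E b))"
proof -
  let ?fam = "{S. S \<subseteq> E \<and> acyclic (E - S)}"
  have "finite ?fam" by (rule finite_subset[of _ "Pow E"]) (use assms in auto)
  moreover have "?fam \<noteq> {}"
  proof -
    have "E \<in> ?fam" by simp
    then show ?thesis by blast
  qed
  ultimately have "\<exists>S. is_arg_min card (\<lambda>S. S \<in> ?fam) S"
    by (rule ex_is_arg_min_if_finite)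
  then obtain S where "is_arg_min card (\<lambda>S. S \<in> ?fam) S" by blast
  then have S: "S \<subseteq> E" "acyclic (E - S)"
    and min: "\<And>S'. S' \<subseteq> E \<Longrightarrow> acyclic (E - S') \<Longrightarrow> card S \<le> card S'"
    by (simp_all add: is_arg_min_linorder)
  have finS: "finite S" using S(1) assms finite_subset by blast
  have "card {e \<in> S. fst e = b \<or> snd e = b} \<le> card (in_nb E b)" for b
  proof -
    let ?At = "{e \<in> S. fst e = b \<or> snd e = b}"
    let ?In = "in_nb E b \<times> {b}"
    let ?S = "(S - ?At) \<union> ?In"
    have "acyclic (E - ?S)"
    proof (rule acyclic_split[where X = "{b}"])
      have "(E - ?S) \<inter> {b} \<times> {b} = {}" by auto
      then show "acyclic ((E - ?S) \<inter> {b} \<times> {b})" by (simp only:) simp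
      show "acyclic ((E - ?S) \<inter> (- {b}) \<times> (- {b}))"
        by (rule acyclic_subset[OF S(2)]) auto
    qed auto
    then have "card S \<le> card ?S" using S(1) by (intro min) auto
    also have "\<dots> \<le> card (S - ?At) + card ?In" by (rule card_Un_le)
    also have "card (S - ?At) = card S - card ?At"
      by (rule card_Diff_subset) (use finS in auto)
    finally have "card S \<le> card S - card ?At + card (in_nb E b)" by (simp add: card_cartesian_product)
    moreover have "card ?At \<le> card S" by (rule card_mono[OF finS]) auto
    ultimately show ?thesis by linarith
  qed
  then show ?thesis using S by blast
qed

section \<open>Few arcs from vertices of out-degree c to vertices of in-degree c + 1\<close>

context min_counterexample
begin

text \<open>The rest of the digraph is dicoloured first. Then vertices of \<open>A\<close> avoid the
  colours of their out-neighbours and vertices of \<open>B\<close> those of their in-neighbours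
  outside \<open>B\<close>, while inside \<open>B\<close> only a feedback arc set has to be coloured
  properly. The degree hypotheses make the lists long enough for Galvin's method.\<close>

lemma no_dense_pair:
  assumes AB: "A \<subseteq> V" "B \<subseteq> V" "A \<inter> B = {}" "A \<union> B \<noteq> {}"
    and indep: "\<And>u v. u \<in> A \<Longrightarrow> v \<in> A \<Longrightarrow> (u, v) \<notin> E"
    and outA: "\<And>a. a \<in> A \<Longrightarrow> card (out_nb E a) = c"
    and inB: "\<And>b. b \<in> B \<Longrightarrow> card (in_nb E b) = c + 1"
    and degA: "\<And>a. a \<in> A \<Longrightarrow> 2 \<le> card (out_nb E a \<inter> B)"
    and degB: "\<And>b. b \<in> B \<Longrightarrow> 4 \<le> card (in_nb E b \<inter> A)"
  shows False
proof -
  have finAB: "finite A" "finite B" using AB fin finite_subset by blast+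
  let ?U = "V - A - B"
  have "?U \<subset> V" using AB by blast
  then obtain f where f: "dicol c ?U E f"
    using dicritical_rel_induced[OF crit] by (auto simp: dicolourable_def)
  define H where "H = E \<inter> A \<times> B"
  have outH: "out_nb H a = out_nb E a \<inter> B" if "a \<in> A" for a using that by (auto simp: H_def)
  have inH: "in_nb H b = in_nb E b \<inter> A" if "b \<in> B" for b using that by (auto simp: H_def)
  have "\<exists>O'. O' \<subseteq> H \<and> (\<forall>a\<in>A. out_nb O' a \<noteq> {}) \<and> (\<forall>b\<in>B. 2 \<le> card (in_nb (H - O') b))"
    by (rule orientation[OF finAB AB(3)]) (use degA degB outH inH in \<open>auto simp: H_def\<close>)
  then obtain O' where O': "O' \<subseteq> H" "\<And>a. a \<in> A \<Longrightarrow> out_nb O' a \<noteq> {}"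
      "\<And>b. b \<in> B \<Longrightarrow> 2 \<le> card (in_nb (H - O') b)"
    by blast
  have "finite (E \<inter> B \<times> B)" using finE by simp
  from feedback_arc_set[OF this]
  obtain S where S: "S \<subseteq> E \<inter> B \<times> B" "acyclic (E \<inter> B \<times> B - S)"
      "\<forall>b. card {e \<in> S. fst e = b \<or> snd e = b} \<le> card (in_nb (E \<inter> B \<times> B) b)"
    by (elim exE conjE)
  have finS: "finite S" using S(1) finE finite_subset by blast
  \<comment> \<open>All pairs whose colours must differ, directed as \<open>kernel\<close> requires.
    Reversing the arcs of \<open>O'\<close> makes the out-degree of each \<open>a\<close> smaller
    than its list, while at each \<open>b\<close> at least two arcs from \<open>A\<close> are not
    reversed.\<close>
  define K where "K = (H - O') \<union> O'\<inverse> \<union> (S \<union> S\<inverse>)"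
  have O'H: "(u, v) \<in> O' \<Longrightarrow> u \<in> A \<and> v \<in> B \<and> (u, v) \<in> E" for u v
    using O'(1) by (auto simp: H_def)
  have SB: "(u, v) \<in> S \<Longrightarrow> u \<in> B \<and> v \<in> B \<and> (u, v) \<in> E" for u v
    using S(1) by auto
  have notAB: "v \<in> A \<Longrightarrow> v \<in> B \<Longrightarrow> False" for v using AB(3) by blast
  have KA: "w \<in> B \<and> (a, w) \<in> E \<and> (a, w) \<notin> O'" if "(a, w) \<in> K" "a \<in> A" for a w
  proof -
    have "(w, a) \<notin> O'" "(a, w) \<notin> S" "(w, a) \<notin> S" using that O'H SB notAB by blast+
    then have "(a, w) \<in> H - O'" using that(1) by (simp add: K_def)
    then show ?thesis by (simp add: H_def)
  qed
  have KB: "(w, b) \<in> O' \<or> (b, w) \<in> S \<or> (w, b) \<in> S" if "(b, w) \<in> K" "b \<in> B" for b w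
  proof -
    have "(b, w) \<notin> H" using that(2) notAB by (auto simp: H_def)
    then show ?thesis using that(1) by (simp add: K_def)
  qed
  define L where "L v = (if v \<in> A then {..<c} - f ` (out_nb E v - B) else {..<c} - f ` (in_nb E v - A - B))" for v
  have listA: "card (out_nb K a \<inter> (A \<union> B)) < card (L a)" if a: "a \<in> A" for a
  proof -
    have sub: "out_nb K a \<subseteq> out_nb E a \<inter> B - out_nb O' a"
      using KA a by auto
    obtain w where "(a, w) \<in> O'" using O'(2)[OF a] by auto
    then have "w \<in> out_nb E a \<inter> B" "w \<notin> out_nb K a" using O'H sub by auto
    then have "out_nb K a \<inter> (A \<union> B) \<subset> out_nb E a \<inter> B" using sub by blast
    then have 1: "card (out_nb K a \<inter> (A \<union> B)) < card (out_nb E a \<inter> B)"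
      by (rule psubset_card_mono[rotated]) simp
    have "card (out_nb E a - B) + card (out_nb E a \<inter> B) = c"
      using outA[OF a] card_Diff_subset_Int[of "out_nb E a" B] card_mono[of "out_nb E a" "out_nb E a \<inter> B"]
      by simp
    then have "card (out_nb E a \<inter> B) \<le> card (L a)"
      using card_missing_colours[of "out_nb E a - B" c f] a by (simp add: L_def)
    then show ?thesis using 1 by linarith
  qed
  \<comment> \<open>In-degree \<open>c + 1\<close> may leave the list one colour short of the number
    of in-neighbours in \<open>A\<close> and \<open>B\<close>. The two unreversed arcs make up for
    this and for the strict inequality; \<open>S\<close> costs no more than the in-degree inside
    \<open>B\<close>.\<close>
  have listB: "card (out_nb K b \<inter> (A \<union> B)) < card (L b)" if b: "b \<in> B" for b
  proof -
    have bA: "b \<notin> A" using b AB(3) by blast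
    let ?At = "{e \<in> S. fst e = b \<or> snd e = b}"
    let ?g = "\<lambda>e. if fst e = b then snd e else fst e"
    have "out_nb K b \<subseteq> (in_nb H b - in_nb (H - O') b) \<union> ?g ` ?At"
    proof
      fix w assume "w \<in> out_nb K b"
      then consider "(w, b) \<in> O'" | "(b, w) \<in> S" | "(w, b) \<in> S" using KB[of b w] b by auto
      then show "w \<in> (in_nb H b - in_nb (H - O') b) \<union> ?g ` ?At"
      proof cases
        case 1
        then show ?thesis using O'(1) by auto
      next
        case 2
        then have "w \<in> ?g ` ?At" by (intro image_eqI[of _ _ "(b, w)"]) simp_all
        then show ?thesis by (rule UnI2)
      next
        case 3
        then have "w \<in> ?g ` ?At" by (intro image_eqI[of _ _ "(w, b)"]) simp_all
        then show ?thesis by (rule UnI2)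
      qed
    qed
    moreover have finin: "finite (in_nb H b)" using inH[OF b] by simp
    ultimately have "card (out_nb K b) \<le> card ((in_nb H b - in_nb (H - O') b) \<union> ?g ` ?At)"
      by (intro card_mono) (use finS in auto)
    also have "\<dots> \<le> card (in_nb H b - in_nb (H - O') b) + card (?g ` ?At)" by (rule card_Un_le)
    also have "card (?g ` ?At) \<le> card ?At" by (rule card_image_le) (use finS in auto)
    also have "card ?At \<le> card (in_nb (E \<inter> B \<times> B) b)" using S(3) by blast
    also have "in_nb (E \<inter> B \<times> B) b = in_nb E b \<inter> B" using b by auto
    finally have "card (out_nb K b) \<le> card (in_nb H b - in_nb (H - O') b) + card (in_nb E b \<inter> B)"
      by simp
    moreover have "card (in_nb H b - in_nb (H - O') b) = card (in_nb H b) - card (in_nb (H - O') b)"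
      by (rule card_Diff_subset) (use finin in \<open>auto intro: finite_subset[of _ "in_nb H b"]\<close>)
    moreover have "card (in_nb H b) = card (in_nb E b \<inter> A)" using inH[OF b] by simp
    ultimately have 1: "card (out_nb K b) \<le> card (in_nb E b \<inter> A) - 2 + card (in_nb E b \<inter> B)"
      using O'(3)[OF b] by linarith
    have "card (in_nb E b) = card (in_nb E b - A - B) + card (in_nb E b \<inter> A) + card (in_nb E b \<inter> B)"
    proof -
      have "in_nb E b = (in_nb E b - A - B) \<union> (in_nb E b \<inter> A) \<union> (in_nb E b \<inter> B)" by blast
      then have "card (in_nb E b) = card ((in_nb E b - A - B) \<union> (in_nb E b \<inter> A) \<union> (in_nb E b \<inter> B))" by simp
      also have "\<dots> = card ((in_nb E b - A - B) \<union> (in_nb E b \<inter> A)) + card (in_nb E b \<inter> B)"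
        by (rule card_Un_disjoint) (use AB(3) in auto)
      also have "card ((in_nb E b - A - B) \<union> (in_nb E b \<inter> A)) = card (in_nb E b - A - B) + card (in_nb E b \<inter> A)"
        by (rule card_Un_disjoint) auto
      finally show ?thesis .
    qed
    then have "card (in_nb E b \<inter> A) + card (in_nb E b \<inter> B) \<le> card (L b) + 1"
      using card_missing_colours[of "in_nb E b - A - B" c f] inB[OF b] bA by (simp add: L_def)
    moreover have "card (out_nb K b \<inter> (A \<union> B)) \<le> card (out_nb K b)"
      by (rule card_mono) (use finS finin O'(1) in \<open>auto intro: finite_subset[OF \<open>out_nb K b \<subseteq> _\<close>]\<close>)
    ultimately show ?thesis using 1 degB[OF b] by linarith
  qed
  have "\<exists>h. (\<forall>u\<in>A \<union> B. h u \<in> L u) \<and> (\<forall>u\<in>A \<union> B. \<forall>v\<in>A \<union> B. (u, v) \<in> K \<longrightarrow> h u \<noteq> h v)"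
  proof (rule kernel_list_colouring[where A = A and B = B])
    show "v \<notin> A" if "(u, v) \<in> K" "u \<in> A" for u v
      using KA[OF that] notAB by blast
    show "(v, u) \<in> K" if "(u, v) \<in> K" "u \<in> B" "v \<in> B" for u v
      using KB[OF that(1,2)] O'H[of v u] notAB[of v] that(3) by (auto simp: K_def)
    show "(u, u) \<notin> K" for u
      using noloop[of u] O'H[of u u] SB[of u u] by (auto simp: K_def H_def)
    show "finite (L u) \<and> card (out_nb K u \<inter> (A \<union> B)) < card (L u)" if "u \<in> A \<union> B" for u
    proof
      show "finite (L u)" by (simp add: L_def)
    qed (use that listA listB in blast)
  qed (use finAB in auto)
  then obtain h where h: "\<And>u. u \<in> A \<union> B \<Longrightarrow> h u \<in> L u"
      "\<And>u v. u \<in> A \<union> B \<Longrightarrow> v \<in> A \<union> B \<Longrightarrow> (u, v) \<in> K \<Longrightarrow> h u \<noteq> h v"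
    by blast
  define g where "g v = (if v \<in> A \<union> B then h v else f v)" for v
  have "dicol c ?U E g" by (rule dicol_cong[OF f]) (auto simp: g_def)
  then have gA: "dicol c (?U \<union> A) E g"
  proof (rule dicol_add_out)
    show "g ` A \<subseteq> {..<c}"
    proof (rule image_subsetI)
      fix a assume "a \<in> A"
      then show "g a \<in> {..<c}" using h(1)[of a] by (simp add: g_def L_def)
    qed
    fix a w assume aw: "a \<in> A" "w \<in> ?U \<union> A" "(a, w) \<in> E"
    then have w: "w \<in> ?U" using indep by blast
    then have "f w \<in> f ` (out_nb E a - B)" using aw by auto
    moreover have "h a \<in> {..<c} - f ` (out_nb E a - B)" using h(1)[of a] aw by (simp add: L_def)
    ultimately show "g a \<noteq> g w" using aw w by (auto simp: g_def)
  qed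
  have "dicol c V E g"
    unfolding dicol_def
  proof
    have gB: "g b < c" if "b \<in> B" for b
    proof -
      have "b \<notin> A" using that AB(3) by blast
      then show ?thesis using h(1)[of b] that by (simp add: g_def L_def)
    qed
    show "g ` V \<subseteq> {..<c}"
    proof (rule image_subsetI)
      fix v assume "v \<in> V"
      then show "g v \<in> {..<c}" using gA gB by (cases "v \<in> B") (auto simp: dicol_def)
    qed
    \<comment> \<open>No monochromatic arc enters \<open>B\<close>, and the monochromatic arcs
      inside \<open>B\<close> avoid \<open>S\<close>.\<close>
    show "acyclic (mono_arcs g (E \<inter> V \<times> V))"
    proof (rule acyclic_split[where X = B])
      show "u \<in> B" if uv: "(u, v) \<in> mono_arcs g (E \<inter> V \<times> V)" "v \<in> B" for u v
      proof (rule ccontr)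
        assume uB: "u \<notin> B"
        have e: "(u, v) \<in> E" "g u = g v" using uv by auto
        have vA: "v \<notin> A" using uv AB(3) by blast
        show False
        proof (cases "u \<in> A")
          case True
          then have "(u, v) \<in> K \<or> (v, u) \<in> K" using e uv by (auto simp: K_def H_def)
          then show False using h(2)[of u v] h(2)[of v u] True uv e by (auto simp: g_def)
        next
          case False
          then have "f u \<in> f ` (in_nb E v - A - B)" using e uB by auto
          moreover have "h v \<in> {..<c} - f ` (in_nb E v - A - B)" using h(1)[of v] uv(2) vA by (simp add: L_def)
          moreover have "f u = h v" using e(2) False uB uv(2) by (simp add: g_def)
          ultimately show False by (metis DiffD2)
        qed
      qed
      show "acyclic (mono_arcs g (E \<inter> V \<times> V) \<inter> B \<times> B)"
      proof (rule acyclic_subset[OF S(2)], rule subrelI)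
        fix u v assume uv: "(u, v) \<in> mono_arcs g (E \<inter> V \<times> V) \<inter> B \<times> B"
        have "(u, v) \<notin> S"
        proof
          assume "(u, v) \<in> S"
          then have "(u, v) \<in> K" by (simp add: K_def)
          then show False using h(2)[of u v] uv by (auto simp: g_def)
        qed
        then show "(u, v) \<in> E \<inter> B \<times> B - S" using uv by auto
      qed
      show "acyclic (mono_arcs g (E \<inter> V \<times> V) \<inter> (- B) \<times> (- B))"
        by (rule acyclic_subset[of "mono_arcs g (E \<inter> (?U \<union> A) \<times> (?U \<union> A))"])
           (use gA in \<open>auto simp: dicol_def\<close>)
    qed
  qed
  then show False using uncol by (auto simp: dicolourable_def)
qed

text \<open>Vertices are peeled off one at a time: by \<open>no_dense_pair\<close> some vertex of
  \<open>A\<close> has at most two of these arcs or some vertex of \<open>B\<close> at most three.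
  The exact degrees are taken in the whole digraph, so they survive the peeling.\<close>

lemma sparse_pair:
  assumes AB: "A \<subseteq> V" "B \<subseteq> V" "A \<inter> B = {}"
    and indep: "\<And>u v. u \<in> A \<Longrightarrow> v \<in> A \<Longrightarrow> (u, v) \<notin> E"
    and outA: "\<And>a. a \<in> A \<Longrightarrow> card (out_nb E a) = c"
    and inB: "\<And>b. b \<in> B \<Longrightarrow> card (in_nb E b) = c + 1"
  shows "card (E \<inter> A \<times> B) \<le> 2 * card A + 3 * card B"
  using assms
proof (induction "card A + card B" arbitrary: A B rule: less_induct)
  case less
  have finAB: "finite A" "finite B" using less.prems fin finite_subset by blast+
  show ?case
  proof (cases "A \<union> B = {}")
    case ne: False
    consider (1) a where "a \<in> A" "card (out_nb E a \<inter> B) \<le> 2" | (2) b where "b \<in> B" "card (in_nb E b \<inter> A) \<le> 3"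
    proof (rule ccontr)
      assume neg: "\<not> thesis"
      have "2 \<le> card (out_nb E a \<inter> B)" if "a \<in> A" for a using 1[OF that] neg by linarith
      moreover have "4 \<le> card (in_nb E b \<inter> A)" if "b \<in> B" for b using 2[OF that] neg by linarith
      ultimately show False using no_dense_pair[OF less.prems(1-3) ne less.prems(4-6)] by blast
    qed
    then show ?thesis
    proof cases
      case 1
      have "card (E \<inter> (A - {a}) \<times> B) \<le> 2 * card (A - {a}) + 3 * card B"
        by (rule less.hyps) (use less.prems 1 finAB card_Diff1_less[of A a] in auto)
      moreover have "card (E \<inter> A \<times> B) \<le> card (E \<inter> (A - {a}) \<times> B \<union> {a} \<times> (out_nb E a \<inter> B))"
        by (rule card_mono) (use finE in auto)
      moreover have "\<dots> \<le> card (E \<inter> (A - {a}) \<times> B) + card ({a} \<times> (out_nb E a \<inter> B))"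
        by (rule card_Un_le)
      moreover have "card A = card (A - {a}) + 1" using card_Suc_Diff1[OF finAB(1) 1(1)] by simp
      ultimately show ?thesis using 1(2) by (simp add: card_cartesian_product)
    next
      case 2
      have "card (E \<inter> A \<times> (B - {b})) \<le> 2 * card A + 3 * card (B - {b})"
        by (rule less.hyps) (use less.prems 2 finAB card_Diff1_less[of B b] in auto)
      moreover have "card (E \<inter> A \<times> B) \<le> card (E \<inter> A \<times> (B - {b}) \<union> (in_nb E b \<inter> A) \<times> {b})"
        by (rule card_mono) (use finE in auto)
      moreover have "\<dots> \<le> card (E \<inter> A \<times> (B - {b})) + card ((in_nb E b \<inter> A) \<times> {b})"
        by (rule card_Un_le)
      moreover have "card B = card (B - {b}) + 1" using card_Suc_Diff1[OF finAB(2) 2(1)] by simp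
      ultimately show ?thesis using 2(2) by (simp add: card_cartesian_product)
    qed
  qed simp
qed

end

section \<open>Discharging\<close>

text \<open>A vertex of degree \<open>d\<close> has \<open>weight c d\<close> to give to each incident arc, measured against twice the
  coefficient of the number of vertices in the theorem.\<close>

definition weight :: "nat \<Rightarrow> nat \<Rightarrow> real" where
  "weight c d = (real d - (2 * real c + 1 - 2 / real c)) / real d"

lemma weight_mono:
  assumes "4 \<le> c" "2 * c + 2 \<le> d" "d \<le> d'"
  shows "weight c d \<le> weight c d'"
proof -
  let ?k = "2 * real c + 1 - 2 / real c"
  have "2 / real c \<le> 1" using assms(1) by (simp add: field_simps)
  then have k: "0 \<le> ?k" by linarith
  have d: "0 < real d" "0 < real d'" "real d \<le> real d'" using assms by linarith+
  have "?k / real d' \<le> ?k / real d" using k d by (intro divide_left_mono) auto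
  moreover have "weight c d = 1 - ?k / real d" "weight c d' = 1 - ?k / real d'"
    using d by (simp_all add: weight_def diff_divide_distrib)
  ultimately show ?thesis by linarith
qed

lemma weight_base:
  assumes "4 \<le> c"
  shows "weight c (2 * c + 2) = (real c + 2) / (2 * real c * (real c + 1))"
  using assms by (simp add: weight_def field_simps)

text \<open>\<open>1 - 2 / c\<close> is what a low vertex lacks; \<open>2 * c\<close> arcs at this
  rate pay for it.\<close>

lemma weight_base_ge:
  assumes "4 \<le> c"
  shows "(1 - 2 / real c) / (2 * real c) \<le> weight c (2 * c + 2)"
proof -
  have "(1 - 2 / real c) * (real c + 1) \<le> real c + 2"
    using assms by (simp add: field_simps)
  then have "(1 - 2 / real c) * (real c + 1) / (2 * real c * (real c + 1)) \<le> (real c + 2) / (2 * real c * (real c + 1))"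
    by (rule divide_right_mono) simp
  moreover have "(1 - 2 / real c) * (real c + 1) / (2 * real c * (real c + 1)) = (1 - 2 / real c) / (2 * real c)"
    by simp
  ultimately show ?thesis using weight_base[OF assms] by simp
qed

text \<open>The left side is the deficit of a low vertex plus the share it lends. The right side is
  what \<open>c - t\<close> digons to vertices of degree \<open>2 * c + 2 * t\<close> bring.\<close>

lemma weight_exceptional:
  assumes "4 \<le> c" "1 \<le> t" "t + 1 \<le> c"
  shows "1 - 2 / real c + (1 - 2 / real c) / real c \<le> 2 * real (c - t) * weight c (2 * c + 2 * t)"
proof -
  have t: "1 \<le> real t" "real t + 1 \<le> real c" using assms by linarith+
  have c: "0 < real c" using assms by simp
  have w: "weight c (2 * c + 2 * t) = (2 * real t - 1 + 2 / real c) / (2 * (real c + real t))"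
    by (simp add: weight_def)
  have cancel: "2 * p * (q / (2 * r)) = p * q / r" for p q r :: real by simp
  have "2 * real (c - t) * weight c (2 * c + 2 * t)
      = (real c - real t) * (2 * real t - 1 + 2 / real c) / (real c + real t)"
    unfolding w cancel using assms by (simp only: of_nat_diff)
  also have "(real c - real t) * (2 * real t - 1 + 2 / real c)
      = (1 - 2 / real c) * (real c + real t) + (2 + 2 * ((real t - 1) * (real c - 1 - real t)))"
    using c by (simp add: field_simps)
  also have "\<dots> / (real c + real t)
      = 1 - 2 / real c + (2 + 2 * ((real t - 1) * (real c - 1 - real t))) / (real c + real t)"
    using c t by (simp add: add_divide_distrib)
  finally have eq: "2 * real (c - t) * weight c (2 * c + 2 * t)
      = 1 - 2 / real c + (2 + 2 * ((real t - 1) * (real c - 1 - real t))) / (real c + real t)" .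
  have "0 \<le> (real t - 1) * (real c - 1 - real t)" using t by (intro mult_nonneg_nonneg) auto
  then have "2 / (2 * real c) \<le> (2 + 2 * ((real t - 1) * (real c - 1 - real t))) / (real c + real t)"
    using t c by (intro frac_le) auto
  moreover have "(1 - 2 / real c) / real c \<le> 2 / (2 * real c)"
    using c by (simp add: divide_right_mono)
  ultimately show ?thesis using eq by linarith
qed

text \<open>A simple arc raises only one of the two degrees by \<open>t\<close>, hence
  \<open>2 * c + t\<close>. For \<open>t = 1\<close> the inequality fails; that case is left to the
  kernel method.\<close>

lemma weight_cluster:
  assumes "4 \<le> c" "2 \<le> t" "t + 1 \<le> c"
  shows "1 - 2 / real c \<le> 2 * real (c + 1 - t) * weight c (2 * c + t)"
proof -
  have t: "2 \<le> real t" "real t + 1 \<le> real c" using assms by linarith+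
  have c: "0 < real c" "1 / real c \<le> 1 / 4" using assms by (auto simp: field_simps)
  have "0 \<le> (real t - 2) * (real c - 1 - real t)" using t by (intro mult_nonneg_nonneg) auto
  moreover have "(1 / real c) * (real t - 2) \<le> 1 / 4 * (real t - 2)"
    using c t by (intro mult_right_mono) auto
  moreover have "1 / 4 * (real t - 2) * 2 \<le> real t + 2" using t by simp
  ultimately have "0 \<le> 2 * ((real t - 2) * (real c - 1 - real t)) + (real t + 2) - 2 * ((1 / real c) * (real t - 2))"
    by linarith
  also have "\<dots> = 2 * (real c + 1 - real t) * (real t - 1 + 2 / real c) - (1 - 2 / real c) * (2 * real c + real t)"
    using c by (simp add: field_simps)
  finally have "(1 - 2 / real c) * (2 * real c + real t) \<le> 2 * (real c + 1 - real t) * (real t - 1 + 2 / real c)"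
    by simp
  then have "1 - 2 / real c \<le> 2 * (real c + 1 - real t) * (real t - 1 + 2 / real c) / (2 * real c + real t)"
    using c t by (simp add: pos_le_divide_eq)
  also have "\<dots> = 2 * real (c + 1 - t) * weight c (2 * c + t)"
    using assms by (simp add: weight_def of_nat_diff algebra_simps)
  finally show ?thesis .
qed

section \<open>Payments received by vertices of minimum degree\<close>

context min_counterexample
begin

definition deg :: "'a \<Rightarrow> nat" where
  "deg v = card (out_nb E v) + card (in_nb E v)"

definition high :: "'a set" where
  "high = {v \<in> V. 2 * c + 2 \<le> deg v}"

text \<open>Payments go along arcs, so a digon neighbour pays twice; vertices of degree
  \<open>2 * c + 1\<close> pay nothing here.\<close>

definition gain :: "'a \<Rightarrow> real" where
  "gain x = (\<Sum>y\<in>out_nb E x \<inter> high. weight c (deg y)) + (\<Sum>y\<in>in_nb E x \<inter> high. weight c (deg y))"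

lemma weight_nonneg: "2 * c + 2 \<le> d \<Longrightarrow> 0 \<le> weight c d"
  using weight_mono[OF c4 order_refl] weight_base[OF c4] order_trans[of 0 "weight c (2 * c + 2)"] by simp

lemma gain_ge:
  assumes "2 * c + 2 \<le> d" "P \<subseteq> out_nb E x" "Q \<subseteq> in_nb E x"
    and "\<And>y. y \<in> P \<union> Q \<Longrightarrow> d \<le> deg y"
  shows "real (card P + card Q) * weight c d \<le> gain x"
proof -
  have h: "P \<subseteq> out_nb E x \<inter> high" "Q \<subseteq> in_nb E x \<inter> high"
    using assms nb_V by (fastforce simp: high_def)+
  have w: "weight c d \<le> weight c (deg y)" if "y \<in> P \<union> Q" for y
    by (rule weight_mono[OF c4 assms(1) assms(4)[OF that]])
  have "real (card P) * weight c d \<le> (\<Sum>y\<in>P. weight c (deg y))"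
    using sum_bounded_below[of P "weight c d" "\<lambda>y. weight c (deg y)"] w by simp
  also have "\<dots> \<le> (\<Sum>y\<in>out_nb E x \<inter> high. weight c (deg y))"
    by (rule sum_mono2) (use h weight_nonneg in \<open>auto simp: high_def\<close>)
  finally have 1: "real (card P) * weight c d \<le> (\<Sum>y\<in>out_nb E x \<inter> high. weight c (deg y))" .
  have "real (card Q) * weight c d \<le> (\<Sum>y\<in>Q. weight c (deg y))"
    using sum_bounded_below[of Q "weight c d" "\<lambda>y. weight c (deg y)"] w by simp
  also have "\<dots> \<le> (\<Sum>y\<in>in_nb E x \<inter> high. weight c (deg y))"
    by (rule sum_mono2) (use h weight_nonneg in \<open>auto simp: high_def\<close>)
  finally show ?thesis using 1 by (simp add: gain_def distrib_right)
qed

text \<open>All neighbours outside the twin class other than \<open>y\<close> are digon neighbours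
  and not low, so both their degrees are at least \<open>c + t\<close>.\<close>

lemma gain_exceptional:
  assumes "exceptional x y"
  shows "1 - 2 / real c + (1 - 2 / real c) / real c \<le> gain x"
proof -
  let ?T = "cluster E x"
  define t where "t = card ?T"
  have low: "low x" using assms by (simp add: exceptional_def)
  then have xV: "x \<in> V" by (simp add: low_def)
  have t: "1 \<le> t" "t + 1 \<le> c" using cluster_card_pos[OF xV] cluster_card_le[OF low] by (auto simp: t_def)
  define P where "P = out_nb E x - ?T - {y}"
  have "y \<in> out_nb E x - ?T" using assms by (simp add: exceptional_def)
  then have "card (out_nb E x - ?T) = card P + 1"
    using card_Suc_Diff1[of "out_nb E x - ?T" y] by (simp add: P_def)
  then have "card P + t = c" using cluster_out[OF xV] low by (simp add: low_def t_def)
  then have cP: "card P = c - t" by linarith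
  have dP: "2 * c + 2 * t \<le> deg a" if a: "a \<in> P" for a
  proof -
    have xa: "(x, a) \<in> E" "a \<notin> ?T" "a \<noteq> y" using a by (auto simp: P_def)
    have ax: "(a, x) \<in> E" using exceptional_in[OF assms] xa by auto
    have "\<not> low a" using exceptional_low_nb[OF assms] xa by blast
    moreover have "\<not> exceptional x a" using exceptional_unique[OF assms] xa(3) by blast
    ultimately show ?thesis
      using digon_in[OF low xa(1) ax xa(2)] digon_out[OF low xa(1) ax xa(2)] by (simp add: deg_def t_def)
  qed
  have "real (card P + card P) * weight c (2 * c + 2 * t) \<le> gain x"
    by (rule gain_ge) (use dP t exceptional_in[OF assms] in \<open>auto simp: P_def\<close>)
  then show ?thesis using weight_exceptional[OF c4 t] cP by simp
qed

text \<open>A low digon neighbour outside the class would have \<open>x\<close> as its exception,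
  which \<open>exceptional_no_twin\<close> forbids for a vertex with twins.\<close>

lemma gain_cluster:
  assumes "low x" "\<And>y. \<not> exceptional x y" "2 \<le> card (cluster E x)"
  shows "1 - 2 / real c \<le> gain x"
proof -
  let ?T = "cluster E x"
  define t where "t = card ?T"
  have xV: "x \<in> V" using assms(1) by (simp add: low_def)
  have t: "2 \<le> t" "t + 1 \<le> c" using assms(3) cluster_card_le[OF assms(1)] by (auto simp: t_def)
  have cT: "card (out_nb E x - ?T) = c + 1 - t" "card (in_nb E x - ?T) = c + 1 - t"
    using cluster_out[OF xV] cluster_in[OF xV] assms(1) by (simp_all add: low_def t_def)
  have d: "2 * c + t \<le> deg y" if y: "y \<in> (out_nb E x - ?T) \<union> (in_nb E x - ?T)" for y
  proof -
    have yV: "y \<in> V" "y \<notin> ?T" using y nb_V[of x] by blast+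
    note dy = degree_ge[OF yV(1)]
    consider "(x, y) \<in> E" "(y, x) \<notin> E" | "(y, x) \<in> E" "(x, y) \<notin> E" | "(x, y) \<in> E" "(y, x) \<in> E"
      using y by auto
    then show ?thesis
    proof cases
      case 1
      then show ?thesis using simple_out[OF assms(1) 1] dy by (simp add: deg_def t_def)
    next
      case 2
      then show ?thesis using simple_in[OF assms(1) 2] dy by (simp add: deg_def t_def)
    next
      case 3
      have "\<not> low y"
      proof
        assume "low y"
        then have "exceptional y x" using low_digon[OF assms(1) _ 3 yV(2)] assms(2) by blast
        then have "cluster E x = {x}" by (rule exceptional_no_twin)
        then show False using assms(3) by simp
      qed
      then show ?thesis
        using digon_in[OF assms(1) 3 yV(2)] digon_out[OF assms(1) 3 yV(2)] assms(2)
        by (simp add: deg_def t_def)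
    qed
  qed
  have "real (card (out_nb E x - ?T) + card (in_nb E x - ?T)) * weight c (2 * c + t) \<le> gain x"
    by (rule gain_ge) (use d t in auto)
  then have "2 * real (c + 1 - t) * weight c (2 * c + t) \<le> gain x"
    unfolding cT by simp
  then show ?thesis using weight_cluster[OF c4 t] by linarith
qed

text \<open>An exceptional vertex passes part of its surplus on to its unique exceptional neighbour.\<close>

definition lenders :: "'a \<Rightarrow> 'a set" where
  "lenders x = {z. exceptional z x}"

lemma finite_lenders [simp]: "finite (lenders x)"
  by (rule finite_subset[of _ V]) (use fin in \<open>auto simp: lenders_def exceptional_def low_def\<close>)

text \<open>One low digon neighbour makes all arcs at \<open>x\<close> digons. Its low neighbours
  are lenders and the others pay for two arcs each; the share of a lender equals two payments at the
  rate of \<open>weight_base_ge\<close>.\<close>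

lemma gain_low_digon:
  assumes "low x" "\<And>y. \<not> exceptional x y" "cluster E x = {x}"
    and z: "low z" "(x, z) \<in> E" "(z, x) \<in> E"
  shows "1 - 2 / real c - (1 - 2 / real c) / real c * real (card (lenders x)) \<le> gain x"
proof -
  have "z \<notin> cluster E x" using assms(3) z noloop by auto
  then have io: "in_nb E x = out_nb E x" using low_digon_out_eq_in[OF assms(1) z] by blast
  define P where "P = out_nb E x - lenders x"
  have d: "2 * c + 2 \<le> deg y" if y: "y \<in> P" for y
  proof -
    have xy: "(x, y) \<in> E" "(y, x) \<in> E" using y io by (auto simp: P_def)
    have yT: "y \<notin> cluster E x" using xy assms(3) noloop by auto
    have "\<not> low y" using low_digon[OF assms(1) _ xy yT] assms(2) y by (auto simp: P_def lenders_def)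
    then show ?thesis
      using digon_in[OF assms(1) xy yT] digon_out[OF assms(1) xy yT] assms(2,3) by (simp add: deg_def)
  qed
  have "card (out_nb E x) - card (lenders x) \<le> card P"
    unfolding P_def by (rule diff_card_le_card_Diff) simp
  then have cP: "real c - real (card (lenders x)) \<le> real (card P)" using assms(1) by (simp add: low_def)
  let ?h = "(1 - 2 / real c) / (2 * real c)"
  have h: "0 \<le> ?h" using c4 by (auto simp: field_simps)
  have "2 * (real c - real (card (lenders x))) * ?h \<le> 2 * real (card P) * ?h"
    using cP h by (intro mult_right_mono) auto
  also have "\<dots> \<le> 2 * real (card P) * weight c (2 * c + 2)"
    using weight_base_ge[OF c4] by (intro mult_left_mono) auto
  also have "\<dots> = real (card P + card P) * weight c (2 * c + 2)" by simp
  also have "\<dots> \<le> gain x" by (rule gain_ge) (use d io in \<open>auto simp: P_def\<close>)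
  finally have "2 * (real c - real (card (lenders x))) * ?h \<le> gain x" .
  moreover have "2 * (real c - real (card (lenders x))) * ?h
      = 1 - 2 / real c - (1 - 2 / real c) / real c * real (card (lenders x))"
    using c4 by (simp add: field_simps)
  ultimately show ?thesis by simp
qed

definition mid_in :: "'a set" where
  "mid_in = {v \<in> V. card (out_nb E v) = c \<and> card (in_nb E v) = c + 1}"

definition mid_out :: "'a set" where
  "mid_out = {v \<in> V. card (out_nb E v) = c + 1 \<and> card (in_nb E v) = c}"

text \<open>The remaining low vertices, isolated among the low ones: by \<open>isolated_nb\<close>
  all their neighbours have larger degree. The difficulty is neighbours of degree
  \<open>2 * c + 1\<close>.\<close>

definition isolated :: "'a set" where
  "isolated = {x. low x \<and> (\<forall>y. \<not> exceptional x y) \<and> cluster E x = {x} \<and>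
     (\<forall>z. low z \<longrightarrow> \<not> ((x, z) \<in> E \<and> (z, x) \<in> E))}"

lemma isolated_nb:
  assumes "x \<in> isolated"
  shows "y \<in> out_nb E x \<Longrightarrow> y \<in> mid_in \<or> 2 * c + 2 \<le> deg y"
    and "y \<in> in_nb E x \<Longrightarrow> y \<in> mid_out \<or> 2 * c + 2 \<le> deg y"
proof -
  have x: "low x" "\<not> exceptional x y" "cluster E x = {x}"
    "\<not> (low y \<and> (x, y) \<in> E \<and> (y, x) \<in> E)"
    using assms by (auto simp: isolated_def)
  have dig: "2 * c + 2 \<le> deg y" if "(x, y) \<in> E" "(y, x) \<in> E"
  proof -
    have "y \<notin> cluster E x" using x(3) that noloop by auto
    then show ?thesis
      using digon_in[OF x(1) that] digon_out[OF x(1) that] x that by (simp add: deg_def)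
  qed
  show "y \<in> mid_in \<or> 2 * c + 2 \<le> deg y" if y: "y \<in> out_nb E x"
  proof (cases "(y, x) \<in> E")
    case False
    have "y \<in> V" using y nb_V by blast
    then show ?thesis
      using simple_out[OF x(1) _ False] y x(3) degree_ge[of y] by (auto simp: mid_in_def deg_def)
  qed (use y dig in auto)
  show "y \<in> mid_out \<or> 2 * c + 2 \<le> deg y" if y: "y \<in> in_nb E x"
  proof (cases "(x, y) \<in> E")
    case False
    have "y \<in> V" using y nb_V by blast
    then show ?thesis
      using simple_in[OF x(1) _ False] y x(3) degree_ge[of y] by (auto simp: mid_out_def deg_def)
  qed (use y dig in auto)
qed

lemma gain_isolated:
  assumes "x \<in> isolated"
  shows "(2 * real c - real (card (out_nb E x \<inter> mid_in)) - real (card (in_nb E x \<inter> mid_out)))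
      * weight c (2 * c + 2) \<le> gain x"
proof -
  have x: "card (out_nb E x) = c" "card (in_nb E x) = c"
    using assms by (auto simp: isolated_def low_def)
  have "real (card (out_nb E x - mid_in) + card (in_nb E x - mid_out)) * weight c (2 * c + 2) \<le> gain x"
    by (rule gain_ge) (use isolated_nb[OF assms] in auto)
  moreover have "card (out_nb E x - mid_in) + card (out_nb E x \<inter> mid_in) = c"
    using x card_Diff_subset_Int[of "out_nb E x" mid_in] card_mono[of "out_nb E x" "out_nb E x \<inter> mid_in"]
    by simp
  moreover have "card (in_nb E x - mid_out) + card (in_nb E x \<inter> mid_out) = c"
    using x card_Diff_subset_Int[of "in_nb E x" mid_out] card_mono[of "in_nb E x" "in_nb E x \<inter> mid_out"]
    by simp
  ultimately show ?thesis
    by (smt (verit, best) of_nat_add)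
qed

lemma finite_isolated [simp]: "finite isolated"
  by (rule finite_subset[of _ V]) (use fin in \<open>auto simp: isolated_def low_def\<close>)

lemma sum_card_arcs:
  assumes "finite A"
  shows "(\<Sum>x\<in>A. card (out_nb E x \<inter> B)) = card (E \<inter> A \<times> B)"
proof -
  have "E \<inter> A \<times> B = (SIGMA x:A. out_nb E x \<inter> B)" by auto
  then show ?thesis using assms by (simp add: card_SigmaI)
qed

lemma isolated_out_sum: "(\<Sum>x\<in>isolated. card (out_nb E x \<inter> mid_in)) \<le> 2 * card isolated + 3 * card mid_in"
proof -
  have "card (E \<inter> isolated \<times> mid_in) \<le> 2 * card isolated + 3 * card mid_in"
  proof (rule sparse_pair)
    show "(u, v) \<notin> E" if "u \<in> isolated" "v \<in> isolated" for u v
      using isolated_nb(1)[OF that(1), of v] that(2) by (auto simp: isolated_def low_def mid_in_def deg_def)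
  qed (auto simp: isolated_def low_def mid_in_def)
  then show ?thesis by (simp add: sum_card_arcs)
qed

lemma isolated_in_sum: "(\<Sum>x\<in>isolated. card (in_nb E x \<inter> mid_out)) \<le> 2 * card isolated + 3 * card mid_out"
proof -
  interpret C: min_counterexample c V "E\<inverse>" by (rule converse)
  have "card (E\<inverse> \<inter> isolated \<times> mid_out) \<le> 2 * card isolated + 3 * card mid_out"
  proof (rule C.sparse_pair)
    show "(u, v) \<notin> E\<inverse>" if "u \<in> isolated" "v \<in> isolated" for u v
      using isolated_nb(1)[OF that(2), of u] that(1) by (auto simp: isolated_def low_def mid_in_def deg_def)
  qed (auto simp: isolated_def low_def mid_out_def)
  then show ?thesis using C.sum_card_arcs[OF finite_isolated, of mid_out] by simp
qed

text \<open>All cases in one inequality fit for summation: lending enters with both signs, and for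
  isolated vertices the second \<open>of_bool\<close> replaces the deficit by their own count of
  payments.\<close>

lemma gain_low:
  assumes "low x"
  shows "1 - 2 / real c + (1 - 2 / real c) / real c * (of_bool (\<exists>y. exceptional x y) - real (card (lenders x)))
    + of_bool (x \<in> isolated) * ((2 * real c - real (card (out_nb E x \<inter> mid_in)) - real (card (in_nb E x \<inter> mid_out)))
      * weight c (2 * c + 2) - (1 - 2 / real c)) \<le> gain x"
proof -
  have h: "0 \<le> (1 - 2 / real c) / real c" using c4 by (auto simp: field_simps)
  then have l: "0 \<le> (1 - 2 / real c) / real c * real (card (lenders x))"
    by (rule mult_nonneg_nonneg) simp
  show ?thesis
  proof (cases "\<exists>y. exceptional x y")
    case True
    then show ?thesis
      using gain_exceptional l by (auto simp: isolated_def right_diff_distrib) (smt (verit))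
  next
    case ne: False
    have xV: "x \<in> V" using assms by (simp add: low_def)
    show ?thesis
    proof (cases "2 \<le> card (cluster E x)")
      case True
      then have "x \<notin> isolated" by (auto simp: isolated_def)
      then show ?thesis using gain_cluster[OF assms _ True] ne l by (simp add: right_diff_distrib)
    next
      case False
      then have "card (cluster E x) = 1" using cluster_card_pos[OF xV] by linarith
      then have T: "cluster E x = {x}" by (metis card_1_singletonE cluster_self singletonD)
      show ?thesis
      proof (cases "x \<in> isolated")
        case True
        then show ?thesis using gain_isolated[OF True] ne l by (simp add: right_diff_distrib)
      next
        case False
        then obtain z where "low z" "(x, z) \<in> E" "(z, x) \<in> E"
          using assms ne T by (auto simp: isolated_def)
        then show ?thesis using gain_low_digon[OF assms _ T] ne False by (simp add: right_diff_distrib)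
      qed
    qed
  qed
qed

section \<open>Balancing the payments over the whole digraph\<close>

definition lows :: "'a set" where
  "lows = {x \<in> V. low x}"

lemma finite_lows [simp]: "finite lows"
  using fin by (simp add: lows_def)

lemma sum_gain_ge:
  "(1 - 2 / real c) * real (card lows) - 2 / real c * real (card mid_in + card mid_out) \<le> (\<Sum>x\<in>lows. gain x)"
proof -
  let ?g = "1 - 2 / real c"
  let ?w = "weight c (2 * c + 2)"
  let ?ex = "\<lambda>x. \<exists>y. exceptional x y"
  let ?z = "\<lambda>x. (2 * real c - real (card (out_nb E x \<inter> mid_in)) - real (card (in_nb E x \<inter> mid_out))) * ?w - ?g"
  have sub: "isolated \<subseteq> lows" by (auto simp: isolated_def lows_def low_def)
  \<comment> \<open>Lending cannot lower the sum: by \<open>exceptional_unique\<close> each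
    exceptional vertex lends to at most one vertex.\<close>
  have "(\<Sum>x\<in>lows. card (lenders x)) = card (SIGMA x:lows. lenders x)"
    by (rule card_SigmaI[symmetric]) auto
  also have "\<dots> = card ((SIGMA x:lows. lenders x)\<inverse>)" by (simp add: card_inverse)
  also have "\<dots> \<le> card {x \<in> lows. ?ex x}"
  proof (rule card_inj_on_le[where f = fst])
    show "inj_on fst ((SIGMA x:lows. lenders x)\<inverse>)"
      by (auto simp: inj_on_def lenders_def intro: exceptional_unique)
    show "fst ` (SIGMA x:lows. lenders x)\<inverse> \<subseteq> {x \<in> lows. ?ex x}"
      by (auto simp: lenders_def lows_def exceptional_def low_def)
  qed simp
  finally have "(\<Sum>x\<in>lows. card (lenders x)) \<le> card {x \<in> lows. ?ex x}" .
  then have "(\<Sum>x\<in>lows. real (card (lenders x))) \<le> real (card {x \<in> lows. ?ex x})"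
    by (metis of_nat_le_iff of_nat_sum)
  moreover have "(\<Sum>x\<in>lows. of_bool (?ex x) :: real) = real (card {x \<in> lows. ?ex x})"
    by (simp add: Int_def)
  ultimately have "0 \<le> (\<Sum>x\<in>lows. of_bool (?ex x) - real (card (lenders x)))"
    by (simp add: sum_subtractf)
  moreover have "0 \<le> ?g / real c" using c4 by (auto simp: field_simps)
  ultimately have 1: "0 \<le> (\<Sum>x\<in>lows. ?g / real c * (of_bool (?ex x) - real (card (lenders x))))"
    unfolding sum_distrib_left[symmetric] by (intro mult_nonneg_nonneg)
  have "(\<Sum>x\<in>lows. of_bool (x \<in> isolated) * ?z x) = (\<Sum>x\<in>isolated. ?z x)"
    using sub by (simp add: of_bool_def if_distrib[of "\<lambda>a. a * _"] sum.If_cases Int_absorb1 cong: if_cong)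
  also have "\<dots> = (2 * real c * ?w - ?g) * real (card isolated)
      - ?w * (real (\<Sum>x\<in>isolated. card (out_nb E x \<inter> mid_in)) + real (\<Sum>x\<in>isolated. card (in_nb E x \<inter> mid_out)))"
    by (simp add: sum_subtractf sum.distrib sum_distrib_left algebra_simps)
  also have "\<dots> \<ge> (2 * real c * ?w - ?g) * real (card isolated)
      - ?w * (real (2 * card isolated + 3 * card mid_in) + real (2 * card isolated + 3 * card mid_out))"
    using isolated_out_sum isolated_in_sum weight_nonneg[of "2 * c + 2"]
    by (intro diff_left_mono mult_left_mono add_mono) (simp_all only: of_nat_le_iff order_refl)
  also have "(2 * real c * ?w - ?g) * real (card isolated)
      - ?w * (real (2 * card isolated + 3 * card mid_in) + real (2 * card isolated + 3 * card mid_out))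
      = ((2 * real c - 4) * ?w - ?g) * real (card isolated) - 3 * ?w * real (card mid_in + card mid_out)"
    by (simp add: algebra_simps)
  finally have 2: "((2 * real c - 4) * ?w - ?g) * real (card isolated) - 3 * ?w * real (card mid_in + card mid_out)
      \<le> (\<Sum>x\<in>lows. of_bool (x \<in> isolated) * ?z x)" .
  note w = weight_base[OF c4]
  \<comment> \<open>Of its \<open>2 * c\<close> possible payments an isolated vertex is charged with
    losing four; the other \<open>2 * c - 4\<close> still cover its deficit.\<close>
  have "0 \<le> ((2 * real c - 4) * ?w - ?g) * real (card isolated)"
  proof -
    have "(2 * real c - 4) * ?w - ?g = (real c - 2) / (real c * (real c + 1))"
    proof -
      have "real c \<noteq> 0" "real c + 1 \<noteq> 0" using c4 by linarith+
      then show ?thesis unfolding w by (simp add: divide_simps) (simp add: algebra_simps)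
    qed
    then show ?thesis using c4 by simp
  qed
  \<comment> \<open>The remaining losses, three for each vertex of degree \<open>2 * c + 1\<close>,
    are covered by the surplus \<open>2 / c\<close> of that vertex.\<close>
  moreover have "3 * ?w * real (card mid_in + card mid_out) \<le> 2 / real c * real (card mid_in + card mid_out)"
  proof (rule mult_right_mono)
    have "3 * (real c + 2) / (2 * (real c + 1)) \<le> 2" using c4 by (simp add: field_simps)
    then have "3 * (real c + 2) / (2 * (real c + 1)) / real c \<le> 2 / real c"
      by (rule divide_right_mono) simp
    then show "3 * ?w \<le> 2 / real c" unfolding w by (simp add: ac_simps)
  qed simp
  ultimately have 3: "- (2 / real c * real (card mid_in + card mid_out))
      \<le> (\<Sum>x\<in>lows. of_bool (x \<in> isolated) * ?z x)" using 2 by linarith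
  have "(\<Sum>x\<in>lows. ?g + ?g / real c * (of_bool (?ex x) - real (card (lenders x))) + of_bool (x \<in> isolated) * ?z x)
      \<le> (\<Sum>x\<in>lows. gain x)"
    by (rule sum_mono) (use gain_low in \<open>simp add: lows_def\<close>)
  moreover have "(\<Sum>x\<in>lows. ?g) = ?g * real (card lows)" by simp
  ultimately show ?thesis using 1 3 unfolding sum.distrib by linarith
qed

text \<open>Double counting: a vertex of \<open>high\<close> pays along at most all its arcs, and
  the weight times the degree is its whole surplus.\<close>

lemma sum_gain_le: "(\<Sum>x\<in>lows. gain x) \<le> (\<Sum>v\<in>high. real (deg v) - (2 * real c + 1 - 2 / real c))"
proof -
  have finH: "finite high" using fin by (simp add: high_def)
  have o: "(\<Sum>x\<in>lows. \<Sum>y\<in>out_nb E x \<inter> high. weight c (deg y)) = (\<Sum>y\<in>high. real (card (in_nb E y \<inter> lows)) * weight c (deg y))"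
  proof -
    have "(\<Sum>x\<in>lows. \<Sum>y\<in>{y \<in> high. (x, y) \<in> E}. weight c (deg y)) = (\<Sum>y\<in>high. \<Sum>x\<in>{x \<in> lows. (x, y) \<in> E}. weight c (deg y))"
      by (rule sum.swap_restrict) (simp_all add: finH)
    moreover have "out_nb E x \<inter> high = {y \<in> high. (x, y) \<in> E}" "in_nb E y \<inter> lows = {x \<in> lows. (x, y) \<in> E}" for x y
      by auto
    ultimately show ?thesis by simp
  qed
  have i: "(\<Sum>x\<in>lows. \<Sum>y\<in>in_nb E x \<inter> high. weight c (deg y)) = (\<Sum>y\<in>high. real (card (out_nb E y \<inter> lows)) * weight c (deg y))"
  proof -
    have "(\<Sum>x\<in>lows. \<Sum>y\<in>{y \<in> high. (y, x) \<in> E}. weight c (deg y)) = (\<Sum>y\<in>high. \<Sum>x\<in>{x \<in> lows. (y, x) \<in> E}. weight c (deg y))"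
      by (rule sum.swap_restrict) (simp_all add: finH)
    moreover have "in_nb E x \<inter> high = {y \<in> high. (y, x) \<in> E}" "out_nb E y \<inter> lows = {x \<in> lows. (y, x) \<in> E}" for x y
      by auto
    ultimately show ?thesis by simp
  qed
  have "(\<Sum>x\<in>lows. gain x) = (\<Sum>y\<in>high. real (card (in_nb E y \<inter> lows) + card (out_nb E y \<inter> lows)) * weight c (deg y))"
    using o i by (simp add: gain_def sum.distrib distrib_right)
  also have "\<dots> \<le> (\<Sum>v\<in>high. real (deg v) - (2 * real c + 1 - 2 / real c))"
  proof (rule sum_mono)
    fix y assume y: "y \<in> high"
    then have d: "2 * c + 2 \<le> deg y" by (simp add: high_def)
    have "card (in_nb E y \<inter> lows) \<le> card (in_nb E y)" "card (out_nb E y \<inter> lows) \<le> card (out_nb E y)"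
      by (auto intro: card_mono)
    then have "card (in_nb E y \<inter> lows) + card (out_nb E y \<inter> lows) \<le> deg y" by (simp add: deg_def)
    then have "real (card (in_nb E y \<inter> lows) + card (out_nb E y \<inter> lows)) * weight c (deg y) \<le> real (deg y) * weight c (deg y)"
      using weight_nonneg[OF d] by (intro mult_right_mono) (simp_all only: of_nat_le_iff)
    also have "\<dots> = real (deg y) - (2 * real c + 1 - 2 / real c)"
      using d by (simp add: weight_def)
    finally show "real (card (in_nb E y \<inter> lows) + card (out_nb E y \<inter> lows)) * weight c (deg y)
      \<le> real (deg y) - (2 * real c + 1 - 2 / real c)" .
  qed
  finally show ?thesis .
qed

lemma contradiction: False
proof -
  let ?k = "2 * real c + 1 - 2 / real c"
  have fins: "finite high" "finite mid_in" "finite mid_out" using fin by (auto simp: high_def mid_in_def mid_out_def)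
  have V: "V = lows \<union> (mid_in \<union> (mid_out \<union> high))"
  proof
    show "V \<subseteq> lows \<union> (mid_in \<union> (mid_out \<union> high))"
    proof
      fix v assume v: "v \<in> V"
      then show "v \<in> lows \<union> (mid_in \<union> (mid_out \<union> high))"
        using degree_ge[OF v] unfolding lows_def low_def mid_in_def mid_out_def high_def deg_def
        by (cases "card (out_nb E v) = c"; cases "card (in_nb E v) = c") auto
    qed
  qed (auto simp: lows_def mid_in_def mid_out_def high_def)
  have disj: "lows \<inter> (mid_in \<union> (mid_out \<union> high)) = {}" "mid_in \<inter> (mid_out \<union> high) = {}" "mid_out \<inter> high = {}"
    by (auto simp: lows_def low_def mid_in_def mid_out_def high_def deg_def)
  have "(\<Sum>v\<in>V. real (deg v) - ?k)
      = (\<Sum>v\<in>lows. real (deg v) - ?k) + ((\<Sum>v\<in>mid_in. real (deg v) - ?k) + ((\<Sum>v\<in>mid_out. real (deg v) - ?k)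
        + (\<Sum>v\<in>high. real (deg v) - ?k)))"
    using disj fins by (subst V) (simp add: sum.union_disjoint)
  also have "(\<Sum>v\<in>lows. real (deg v) - ?k) = (\<Sum>v\<in>lows. - (1 - 2 / real c))"
    by (rule sum.cong) (auto simp: lows_def low_def deg_def)
  also have "(\<Sum>v\<in>mid_in. real (deg v) - ?k) = (\<Sum>v\<in>mid_in. 2 / real c)"
    by (rule sum.cong) (auto simp: mid_in_def deg_def)
  also have "(\<Sum>v\<in>mid_out. real (deg v) - ?k) = (\<Sum>v\<in>mid_out. 2 / real c)"
    by (rule sum.cong) (auto simp: mid_out_def deg_def)
  finally have eq: "(\<Sum>v\<in>V. real (deg v) - ?k)
      = - ((1 - 2 / real c) * real (card lows)) + 2 / real c * real (card mid_in + card mid_out)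
        + (\<Sum>v\<in>high. real (deg v) - ?k)"
    by (simp add: algebra_simps)
  have "0 \<le> (\<Sum>v\<in>V. real (deg v) - ?k)"
    using eq sum_gain_ge sum_gain_le by linarith
  moreover have "(\<Sum>v\<in>V. real (deg v)) = 2 * real (card E)"
  proof -
    have "(\<Sum>v\<in>V. card (out_nb E v \<inter> V)) = card (E \<inter> V \<times> V)" by (rule sum_card_arcs[OF fin])
    moreover have "(\<Sum>v\<in>V. card (in_nb E v \<inter> V)) = card (E\<inverse> \<inter> V \<times> V)"
      using min_counterexample.sum_card_arcs[OF converse fin, of V] by simp
    moreover have "E\<inverse> \<inter> V \<times> V = E\<inverse>" "E \<inter> V \<times> V = E" using EV by auto
    moreover have "out_nb E v \<inter> V = out_nb E v" "in_nb E v \<inter> V = in_nb E v" for v using nb_V by auto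
    ultimately have "(\<Sum>v\<in>V. card (out_nb E v)) = card E" "(\<Sum>v\<in>V. card (in_nb E v)) = card E"
      by (simp_all add: card_inverse)
    moreover have "(\<Sum>v\<in>V. deg v) = (\<Sum>v\<in>V. card (out_nb E v)) + (\<Sum>v\<in>V. card (in_nb E v))"
      unfolding deg_def by (rule sum.distrib)
    ultimately have "(\<Sum>v\<in>V. deg v) = 2 * card E" by linarith
    then show ?thesis by (metis of_nat_mult of_nat_numeral of_nat_sum)
  qed
  ultimately have "?k * real (card V) \<le> 2 * real (card E)"
    by (simp add: sum_subtractf mult.commute)
  moreover have "?k * real (card V) = 2 * ((real c + 1 / 2 - 1 / real c) * real (card V))"
    by (simp add: algebra_simps)
  ultimately have "pot c E V \<le> 0" using pot_V by linarith
  moreover have "3 / 2 \<le> (real c - 1) / 2" using c4 by simp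
  then have "0 < potK c" using inv_c(2) unfolding potK_def by linarith
  ultimately show False using big by linarith
qed

end

theorem dicritical_rel_potential:
  assumes "4 \<le> c" "dicritical_rel c V E"
  shows "pot c E V \<le> potK c"
proof -
  \<comment> \<open>All lists have length three, so \<open>lenlex\<close> compares them
    lexicographically. More twin pairs must count as smaller, hence the subtraction;
    \<open>card V * card V\<close> bounds their number, which keeps it exact.\<close>
  let ?m = "\<lambda>(V :: 'a set, E). [card V, card E, card V * card V - card (twin_pairs V E)]"
  have "pot c (snd G) (fst G) \<le> potK c" if "dicritical_rel c (fst G) (snd G)" for G :: "'a set \<times> ('a \<times> 'a) set"
    using that
  proof (induction G rule: wf_induct[where r = "inv_image (lenlex less_than) ?m"])
    case 1
    show ?case by (intro wf_inv_image wf_lenlex) simp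
  next
    case (2 G)
    obtain V E where G: "G = (V, E)" by (cases G)
    have crit: "dicritical_rel c V E" using 2 by (simp add: G)
    show ?case
    proof (rule ccontr)
      assume neg: "\<not> ?case"
      have "min_counterexample c V E"
      proof
        fix W F assume WF: "dicritical_rel c W F" "smaller W F V E"
        have le: "card (twin_pairs W F) \<le> card W * card W"
        proof -
          have "finite W" using dicritical_relD(1)[OF WF(1)] .
          then have "card (twin_pairs W F) \<le> card (W \<times> W)" by (intro card_mono) (auto simp: twin_pairs_def)
          then show ?thesis by (simp add: card_cartesian_product)
        qed
        then have "((W, F), G) \<in> inv_image (lenlex less_than) ?m"
          using WF(2) by (auto simp: G smaller_def lenlex_conv)
        then show "pot c F W \<le> potK c" using 2(1) WF(1) by fastforce
      qed (use assms(1) crit neg in \<open>auto simp: G\<close>)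
      then show False by (rule min_counterexample.contradiction)
    qed
  qed
  from this[of "(V, E)"] show ?thesis using assms(2) by simp
qed

section \<open>Dicritical digraphs as relations\<close>

text \<open>A nonempty closed walk contains a cycle, so walks, and with them the transitive closure
  of the pairs of ends, decide acyclicity.\<close>

lemma acyclic_digraph_iff:
  assumes "wf_digraph H"
  shows "acyclic_digraph H \<longleftrightarrow> acyclic (arcs_ends H)"
proof -
  interpret wf_digraph H by fact
  have "(\<exists>p. cycle p) \<longleftrightarrow> (\<exists>u p. awalk u p u \<and> p \<noteq> [])"
    using closed_w_imp_cycle by (auto simp: cycle_def closed_w_def)
  then show ?thesis
    by (simp add: acyclic_digraph_def acyclic_def reachable1_awalk)
qed

lemma acyclic_digraph_induce:
  assumes "wf_digraph H" "S \<subseteq> verts H"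
  shows "acyclic_digraph (H \<restriction> S) \<longleftrightarrow> acyclic (arcs_ends H \<inter> S \<times> S)"
proof -
  interpret wf_digraph H by fact
  have "arcs_ends (H \<restriction> S) = arcs_ends H \<inter> S \<times> S"
    by (auto simp: arcs_ends_conv)
  then show ?thesis
    using acyclic_digraph_iff[OF wellformed_induce_subgraph] by simp
qed

lemma arcs_ends_verts:
  assumes "wf_digraph H"
  shows "arcs_ends H \<subseteq> verts H \<times> verts H"
proof -
  interpret wf_digraph H by fact
  show ?thesis by (auto simp: arcs_ends_conv)
qed

lemma acyclic_partition_imp_dicolourable:
  assumes "wf_digraph H" "acyclic_partition H P" "finite P" "card P \<le> c"
  shows "dicolourable c (verts H) (arcs_ends H)"
proof -
  have part: "partition_on (verts H) P" and ac: "\<And>S. S \<in> P \<Longrightarrow> acyclic_digraph (H \<restriction> S)"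
    using assms(2) by (auto simp: acyclic_partition_def)
  obtain e :: "'a set \<Rightarrow> nat" where e: "e ` P \<subseteq> {..<c}" "inj_on e P"
    using card_le_inj[of P "{..<c}"] assms(3,4) by auto
  define part_of where "part_of v = (SOME S. S \<in> P \<and> v \<in> S)" for v
  have po: "part_of v \<in> P \<and> v \<in> part_of v" if "v \<in> verts H" for v
    unfolding part_of_def by (rule someI_ex) (use part that in \<open>auto simp: partition_on_def\<close>)
  define f where "f v = e (part_of v)" for v
  let ?E = "arcs_ends H"
  have same: "v \<in> part_of u" if "u \<in> verts H" "v \<in> verts H" "f u = f v" for u v
  proof -
    have "part_of u = part_of v" using that po e(2) by (auto simp: f_def dest: inj_onD)
    then show ?thesis using po[OF that(2)] by simp
  qed
  have "dicol c (verts H) ?E f"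
    unfolding dicol_def
  proof
    show "f ` verts H \<subseteq> {..<c}" using po e(1) by (auto simp: f_def)
    let ?m = "mono_arcs f (?E \<inter> verts H \<times> verts H)"
    show "acyclic ?m"
    proof (rule acyclicI, rule allI, rule notI)
      fix x assume x: "(x, x) \<in> ?m\<^sup>+"
      have "f u = f v \<and> v \<in> verts H \<and> (u, v) \<in> (?E \<inter> part_of u \<times> part_of u)\<^sup>+" if "(u, v) \<in> ?m\<^sup>+" "u \<in> verts H" for u v
        using that
      proof (induction rule: trancl_induct)
        case (base y)
        then show ?case using same[of u y] po[of u] by auto
      next
        case (step y z)
        then have "f u = f y" "f y = f z" "y \<in> verts H" "z \<in> verts H" "(y, z) \<in> ?E" by auto
        moreover then have "y \<in> part_of u" "z \<in> part_of u" using same[of u] step.prems by auto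
        ultimately show ?case using step by (auto intro: trancl_into_trancl)
      qed
      moreover have xV: "x \<in> verts H" using x by (metis (no_types, lifting) IntD2 SigmaD1 mem_mono_arcs tranclD)
      ultimately have "\<not> acyclic (?E \<inter> part_of x \<times> part_of x)" using x by (auto simp: acyclic_def)
      moreover have "part_of x \<subseteq> verts H" using po[OF xV] part by (auto simp: partition_on_def)
      ultimately show False using acyclic_digraph_induce[OF assms(1)] ac po[OF xV] by blast
    qed
  qed
  then show ?thesis by (auto simp: dicolourable_def)
qed

lemma dicol_imp_acyclic_partition:
  assumes "wf_digraph H" "dicol c (verts H) (arcs_ends H) f"
  shows "\<exists>P. acyclic_partition H P \<and> finite P \<and> card P \<le> c"
proof -
  let ?P = "(\<lambda>i. {v \<in> verts H. f v = i}) ` f ` verts H"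
  have sub: "f ` verts H \<subseteq> {..<c}" using assms(2) by (simp add: dicol_def)
  then have fin: "finite (f ` verts H)" using finite_subset by blast
  have "card ?P \<le> card (f ` verts H)" by (rule card_image_le[OF fin])
  also have "\<dots> \<le> c" using card_mono[OF _ sub] by simp
  finally have "card ?P \<le> c" .
  moreover have "acyclic_partition H ?P"
    unfolding acyclic_partition_def
  proof
    show "partition_on (verts H) ?P"
      by (rule partition_onI) (auto simp: disjnt_def)
    show "\<forall>S\<in>?P. acyclic_digraph (H \<restriction> S)"
    proof
      fix S assume "S \<in> ?P"
      then obtain i where S: "S = {v \<in> verts H. f v = i}" by blast
      have "acyclic (arcs_ends H \<inter> S \<times> S)"
        by (rule acyclic_subset[of "mono_arcs f (arcs_ends H \<inter> verts H \<times> verts H)"])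
           (use assms(2) in \<open>auto simp: dicol_def S\<close>)
      moreover have "S \<subseteq> verts H" using S by auto
      ultimately show "acyclic_digraph (H \<restriction> S)"
        using acyclic_digraph_induce[OF assms(1)] by simp
    qed
  qed
  ultimately show ?thesis using fin by blast
qed

lemma dichromatic_number_le_iff:
  assumes "digraph H"
  shows "dichromatic_number H \<le> c \<longleftrightarrow> dicolourable c (verts H) (arcs_ends H)"
proof -
  interpret digraph H by fact
  have wf: "wf_digraph H" by unfold_locales
  let ?Q = "\<lambda>n. \<exists>P. acyclic_partition H P \<and> finite P \<and> card P = n"
  have loop: "(v, v) \<notin> arcs_ends H" for v using no_loops by (auto simp: arcs_ends_conv)
  \<comment> \<open>An injective colouring shows that the set under \<open>LEAST\<close> is not
    empty, so the minimum is attained.\<close>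
  obtain f where f: "f ` verts H \<subseteq> {..<card (verts H)}" "inj_on f (verts H)"
    using card_le_inj[of "verts H" "{..<card (verts H)}"] by auto
  have "mono_arcs f (arcs_ends H \<inter> verts H \<times> verts H) \<subseteq> {}"
  proof (rule subrelI)
    fix u v assume "(u, v) \<in> mono_arcs f (arcs_ends H \<inter> verts H \<times> verts H)"
    then show "(u, v) \<in> {}" using inj_onD[OF f(2), of u v] loop[of u] by auto
  qed
  then have "dicol (card (verts H)) (verts H) (arcs_ends H) f" using f(1) by (simp add: dicol_def)
  then obtain P0 where "acyclic_partition H P0 \<and> finite P0"
    using dicol_imp_acyclic_partition[OF wf] by blast
  then have "?Q (card P0)" by blast
  then have "?Q (dichromatic_number H)" unfolding dichromatic_number_def by (rule LeastI)
  then obtain P where P: "acyclic_partition H P" "finite P" "card P = dichromatic_number H" by blast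
  show ?thesis
  proof
    assume "dichromatic_number H \<le> c"
    then show "dicolourable c (verts H) (arcs_ends H)"
      using acyclic_partition_imp_dicolourable[OF wf P(1,2)] P(3) by simp
  next
    assume "dicolourable c (verts H) (arcs_ends H)"
    then obtain P' where P': "acyclic_partition H P'" "finite P'" "card P' \<le> c"
      using dicol_imp_acyclic_partition[OF wf] by (auto simp: dicolourable_def)
    have "dichromatic_number H \<le> card P'"
      unfolding dichromatic_number_def by (rule Least_le) (use P' in blast)
    then show "dichromatic_number H \<le> c" using P'(3) by linarith
  qed
qed

lemma dicritical_imp_dicritical_rel:
  assumes "digraph G" "dicritical k G" "0 < k"
  shows "dicritical_rel (k - 1) (verts G) (arcs_ends G)"
  unfolding dicritical_rel_def
proof (intro conjI allI impI)
  interpret digraph G by fact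
  show "finite (verts G)" by simp
  show "arcs_ends G \<subseteq> verts G \<times> verts G" by (rule arcs_ends_verts) unfold_locales
  show "irrefl (arcs_ends G)" using no_loops by (auto simp: irrefl_def arcs_ends_conv)
  show "\<not> dicolourable (k - 1) (verts G) (arcs_ends G)"
  proof -
    have "\<not> dichromatic_number G \<le> k - 1" using assms(2,3) by (auto simp: dicritical_def)
    then show ?thesis using dichromatic_number_le_iff[OF assms(1)] by blast
  qed
  fix V' E' assume VE: "V' \<subseteq> verts G" "E' \<subseteq> arcs_ends G" "E' \<subseteq> V' \<times> V'" "(V', E') \<noteq> (verts G, arcs_ends G)"
  \<comment> \<open>Keeping the tail and head maps of \<open>G\<close> makes \<open>H\<close> a
    \<open>subgraph\<close>; its arcs are all those with ends in \<open>E'\<close>.\<close>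
  define H where "H = \<lparr>verts = V', arcs = {e \<in> arcs G. arc_to_ends G e \<in> E'}, tail = tail G, head = head G\<rparr>"
  have wfH: "wf_digraph H" using VE(3) by unfold_locales (auto simp: H_def arc_to_ends_def)
  have wfG: "wf_digraph G" by unfold_locales
  have sub: "subgraph H G"
    by (rule subgraphI[OF _ _ _ wfH wfG]) (use VE(1) in \<open>auto simp: H_def compatible_def\<close>)
  have ends: "arcs_ends H = E'" using VE(2) by (auto simp: H_def arcs_ends_def arc_to_ends_def)
  have vH: "verts H = V'" by (simp add: H_def)
  have "H \<noteq> G"
  proof
    assume "H = G"
    then show False using VE(4) vH ends by simp
  qed
  then have "dichromatic_number H \<le> k - 1" using assms(2) sub by (simp add: dicritical_def)
  then have "dicolourable (k - 1) (verts H) (arcs_ends H)"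
    using dichromatic_number_le_iff[OF digraph_subgraph[OF sub]] by blast
  then show "dicolourable (k - 1) V' E'" by (simp only: ends vH)
qed

lemma card_arcs_ends:
  assumes "digraph G"
  shows "card (arcs_ends G) = card (arcs G)"
proof -
  interpret digraph G by fact
  show ?thesis unfolding arcs_ends_def by (rule card_image) (auto intro: inj_onI no_multi_arcs)
qed

theorem theorem1p10:
  fixes G :: "('a, 'b) pre_digraph" and k :: nat
  assumes "k \<ge> 5" and "digraph G" and "dicritical k G"
  shows "real (card (arcs G)) \<ge>
           (real k - 1 / 2 - 1 / (real k - 1)) * real (card (verts G))
             - real k * (1 / 2 - 1 / (real k - 1))"
proof -
  obtain c where k: "k = c + 1" and c: "4 \<le> c"
    using assms(1) that[of "k - 1"] by linarith
  interpret digraph G by fact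
  have "dicritical_rel c (verts G) (arcs_ends G)"
    using dicritical_imp_dicritical_rel[OF assms(2,3)] k by simp
  then have "pot c (arcs_ends G) (verts G) \<le> potK c"
    by (rule dicritical_rel_potential[OF c])
  moreover have "arcs_ends G \<inter> verts G \<times> verts G = arcs_ends G"
    using arcs_ends_verts[OF wf_digraph] by blast
  ultimately have pot: "(real c + 1 / 2 - 1 / real c) * real (card (verts G)) - real (card (arcs G)) \<le> potK c"
    by (simp add: pot_def card_arcs_ends[OF assms(2)])
  have coeff: "real k - 1 / 2 - 1 / (real k - 1) = real c + 1 / 2 - 1 / real c"
    by (simp add: k)
  have const: "real k * (1 / 2 - 1 / (real k - 1)) = potK c"
    using c by (simp add: k potK_def field_simps)
  show ?thesis unfolding coeff const using pot by linarith
qed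

end
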